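(* Let $d\in\mathbb{N}$, $1<p<\infty$, $0<q_0,q_1\le\infty$, $s_0,s_1\ge0$, and $-\infty<b_0,b_1<\infty$, with $b_i\ge-1/q_i$ if $s_i=0$ ($i=0,1$). Then $$\mathbf{B}^{s_0,b_0}_{p,q_0}(\mathbb{R}^d)\hookrightarrow\mathbf{B}^{s_1,b_1}_{p,q_1}(\mathbb{R}^d)$$ if and only if one of the following conditions is valid: (i) $s_0>s_1$; (ii) $s_0=s_1>0$, $q_0\le q_1$, and $b_0\ge b_1$; (iii) $s_0=s_1>0$, $q_0>q_1$, and $b_0+\frac1{q_0}>b_1+\frac1{q_1}$; (iv) $s_0=s_1=0$ and $b_0+\frac1{q_0}>b_1+\frac1{q_1}$; (v) $s_0=s_1=0$, $b_0+\frac1{q_0}=b_1+\frac1{q_1}$, and $q_0\le q_1$. The corresponding assertion for the periodic spaces $\mathbf{B}^{s,b}_{p,q}(\mathbb{T})$ also holds.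
   Context: Convention: $1/\infty=0$. $A\hookrightarrow B$ means $A\subset B$ with continuous inclusion. For $1\le p\le\infty$, $0<q\le\infty$, $b\in\mathbb{R}$, $s\ge0$, $\mathbf{B}^{s,b}_{p,q}(\mathbb{R}^d)$ is the set of $f\in L_p(\mathbb{R}^d)$ with finite quasi-norm $\|f\|_{L_p(\mathbb{R}^d)}+\left(\int_0^1(t^{-s}(1-\log t)^b\omega_k(f,t)_p)^q\frac{dt}{t}\right)^{1/q}$ (supremum over $0<t<1$ if $q=\infty$), where $k\in\mathbb{N}$, $k>s$, is fixed (different $k$ give equivalent quasi-norms), $\omega_k(f,t)_p=\sup_{|h|\le t}\|\Delta_h^kf\|_{L_p(\mathbb{R}^d)}$, $\Delta^1_hf(x)=f(x+h)-f(x)$, $\Delta_h^{k+1}=\Delta_h^1\Delta_h^k$. The periodic space $\mathbf{B}^{s,b}_{p,q}(\mathbb{T})$ on the unit circle $\mathbb{T}$ is defined in the same way with $L_p(\mathbb{T})$-norms. *)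

theory Defs
  imports "HOL-Analysis.Analysis"
begin

text \<open>Real powers of extended nonnegative reals, meant for exponents \<open>a > 0\<close>.\<close>

definition epowr :: "ennreal \<Rightarrow> real \<Rightarrow> ennreal" where
  "epowr x a = (if x = \<infinity> then \<infinity> else ennreal (enn2real x powr a))"

text \<open>
  Elements of \<open>L\<^sub>p\<close> are represented by measurable functions rather than by their classes modulo
  equality almost everywhere; all quantities below depend only on the class. Functions are
  complex-valued, and only finite \<open>p\<close> is covered. The measure \<open>M\<close> is Lebesgue measure on \<open>\<real>\<^sup>d\<close> or
  its restriction to one period.
\<close>

definition Lp_norm :: "'a measure \<Rightarrow> real \<Rightarrow> ('a \<Rightarrow> complex) \<Rightarrow> ennreal" where
  "Lp_norm M p f = epowr (\<integral>\<^sup>+x. ennreal (norm (f x) powr p) \<partial>M) (1 / p)"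

definition diff1 :: "'a::plus \<Rightarrow> ('a \<Rightarrow> complex) \<Rightarrow> 'a \<Rightarrow> complex" where
  "diff1 h f = (\<lambda>x. f (x + h) - f x)"

definition modulus :: "'a::real_normed_vector measure \<Rightarrow> real \<Rightarrow> nat \<Rightarrow> ('a \<Rightarrow> complex) \<Rightarrow> real \<Rightarrow> ennreal" where
  "modulus M p k f t = (SUP h\<in>{h. norm h \<le> t}. Lp_norm M p ((diff1 h ^^ k) f))"

definition besov_seminorm ::
    "'a::real_normed_vector measure \<Rightarrow> real \<Rightarrow> ennreal \<Rightarrow> real \<Rightarrow> real \<Rightarrow> nat \<Rightarrow> ('a \<Rightarrow> complex) \<Rightarrow> ennreal" where
  "besov_seminorm M p q s b k f =
    (let w = (\<lambda>t. ennreal (t powr (- s) * (1 - ln t) powr b) * modulus M p k f t)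
     in if q = \<infinity> then (SUP t\<in>{0<..<1}. w t)
        else epowr (\<integral>\<^sup>+t\<in>{0<..<1}. epowr (w t) (enn2real q) * ennreal (1 / t) \<partial>lborel)
               (1 / enn2real q))"

definition besov_norm ::
    "'a::real_normed_vector measure \<Rightarrow> real \<Rightarrow> ennreal \<Rightarrow> real \<Rightarrow> real \<Rightarrow> nat \<Rightarrow> ('a \<Rightarrow> complex) \<Rightarrow> ennreal" where
  "besov_norm M p q s b k f = Lp_norm M p f + besov_seminorm M p q s b k f"

definition Lp_Rd :: "real \<Rightarrow> (real^'d \<Rightarrow> complex) set" where
  "Lp_Rd p = {f \<in> borel_measurable lborel. Lp_norm lborel p f < \<infinity>}"

abbreviation besov_norm_Rd ::
    "real \<Rightarrow> ennreal \<Rightarrow> real \<Rightarrow> real \<Rightarrow> nat \<Rightarrow> (real^'d \<Rightarrow> complex) \<Rightarrow> ennreal" where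
  "besov_norm_Rd \<equiv> besov_norm lborel"

definition besov_Rd ::
    "real \<Rightarrow> ennreal \<Rightarrow> real \<Rightarrow> real \<Rightarrow> nat \<Rightarrow> (real^'d \<Rightarrow> complex) set" where
  "besov_Rd p q s b k = {f \<in> Lp_Rd p. besov_norm_Rd p q s b k f < \<infinity>}"

text \<open>
  Functions on the unit circle are \<open>2\<pi>\<close>-periodic functions of the angle, normed over one period
  with respect to arc length.
\<close>

definition circle_measure :: "real measure" where
  "circle_measure = restrict_space lborel {0..<2 * pi}"

definition Lp_T :: "real \<Rightarrow> (real \<Rightarrow> complex) set" where
  "Lp_T p = {f \<in> borel_measurable lborel.
     (\<forall>x. f (x + 2 * pi) = f x) \<and> Lp_norm circle_measure p f < \<infinity>}"

abbreviation besov_norm_T ::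
    "real \<Rightarrow> ennreal \<Rightarrow> real \<Rightarrow> real \<Rightarrow> nat \<Rightarrow> (real \<Rightarrow> complex) \<Rightarrow> ennreal" where
  "besov_norm_T \<equiv> besov_norm circle_measure"

definition besov_T :: "real \<Rightarrow> ennreal \<Rightarrow> real \<Rightarrow> real \<Rightarrow> nat \<Rightarrow> (real \<Rightarrow> complex) set" where
  "besov_T p q s b k = {f \<in> Lp_T p. besov_norm_T p q s b k f < \<infinity>}"

text \<open>
  \<open>A \<hookrightarrow> B\<close>: inclusion of sets that is continuous for the topologies given by the quasi-norms
  \<open>NA\<close> on \<open>A\<close> and \<open>NB\<close> on \<open>B\<close>.
\<close>

definition continuously_embedded ::
    "('a \<Rightarrow> complex) set \<Rightarrow> (('a \<Rightarrow> complex) \<Rightarrow> ennreal) \<Rightarrow>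
     ('a \<Rightarrow> complex) set \<Rightarrow> (('a \<Rightarrow> complex) \<Rightarrow> ennreal) \<Rightarrow> bool" where
  "continuously_embedded A NA B NB \<longleftrightarrow>
     A \<subseteq> B \<and>
     (\<forall>f\<in>A. \<forall>\<epsilon>::real. \<epsilon> > 0 \<longrightarrow>
        (\<exists>\<delta>::real. \<delta> > 0 \<and>
          (\<forall>g\<in>A. NA (\<lambda>x. g x - f x) < ennreal \<delta> \<longrightarrow> NB (\<lambda>x. g x - f x) < ennreal \<epsilon>)))"

text \<open>
  In \<open>ennreal\<close> one has \<open>1 / \<infinity> = 0\<close>, which is the usual convention for \<open>1 / q\<close> with \<open>q = \<infinity>\<close>.
\<close>

definition recip :: "ennreal \<Rightarrow> real" where
  "recip q = enn2real (1 / q)"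

end

theory Submission
  imports Defs
begin

text \<open>
  Sampling the modulus of smoothness at \<open>t = 2 powr (- n)\<close> turns the seminorm into a weighted
  \<open>\<ell>\<^sub>q\<close> quasi-norm of a decreasing sequence. Marchaud's inequality and a discrete Hardy inequality
  show that the order of the difference is irrelevant, so one order serves both spaces.
  Sufficiency is then a statement about sequences; for \<open>s = 0\<close> the monotonicity of the sequence
  gives \<open>x n = O((1 + n) powr (- (b + 1 / q)))\<close>.

  For necessity, continuity at 0 and homogeneity give a norm inequality, which is tested on
  finite sums \<open>\<Sum>a j * G j\<close> of \<open>Lp\<close>-normalized nonnegative spline bumps \<open>G j\<close> at scale \<open>2 powr (- j)\<close>,
  all supported just to one side of a hyperplane through the origin. The triangle inequality
  bounds the modulus from above by \<open>\<Sum>a j * min 1 (2 powr (j - n)) ^ k\<close>. A step \<open>h\<close> across the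
  hyperplane gives the lower bound \<open>a n\<close>, because there all terms of the difference but one vanish.
\<close>

section \<open>Weighted sequence quasi-norms\<close>

text \<open>Nonnegative summands cannot cancel, so the pointwise lower bound costs nothing, and the
  upper bound needs only the triangle inequality. The price shows at \<open>s = 0\<close>: the upper
  bound for the modulus at level n contains the undamped tail of the coefficients beyond n. For
  \<open>s > 0\<close> the weight makes up for it. For \<open>s = 0\<close> the full sequence (1 +
  j)^(-c) has tails larger than (1 + n)^(-c) by a factor of order n if c > 1, and tails that are
  unbounded in N if c <= 1. The borderline case therefore puts coefficients only on powers of 2,
  where tails are geometric, and lets the monotonicity of the modulus fill the gaps. Failures that
  depend on the fine indices alone come from the borderline sequence (1 + n)^(-1/q), whose truncated
  ell_q norm is the power 1/q of a divergent harmonic sum: different q give different powers. Space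
  enters only through the translation invariance of the Lp norm and the existence of bumps, so
  Euclidean space and the circle share one argument.\<close>

definition wt :: "real \<Rightarrow> real \<Rightarrow> nat \<Rightarrow> real" where
  "wt s b n = 2 powr (s * real n) * (1 + real n) powr b"

text \<open>A bound on all finite partial sums instead of a norm: no convergence question and no
  infinite value arises, and constants are tracked through \<open>R\<close>. For nonnegative
  \<open>y\<close> and \<open>R\<close> it says that the ell_q quasi-norm is at most
  \<open>R\<close>.\<close>

definition lq_le :: "ennreal \<Rightarrow> (nat \<Rightarrow> real) \<Rightarrow> real \<Rightarrow> bool" where
  "lq_le q y R \<longleftrightarrow> (if q = \<infinity> then \<forall>n. y n \<le> R
     else \<forall>N. (\<Sum>n<N. y n powr enn2real q) \<le> R powr enn2real q)"

lemma lq_le_top: "lq_le top y R \<longleftrightarrow> (\<forall>n. y n \<le> R)"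
  by (simp add: lq_le_def)

lemma lq_le_real: "0 < r \<Longrightarrow> lq_le (ennreal r) y R \<longleftrightarrow> (\<forall>N. (\<Sum>n<N. y n powr r) \<le> R powr r)"
  by (simp add: lq_le_def)

lemma recip_top [simp]: "recip top = 0"
  by (simp add: recip_def)

lemma recip_ennreal: "0 < r \<Longrightarrow> recip (ennreal r) = 1 / r"
  by (simp add: recip_def divide_ennreal flip: ennreal_1)

lemma exponent_cases [consumes 1, case_names top real]:
  fixes q :: ennreal
  assumes "0 < q"
  obtains "q = top" | r where "0 < r" "q = ennreal r"
  using assms by (cases q) auto

lemma wt_pos: "0 < wt s b n"
  by (simp add: wt_def)

lemma wt_nonneg: "0 \<le> wt s b n"
  using wt_pos[of s b n] by simp

lemma wt_0 [simp]: "wt s b 0 = 1"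
  by (simp add: wt_def)

lemma lq_le_term:
  assumes "0 < q" "\<And>n. 0 \<le> y n" "0 \<le> R" "lq_le q y R"
  shows "y n \<le> R"
  using assms(1)
proof (cases q rule: exponent_cases)
  case top
  then show ?thesis using assms by (simp add: lq_le_top)
next
  case (real r)
  have "y n powr r \<le> (\<Sum>i<Suc n. y i powr r)"
    by (rule member_le_sum) auto
  also have "\<dots> \<le> R powr r"
    using assms(4) real lq_le_real by blast
  finally show ?thesis
    using powr_less_mono2[OF \<open>0 < r\<close> \<open>0 \<le> R\<close>, of "y n"] by (cases "y n \<le> R") auto
qed

lemma lq_le_mono:
  assumes "0 < q" "\<And>n. 0 \<le> y n" "\<And>n. y n \<le> z n" "lq_le q z R"
  shows "lq_le q y R"
  using assms(1)
proof (cases q rule: exponent_cases)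
  case top
  then show ?thesis using assms(3,4) by (auto simp: lq_le_top intro: order_trans)
next
  case (real r)
  have "(\<Sum>n<N. y n powr r) \<le> R powr r" for N
  proof -
    have "(\<Sum>n<N. y n powr r) \<le> (\<Sum>n<N. z n powr r)"
      using assms real by (intro sum_mono powr_mono2) auto
    also have "\<dots> \<le> R powr r" using assms(4) real lq_le_real by blast
    finally show ?thesis .
  qed
  then show ?thesis using real lq_le_real by blast
qed

lemma lq_le_scale:
  assumes "0 < q" "\<And>n. 0 \<le> y n" "0 \<le> R" "0 \<le> c" "lq_le q y R"
  shows "lq_le q (\<lambda>n. c * y n) (c * R)"
  using assms(1)
proof (cases q rule: exponent_cases)
  case top
  then show ?thesis using assms by (auto simp: lq_le_top mult_left_mono)
next
  case (real r)
  have "(\<Sum>n<N. (c * y n) powr r) \<le> (c * R) powr r" for N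
  proof -
    have "(\<Sum>n<N. (c * y n) powr r) = c powr r * (\<Sum>n<N. y n powr r)"
      using assms by (simp add: powr_mult sum_distrib_left)
    also have "\<dots> \<le> c powr r * R powr r"
      using assms(5) real lq_le_real by (intro mult_left_mono) auto
    finally show ?thesis using assms by (simp add: powr_mult)
  qed
  then show ?thesis using real lq_le_real by blast
qed

lemma lq_le_mono_bound:
  assumes "0 < q" "0 \<le> R" "R \<le> R'" "lq_le q y R"
  shows "lq_le q y R'"
  using assms(1)
proof (cases q rule: exponent_cases)
  case top
  then show ?thesis using assms by (auto simp: lq_le_top intro: order_trans)
next
  case (real r)
  then have "R powr r \<le> R' powr r" using assms by (intro powr_mono2) auto
  then show ?thesis using assms real lq_le_real[of r] by (metis order_trans)
qed

text \<open>Every term is at most \<open>R\<close>, so the surplus power r1 - r0 of each term can be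
  replaced by the same power of \<open>R\<close>; the constant stays 1.\<close>

lemma lq_le_exponent_mono:
  assumes "0 < q0" "q0 \<le> q1" "\<And>n. 0 \<le> y n" "0 \<le> R" "lq_le q0 y R"
  shows "lq_le q1 y R"
proof -
  have le: "y n \<le> R" for n using lq_le_term assms by blast
  have "0 < q1" using assms by simp
  then show ?thesis
  proof (cases q1 rule: exponent_cases)
    case top
    then show ?thesis using le by (simp add: lq_le_top)
  next
    case (real r1)
    obtain r0 where r0: "0 < r0" "q0 = ennreal r0"
      using assms(1)
    proof (cases q0 rule: exponent_cases)
      case top
      then show ?thesis using assms(2) real by (simp add: top_unique)
    qed
    have r01: "r0 \<le> r1" using assms(2) r0 real by simp
    have "(\<Sum>n<N. y n powr r1) \<le> R powr r1" for N
    proof -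
      have "(\<Sum>n<N. y n powr r1) = (\<Sum>n<N. y n powr r0 * y n powr (r1 - r0))"
        by (simp flip: powr_add)
      also have "\<dots> \<le> (\<Sum>n<N. y n powr r0 * R powr (r1 - r0))"
        using le r01 assms by (intro sum_mono mult_left_mono powr_mono2) auto
      also have "\<dots> = (\<Sum>n<N. y n powr r0) * R powr (r1 - r0)"
        by (simp add: sum_distrib_right)
      also have "\<dots> \<le> R powr r0 * R powr (r1 - r0)"
        using assms(5) r0 lq_le_real by (intro mult_right_mono) auto
      finally show ?thesis by (simp flip: powr_add)
    qed
    then show ?thesis using real lq_le_real by blast
  qed
qed

text \<open>Serves the Marchaud recursion, whose starting value is controlled by the Lp norm and not
  by the given sequence. The constant pays for one additional term.\<close>

lemma lq_le_update_0:
  assumes "0 < q"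
  obtains C where "1 \<le> C"
    "\<And>y R. (\<And>n. 0 \<le> y n) \<Longrightarrow> 0 \<le> R \<Longrightarrow> lq_le q y R \<Longrightarrow> lq_le q (y(0 := R)) (C * R)"
  using assms
proof (cases q rule: exponent_cases)
  case top
  show ?thesis by (rule that[of 1]) (use top in \<open>auto simp: lq_le_top\<close>)
next
  case (real r)
  show ?thesis
  proof (rule that[of "2 powr (1 / r)"])
    show "1 \<le> 2 powr (1 / r)" using real by (intro ge_one_powr_ge_zero) auto
    fix y :: "nat \<Rightarrow> real" and R :: real
    assume y: "\<And>n. 0 \<le> y n" "0 \<le> R" "lq_le q y R"
    have "(\<Sum>n<N. (y(0 := R)) n powr r) \<le> (2 powr (1 / r) * R) powr r" for N
    proof -
      have "(\<Sum>n<N. (y(0 := R)) n powr r) \<le> (\<Sum>n<N. (if n = 0 then R powr r else 0) + y n powr r)"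
        by (intro sum_mono) auto
      also have "\<dots> = (\<Sum>n<N. if n = 0 then R powr r else 0) + (\<Sum>n<N. y n powr r)"
        by (simp add: sum.distrib)
      also have "\<dots> \<le> R powr r + R powr r"
        using y real lq_le_real by (intro add_mono) (auto simp: sum.delta)
      finally show ?thesis using real y by (simp add: powr_mult powr_powr)
    qed
    then show "lq_le q (y(0 := R)) (2 powr (1 / r) * R)" using real lq_le_real by blast
  qed
qed

lemma lq_le_summable:
  assumes "0 < r" "summable (\<lambda>n. z n powr r)"
  obtains C where "0 < C" "lq_le (ennreal r) z C"
proof -
  define S where "S = 1 + (\<Sum>n. z n powr r)"
  have "0 \<le> (\<Sum>n. z n powr r)" using assms by (intro suminf_nonneg) auto
  then have S: "0 < S" by (simp add: S_def)
  have "(\<Sum>n<N. z n powr r) \<le> (S powr (1 / r)) powr r" for N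
    using sum_le_suminf[OF assms(2), of "{..<N}"] assms S
    by (simp add: powr_powr S_def)
  then show ?thesis using S assms lq_le_real by (intro that[of "S powr (1 / r)"]) auto
qed

lemma powr_le_geometric:
  fixes e b :: real
  assumes "0 < e"
  obtains C where "0 < C" "\<And>n::nat. (1 + real n) powr b \<le> C * 2 powr (e * real n)"
proof (cases "b \<le> 0")
  case True
  have "(1 + real n) powr b \<le> 1 * 2 powr (e * real n)" for n
  proof -
    have "(1 + real n) powr b \<le> (1 + real n) powr 0" using True by (intro powr_mono) auto
    also have "\<dots> \<le> 2 powr (e * real n)" using assms by (simp add: ge_one_powr_ge_zero)
    finally show ?thesis by simp
  qed
  then show ?thesis by (rule that[OF zero_less_one])
next
  case False
  \<comment> \<open>The two bounds on \<open>m\<close> make m (1 + n) <= 1 + (e / b) ln 2 n, to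
    which 1 + x <= exp x applies.\<close>
  define m where "m = min 1 (e / b * ln 2)"
  have m: "0 < m" "m \<le> 1" "m \<le> e / b * ln 2" using False assms by (auto simp: m_def)
  have le: "1 + real n \<le> (1 / m) * 2 powr (e / b * real n)" for n
  proof -
    have "m * (1 + real n) \<le> 1 + (e / b * ln 2) * real n"
      using m mult_right_mono[OF m(3), of "real n"] by (simp add: algebra_simps)
    also have "\<dots> \<le> exp (e / b * ln 2 * real n)" by (rule exp_ge_add_one_self)
    also have "\<dots> = 2 powr (e / b * real n)" by (simp add: powr_def mult_ac)
    finally show ?thesis using m by (simp add: field_simps)
  qed
  have "(1 + real n) powr b \<le> (1 / m) powr b * 2 powr (e * real n)" for n
  proof -
    have "(1 + real n) powr b \<le> ((1 / m) * 2 powr (e / b * real n)) powr b"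
      using le False by (intro powr_mono2) auto
    also have "\<dots> = (1 / m) powr b * 2 powr (e * real n)"
      using False m by (simp add: powr_mult powr_powr powr_divide)
    finally show ?thesis .
  qed
  then show ?thesis using that[of "(1 / m) powr b"] m by auto
qed

text \<open>Half of the rate \<open>e\<close> absorbs the power of 1 + n, the other half leaves a
  geometric series.\<close>

lemma lq_le_geometric:
  assumes "0 < e" "0 < q"
  obtains C where "0 < C" "lq_le q (\<lambda>n. 2 powr (- e * real n) * (1 + real n) powr b) C"
proof -
  obtain C0 where C0: "0 < C0" "\<And>n::nat. (1 + real n) powr b \<le> C0 * 2 powr (e/2 * real n)"
    using powr_le_geometric[of "e/2" b] assms by auto
  have le: "2 powr (- e * real n) * (1 + real n) powr b \<le> C0 * 2 powr (- (e/2) * real n)" for n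
  proof -
    have "2 powr (- e * real n) * (1 + real n) powr b \<le> 2 powr (- e * real n) * (C0 * 2 powr (e/2 * real n))"
      using C0 by (intro mult_left_mono) auto
    also have "\<dots> = C0 * 2 powr (- e * real n + e/2 * real n)"
      by (simp only: powr_add) simp
    also have "- e * real n + e/2 * real n = - (e/2) * real n" by simp
    finally show ?thesis .
  qed
  have "\<exists>C>0. lq_le q (\<lambda>n. C0 * 2 powr (- (e/2) * real n)) C"
    using assms(2)
  proof (cases q rule: exponent_cases)
    case top
    have "C0 * 2 powr (- (e/2) * real n) \<le> C0 * 1" for n
    proof (rule mult_left_mono)
      have "2 powr (- (e/2) * real n) \<le> 2 powr (0::real)" using assms by (intro powr_mono) auto
      then show "2 powr (- (e/2) * real n) \<le> 1" by simp
    qed (use C0 in auto)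
    then show ?thesis using top C0 by (auto simp: lq_le_top intro!: exI[of _ C0])
  next
    case (real r)
    have "summable (\<lambda>n. C0 powr r * (2 powr (- (e/2) * r)) ^ n)"
      using assms real by (intro summable_mult summable_geometric) (auto simp: powr_less_one)
    also have "(\<lambda>n. C0 powr r * (2 powr (- (e/2) * r)) ^ n) = (\<lambda>n. (C0 * 2 powr (- (e/2) * real n)) powr r)"
      using C0 by (auto simp: powr_mult powr_powr powr_power fun_eq_iff mult_ac)
    finally show ?thesis using lq_le_summable real by metis
  qed
  then show ?thesis
    using lq_le_mono[OF assms(2) _ le] that by force
qed

lemma lq_le_power_decay:
  assumes "recip q < g" "0 < q"
  obtains C where "0 < C" "lq_le q (\<lambda>n. (1 + real n) powr (- g)) C"
  using assms(2)
proof (cases q rule: exponent_cases)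
  case top
  then have g: "0 < g" using assms by simp
  have "(1 + real n) powr (- g) \<le> 1 powr (- g)" for n
    using g by (intro powr_mono2') auto
  then show ?thesis using top that[of 1] by (auto simp: lq_le_top)
next
  case (real r)
  have "r * g > 1" using assms real by (simp add: recip_ennreal field_simps)
  then have "summable (\<lambda>n. real n powr (- (r * g)))"
    by (simp add: summable_real_powr_iff)
  then have "summable (\<lambda>n. real (Suc n) powr (- (r * g)))"
    by (subst summable_Suc_iff)
  then have "summable (\<lambda>n. ((1 + real n) powr (- g)) powr r)"
    by (simp add: powr_powr mult_ac)
  then show ?thesis using lq_le_summable real that by metis
qed

text \<open>Both (1 + n) / (1 + j) and (1 + j) / (1 + n) are at most 1 + |n - j|, so the logarithmic
  factor varies more slowly than any exponential of the distance of the indices. Comparisons of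
  weights at different scales pay for it with a small \<open>e\<close>.\<close>

lemma wt_ratio:
  assumes "0 < e"
  obtains C where "0 < C"
    "\<And>n j. wt s b n \<le> C * 2 powr (s * (real n - real j) + e * \<bar>real n - real j\<bar>) * wt s b j"
proof -
  obtain C where C: "0 < C" "\<And>n::nat. (1 + real n) powr \<bar>b\<bar> \<le> C * 2 powr (e * real n)"
    using powr_le_geometric[OF assms] by metis
  have "wt s b n \<le> C * 2 powr (s * (real n - real j) + e * \<bar>real n - real j\<bar>) * wt s b j" for n j
  proof -
    obtain m :: nat where m: "real m = \<bar>real n - real j\<bar>"
      by (metis of_nat_diff abs_minus_commute abs_of_nonneg diff_ge_0_iff_ge linorder_linear of_nat_mono)
    have x: "(1 + real n) / (1 + real j) \<le> 1 + real m" "(1 + real j) / (1 + real n) \<le> 1 + real m"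
    proof -
      have *: "a / c \<le> 1 + real m" if "1 \<le> c" "a \<le> c + real m" for a c :: real
      proof -
        have "real m \<le> real m * c" using that mult_left_mono[of 1 c "real m"] by simp
        then have "a \<le> (1 + real m) * c" using that by (simp add: algebra_simps)
        then show ?thesis using that by (simp add: field_simps)
      qed
      show "(1 + real n) / (1 + real j) \<le> 1 + real m" "(1 + real j) / (1 + real n) \<le> 1 + real m"
        by (rule *; use m in linarith)+
    qed
    have "(1 + real n) powr b / (1 + real j) powr b = ((1 + real n) / (1 + real j)) powr b"
      by (simp add: powr_divide)
    also have "\<dots> \<le> (1 + real m) powr \<bar>b\<bar>"
    proof (cases "b \<ge> 0")
      case True
      then show ?thesis using x by (simp add: powr_mono2)
    next
      case False
      have "((1 + real n) / (1 + real j)) powr b = ((1 + real j) / (1 + real n)) powr (- b)"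
        by (simp add: powr_divide powr_minus field_simps)
      also have "\<dots> \<le> (1 + real m) powr (- b)"
        using False x by (intro powr_mono2) auto
      finally show ?thesis using False by simp
    qed
    also have "\<dots> \<le> C * 2 powr (e * \<bar>real n - real j\<bar>)" using C(2)[of m] m by simp
    finally have "(1 + real n) powr b \<le> C * 2 powr (e * \<bar>real n - real j\<bar>) * (1 + real j) powr b"
      by (simp add: field_simps)
    then have "2 powr (s * real n) * (1 + real n) powr b \<le>
       2 powr (s * (real n - real j) + s * real j) * (C * 2 powr (e * \<bar>real n - real j\<bar>) * (1 + real j) powr b)"
      by (simp add: algebra_simps)
    also have "\<dots> = C * 2 powr (s * (real n - real j) + e * \<bar>real n - real j\<bar>) * (2 powr (s * real j) * (1 + real j) powr b)"
      by (simp only: powr_add) simp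
    finally show ?thesis by (simp add: wt_def)
  qed
  then show ?thesis using that C by blast
qed

lemma sum_powr_abs_diff_le:
  fixes e :: real
  assumes "0 < e"
  obtains C where "0 < C" "\<And>(N::nat) n::nat. (\<Sum>j<N. 2 powr (- e * \<bar>real n - real j\<bar>)) \<le> C"
proof -
  define t :: real where "t = 2 powr (- e)"
  have t: "0 < t" "t < 1" using assms by (auto simp: t_def powr_less_one)
  have tp: "2 powr (- e * real m) = t ^ m" for m
    by (simp add: t_def powr_power mult_ac)
  have geo: "(\<Sum>j<N. t ^ j) \<le> 1 / (1 - t)" for N
    using t sum_le_suminf[of "\<lambda>j. t ^ j" "{..<N}"] by (simp add: suminf_geometric)
  have "(\<Sum>j<N. 2 powr (- e * \<bar>real n - real j\<bar>)) \<le> 2 / (1 - t)" for N n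
  proof -
    \<comment> \<open>The longer range \<open>Suc n + N\<close> contains \<open>n\<close> whatever
      \<open>N\<close> is, so the sum splits at \<open>n\<close> into two geometric sums.\<close>
    have "(\<Sum>j<N. 2 powr (- e * \<bar>real n - real j\<bar>)) \<le> (\<Sum>j<Suc n + N. 2 powr (- e * \<bar>real n - real j\<bar>))"
      by (intro sum_mono2) auto
    also have "\<dots> = (\<Sum>j<Suc n. 2 powr (- e * \<bar>real n - real j\<bar>)) + (\<Sum>j<N. 2 powr (- e * \<bar>real n - real (Suc n + j)\<bar>))"
      by (induction N) (auto simp: algebra_simps)
    also have "(\<Sum>j<Suc n. 2 powr (- e * \<bar>real n - real j\<bar>)) = (\<Sum>j<Suc n. t ^ (n - j))"
      by (intro sum.cong) (auto simp: of_nat_diff simp flip: tp)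
    also have "\<dots> = (\<Sum>j<Suc n. t ^ j)"
      using sum.nat_diff_reindex[of "\<lambda>j. t ^ j" "Suc n"] by simp
    also have "(\<Sum>j<N. 2 powr (- e * \<bar>real n - real (Suc n + j)\<bar>)) = (\<Sum>j<N. t ^ Suc j)"
      by (intro sum.cong refl, subst tp[symmetric]) (auto simp: add.commute)
    also have "\<dots> \<le> (\<Sum>j<N. t ^ j)" using t by (intro sum_mono) (auto simp: mult_left_le_one_le)
    finally show ?thesis using geo[of "Suc n"] geo[of N] by linarith
  qed
  then show ?thesis using that[of "2 / (1 - t)"] t by simp
qed

lemma lq_le_sum_bound:
  assumes "0 < r" "lq_le (ennreal r) y R" "finite F"
  shows "(\<Sum>n\<in>F. y n powr r) \<le> R powr r"
proof -
  obtain N where "F \<subseteq> {..<N}" using assms(3) finite_nat_bounded by blast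
  then have "(\<Sum>n\<in>F. y n powr r) \<le> (\<Sum>n<N. y n powr r)" by (intro sum_mono2) auto
  also have "\<dots> \<le> R powr r" using assms lq_le_real by blast
  finally show ?thesis .
qed

text \<open>The discrete Hardy inequality: exponential decay off the diagonal bounds the matrix on
  every ell_q. The truncation \<open>J n\<close> is free and does not affect the constant;
  Marchaud's recursion cuts at n, test sums at a fixed N.\<close>

lemma lq_le_convolution:
  assumes "0 < e" "0 < q"
  obtains C where "0 < C"
    "\<And>y z J B. (\<And>n. 0 \<le> y n) \<Longrightarrow> (\<And>n. 0 \<le> z n) \<Longrightarrow> 0 \<le> B \<Longrightarrow>
       (\<And>n. z n \<le> (\<Sum>j<J n. 2 powr (- e * \<bar>real n - real j\<bar>) * y j)) \<Longrightarrow>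
       lq_le q y B \<Longrightarrow> lq_le q z (C * B)"
proof -
  obtain C1 where C1: "0 < C1" "\<And>(N::nat) n::nat. (\<Sum>j<N. 2 powr (- (e/2) * \<bar>real n - real j\<bar>)) \<le> C1"
    using sum_powr_abs_diff_le[of "e/2"] assms by auto
  show ?thesis
    using assms(2)
  proof (cases q rule: exponent_cases)
    case top
    obtain C where C: "0 < C" "\<And>(N::nat) n::nat. (\<Sum>j<N. 2 powr (- e * \<bar>real n - real j\<bar>)) \<le> C"
      using sum_powr_abs_diff_le[of e] assms by auto
    show ?thesis
    proof (rule that[OF C(1)])
      fix y z :: "nat \<Rightarrow> real" and J :: "nat \<Rightarrow> nat" and B :: real
      assume H: "\<And>n. 0 \<le> y n" "\<And>n. 0 \<le> z n" "0 \<le> B"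
        "\<And>n. z n \<le> (\<Sum>j<J n. 2 powr (- e * \<bar>real n - real j\<bar>) * y j)" "lq_le q y B"
      have "z n \<le> C * B" for n
      proof -
        have "z n \<le> (\<Sum>j<J n. 2 powr (- e * \<bar>real n - real j\<bar>) * y j)" by fact
        also have "\<dots> \<le> (\<Sum>j<J n. 2 powr (- e * \<bar>real n - real j\<bar>) * B)"
          using H(5) top by (intro sum_mono mult_left_mono) (auto simp: lq_le_top)
        also have "\<dots> = (\<Sum>j<J n. 2 powr (- e * \<bar>real n - real j\<bar>)) * B"
          by (simp add: sum_distrib_right)
        also have "\<dots> \<le> C * B" by (rule mult_right_mono[OF C(2) H(3)])
        finally show ?thesis .
      qed
      then show "lq_le q z (C * B)" using top by (simp add: lq_le_top)
    qed
  next
    case (real r)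
    obtain C2 where C2: "0 < C2" "\<And>(N::nat) n::nat. (\<Sum>j<N. 2 powr (- (e/2*r) * \<bar>real n - real j\<bar>)) \<le> C2"
      using sum_powr_abs_diff_le[of "e/2*r"] assms real by auto
    define C where "C = C1 * C2 powr (1 / r)"
    show ?thesis
    proof (rule that[of C])
      show "0 < C" using C1 C2 by (simp add: C_def)
      fix y z :: "nat \<Rightarrow> real" and J :: "nat \<Rightarrow> nat" and B :: real
      assume H: "\<And>n. 0 \<le> y n" "\<And>n. 0 \<le> z n" "0 \<le> B"
        "\<And>n. z n \<le> (\<Sum>j<J n. 2 powr (- e * \<bar>real n - real j\<bar>) * y j)" "lq_le q y B"
      \<comment> \<open>The sum is controlled by its largest term at half the decay rate; this treats all
        exponents, also those below 1, in the same way.\<close>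
      have pt: "z n powr r \<le> C1 powr r * (\<Sum>j<J n. 2 powr (- (e/2*r) * \<bar>real n - real j\<bar>) * y j powr r)" for n
      proof (cases "J n = 0")
        case True
        then have "z n = 0" using H(2)[of n] H(4)[of n] by simp
        then show ?thesis using True by simp
      next
        case False
        define g where "g j = 2 powr (- (e/2) * \<bar>real n - real j\<bar>) * y j" for j
        define m where "m = Max (g ` {..<J n})"
        have fin: "finite (g ` {..<J n})" "g ` {..<J n} \<noteq> {}" using False by auto
        have m: "g j \<le> m" if "j < J n" for j using that fin by (auto simp: m_def)
        obtain i where i: "i < J n" "m = g i" using Max_in[OF fin] by (auto simp: m_def)
        have m0: "0 \<le> m" using i H(1) by (simp add: g_def)
        have "z n \<le> (\<Sum>j<J n. 2 powr (- e * \<bar>real n - real j\<bar>) * y j)" by fact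
        also have "\<dots> = (\<Sum>j<J n. 2 powr (- (e/2) * \<bar>real n - real j\<bar>) * g j)"
        proof (intro sum.cong refl)
          fix j
          have "- e * \<bar>real n - real j\<bar> = - (e/2) * \<bar>real n - real j\<bar> + - (e/2) * \<bar>real n - real j\<bar>" by simp
          then have "2 powr (- e * \<bar>real n - real j\<bar>) = 2 powr (- (e/2) * \<bar>real n - real j\<bar>) * 2 powr (- (e/2) * \<bar>real n - real j\<bar>)"
            by (simp only: powr_add)
          then show "2 powr (- e * \<bar>real n - real j\<bar>) * y j = 2 powr (- (e/2) * \<bar>real n - real j\<bar>) * g j"
            by (simp add: g_def)
        qed
        also have "\<dots> \<le> (\<Sum>j<J n. 2 powr (- (e/2) * \<bar>real n - real j\<bar>) * m)"
          using m by (intro sum_mono mult_left_mono) auto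
        also have "\<dots> = (\<Sum>j<J n. 2 powr (- (e/2) * \<bar>real n - real j\<bar>)) * m"
          by (simp add: sum_distrib_right)
        also have "\<dots> \<le> C1 * m" by (rule mult_right_mono[OF C1(2) m0])
        finally have "z n powr r \<le> (C1 * m) powr r" using H(2) real by (intro powr_mono2) auto
        also have "\<dots> = C1 powr r * g i powr r" using C1 m0 i by (simp add: powr_mult)
        also have "g i powr r = 2 powr (- (e/2*r) * \<bar>real n - real i\<bar>) * y i powr r"
          using H(1) by (simp add: g_def powr_mult powr_powr mult_ac)
        also have "\<dots> \<le> (\<Sum>j<J n. 2 powr (- (e/2*r) * \<bar>real n - real j\<bar>) * y j powr r)"
          using i by (intro member_le_sum) auto
        finally show ?thesis by (simp add: mult_left_mono)
      qed
      have "(\<Sum>n<N. z n powr r) \<le> (C * B) powr r" for N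
      proof -
        \<comment> \<open>A common bound for the truncations \<open>J n\<close> with n < N, so that
          the two finite sums can be interchanged.\<close>
        define K where "K = Max (insert 0 (J ` {..<N}))"
        have K: "J n \<le> K" if "n < N" for n using that by (auto simp: K_def)
        have "(\<Sum>n<N. z n powr r) \<le> (\<Sum>n<N. C1 powr r * (\<Sum>j<K. 2 powr (- (e/2*r) * \<bar>real n - real j\<bar>) * y j powr r))"
        proof (intro sum_mono)
          fix n assume "n \<in> {..<N}"
          then have "(\<Sum>j<J n. 2 powr (- (e/2*r) * \<bar>real n - real j\<bar>) * y j powr r) \<le> (\<Sum>j<K. 2 powr (- (e/2*r) * \<bar>real n - real j\<bar>) * y j powr r)"
            using K[of n] by (intro sum_mono2) auto
          then show "z n powr r \<le> C1 powr r * (\<Sum>j<K. 2 powr (- (e/2*r) * \<bar>real n - real j\<bar>) * y j powr r)"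
            using pt[of n] by (smt (verit) mult_left_mono powr_ge_zero)
        qed
        also have "\<dots> = C1 powr r * (\<Sum>j<K. (\<Sum>n<N. 2 powr (- (e/2*r) * \<bar>real j - real n\<bar>)) * y j powr r)"
          unfolding sum_distrib_left sum_distrib_right
          by (subst sum.swap) (intro sum.cong refl, simp add: abs_minus_commute)
        also have "\<dots> \<le> C1 powr r * (\<Sum>j<K. C2 * y j powr r)"
          using C2 by (intro mult_left_mono sum_mono mult_right_mono) auto
        also have "\<dots> = C1 powr r * C2 * (\<Sum>j<K. y j powr r)" by (simp add: sum_distrib_left mult_ac)
        also have "\<dots> \<le> C1 powr r * C2 * B powr r"
          using H(5) real lq_le_real[of r y B] C2 by (intro mult_left_mono) auto
        also have "\<dots> = (C * B) powr r"
          using C1 C2 H(3) real by (simp add: C_def powr_mult powr_powr)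
        finally show ?thesis .
      qed
      then show "lq_le q z (C * B)" using real lq_le_real by blast
    qed
  qed
qed

text \<open>Only the upper half of the indices is used. There 1 + n lies between (1 + N) / 2 and 1 +
  N, which serves both signs of \<open>b\<close>, and about N / 2 terms supply the additional
  power.\<close>

lemma sum_powr_ge:
  obtains c where "0 < c" "\<And>N. c * (1 + real N) powr (b + 1) \<le> (\<Sum>n\<le>N. (1 + real n) powr b)"
proof -
  define c where "c = min 1 (2 powr (- b))"
  have c: "0 < c" "c \<le> 1" by (auto simp: c_def)
  have "c / 2 * (1 + real N) powr (b + 1) \<le> (\<Sum>n\<le>N. (1 + real n) powr b)" for N
  proof -
    have pt: "c * (1 + real N) powr b \<le> (1 + real n) powr b" if "n \<in> {N div 2..N}" for n
    proof (cases "b \<ge> 0")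
      case True
      have "c * (1 + real N) powr b \<le> 2 powr (- b) * (1 + real N) powr b"
        by (intro mult_right_mono) (auto simp: c_def)
      also have "\<dots> = ((1 + real N) / 2) powr b" by (simp add: powr_divide powr_minus field_simps)
      also have "\<dots> \<le> (1 + real n) powr b" using True that by (intro powr_mono2) auto
      finally show ?thesis .
    next
      case False
      have "c * (1 + real N) powr b \<le> 1 * (1 + real N) powr b" using c by (intro mult_right_mono) auto
      also have "\<dots> \<le> (1 + real n) powr b" using False that by (simp add: powr_mono2')
      finally show ?thesis .
    qed
    have "(1 + real N) / 2 \<le> real (card {N div 2..N})" by (auto simp: field_simps)
    then have "(1 + real N) / 2 * (c * (1 + real N) powr b) \<le> real (card {N div 2..N}) * (c * (1 + real N) powr b)"
      using c by (intro mult_right_mono) auto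
    also have "\<dots> \<le> (\<Sum>n\<in>{N div 2..N}. (1 + real n) powr b)"
      using sum_mono[of "{N div 2..N}" "\<lambda>_. c * (1 + real N) powr b", OF pt] by simp
    also have "\<dots> \<le> (\<Sum>n\<le>N. (1 + real n) powr b)" by (intro sum_mono2) auto
    finally show ?thesis by (simp add: powr_add mult_ac)
  qed
  then show ?thesis using that[of "c / 2"] c by simp
qed

text \<open>For \<open>s = 0\<close> the monotonicity of the sequence improves the trivial bound on its terms.\<close>

lemma decseq_term_bound:
  assumes "0 < q" "- recip q \<le> b"
  obtains C where "0 < C"
    "\<And>x R n. decseq x \<Longrightarrow> (\<And>n. 0 \<le> x n) \<Longrightarrow> x 0 \<le> R \<Longrightarrow>
       lq_le q (\<lambda>n. wt 0 b n * x n) R \<Longrightarrow> x n \<le> C * R * (1 + real n) powr (- (b + recip q))"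
  using assms(1)
proof (cases q rule: exponent_cases)
  case top
  show ?thesis
  proof (rule that[of 1])
    fix x :: "nat \<Rightarrow> real" and R :: real and n :: nat
    assume "lq_le q (\<lambda>n. wt 0 b n * x n) R"
    then have "(1 + real n) powr b * x n \<le> R" using top by (simp add: lq_le_top wt_def)
    then show "x n \<le> 1 * R * (1 + real n) powr (- (b + recip q))"
      using top by (simp add: powr_minus field_simps)
  qed auto
next
  case (real r)
  obtain c where c: "0 < c" "\<And>N. c * (1 + real N) powr (b * r + 1) \<le> (\<Sum>n\<le>N. (1 + real n) powr (b * r))"
    using sum_powr_ge by metis
  show ?thesis
  proof (rule that[of "c powr (- (1 / r))"])
    show "0 < c powr (- (1 / r))" using c by simp
    fix x :: "nat \<Rightarrow> real" and R :: real and n :: nat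
    assume H: "decseq x" "\<And>n. 0 \<le> x n" "x 0 \<le> R" "lq_le q (\<lambda>n. wt 0 b n * x n) R"
    have R: "0 \<le> R" using H(2)[of 0] H(3) by simp
    \<comment> \<open>Every earlier term is at least \<open>x n\<close>, so the whole partial sum of
      weights, at least of order (1 + n)^(b r + 1), multiplies it; a single term would give only (1
      + n)^(b r).\<close>
    have "c * (1 + real n) powr (b * r + 1) * x n powr r \<le> (\<Sum>i\<le>n. (1 + real i) powr (b * r)) * x n powr r"
      using c by (intro mult_right_mono) auto
    also have "\<dots> \<le> (\<Sum>i\<le>n. (1 + real i) powr (b * r) * x i powr r)"
      unfolding sum_distrib_right using H(1,2) real
      by (intro sum_mono mult_left_mono powr_mono2) (auto simp: decseq_def)
    also have "\<dots> = (\<Sum>i\<le>n. (wt 0 b i * x i) powr r)"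
      using H(2) by (simp add: wt_def powr_mult powr_powr)
    also have "\<dots> \<le> R powr r" using lq_le_sum_bound H(4) real by blast
    finally have le: "c * (1 + real n) powr (b * r + 1) * x n powr r \<le> R powr r" .
    have inv: "(1 + real n) powr (b * r + 1) * (1 + real n) powr (- (b * r + 1)) = 1"
      by (simp flip: powr_add)
    have "(x n) powr r = ((1 + real n) powr (b * r + 1) * (1 + real n) powr (- (b * r + 1))) * (x n) powr r"
      unfolding inv by simp
    also have "\<dots> = (c * (1 + real n) powr (b * r + 1) * x n powr r) * (1 / c * (1 + real n) powr (- (b * r + 1)))"
      using c by simp
    also have "\<dots> \<le> R powr r * (1 / c * (1 + real n) powr (- (b * r + 1)))"
      using c by (intro mult_right_mono le) auto
    finally have "((x n) powr r) powr (1 / r) \<le> (R powr r * (1 / c * (1 + real n) powr (- (b * r + 1)))) powr (1 / r)"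
      using real by (intro powr_mono2) auto
    also have "\<dots> = R * ((1 / c) powr (1 / r) * (1 + real n) powr (- (b * r + 1) * (1 / r)))"
      using R c real by (simp add: powr_mult powr_powr powr_divide)
    also have "- (b * r + 1) * (1 / r) = - (b + recip q)" using real by (simp add: recip_ennreal field_simps)
    also have "(1 / c) powr (1 / r) = c powr (- (1 / r))" using c by (simp add: powr_divide powr_minus_divide)
    finally show "x n \<le> c powr (- (1 / r)) * R * (1 + real n) powr (- (b + recip q))"
      using H(2) real by (simp add: powr_powr mult_ac)
  qed
qed

section \<open>Sufficiency as a statement about decreasing sequences\<close>

definition embedding_condition :: "real \<Rightarrow> real \<Rightarrow> ennreal \<Rightarrow> real \<Rightarrow> real \<Rightarrow> ennreal \<Rightarrow> bool" where
  "embedding_condition s0 b0 q0 s1 b1 q1 \<longleftrightarrow>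
        s0 > s1
      \<or> (s0 = s1 \<and> s1 > 0 \<and> q0 \<le> q1 \<and> b0 \<ge> b1)
      \<or> (s0 = s1 \<and> s1 > 0 \<and> q0 > q1 \<and> b0 + recip q0 > b1 + recip q1)
      \<or> (s0 = s1 \<and> s1 = 0 \<and> b0 + recip q0 > b1 + recip q1)
      \<or> (s0 = s1 \<and> s1 = 0 \<and> b0 + recip q0 = b1 + recip q1 \<and> q0 \<le> q1)"

text \<open>\<open>x\<close> stands for the modulus of smoothness sampled at dyadic points: it is
  decreasing, and \<open>x 0\<close> is controlled by the Lp norm.\<close>

definition seq_embeds :: "real \<Rightarrow> real \<Rightarrow> ennreal \<Rightarrow> real \<Rightarrow> real \<Rightarrow> ennreal \<Rightarrow> bool" where
  "seq_embeds s0 b0 q0 s1 b1 q1 \<longleftrightarrow> (\<exists>C>0. \<forall>x R. decseq x \<longrightarrow> (\<forall>n. 0 \<le> x n) \<longrightarrow> x 0 \<le> R \<longrightarrow>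
     lq_le q0 (\<lambda>n. wt s0 b0 n * x n) R \<longrightarrow> lq_le q1 (\<lambda>n. wt s1 b1 n * x n) (C * R))"

text \<open>The pattern of all cases where \<open>x\<close> is dominated term by term:
  \<open>R\<close> times one fixed sequence \<open>z\<close> in ell_q1 majorizes the weighted
  terms.\<close>

lemma seq_embeds_of_bound:
  assumes "0 < q1" "0 < C0" "lq_le q1 z C0" "0 < K"
    "\<And>x R n. decseq x \<Longrightarrow> (\<And>n. 0 \<le> x n) \<Longrightarrow> x 0 \<le> R \<Longrightarrow> lq_le q0 (\<lambda>n. wt s0 b0 n * x n) R \<Longrightarrow>
       wt s1 b1 n * x n \<le> K * R * z n"
    "\<And>n. 0 \<le> z n"
  shows "seq_embeds s0 b0 q0 s1 b1 q1"
  unfolding seq_embeds_def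
proof (intro exI conjI allI impI)
  show "0 < K * C0" using assms by simp
  fix x :: "nat \<Rightarrow> real" and R :: real
  assume H: "decseq x" "\<forall>n. 0 \<le> x n" "x 0 \<le> R" "lq_le q0 (\<lambda>n. wt s0 b0 n * x n) R"
  have R: "0 \<le> R" using H(2)[rule_format, of 0] H(3) by simp
  have "lq_le q1 (\<lambda>n. (K * R) * z n) ((K * R) * C0)"
    using assms R by (intro lq_le_scale) auto
  then have "lq_le q1 (\<lambda>n. wt s1 b1 n * x n) ((K * R) * C0)"
    by (rule lq_le_mono[rotated -1]) (use assms H wt_nonneg in auto)
  then show "lq_le q1 (\<lambda>n. wt s1 b1 n * x n) (K * C0 * R)" by (simp add: mult_ac)
qed

text \<open>Of the hypothesis only the uniform bound on the weighted terms is used; the gap s0 - s1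
  leaves a geometric factor, which lies in every ell_q and outweighs any logarithm.\<close>

lemma seq_embeds_smoothness:
  assumes "0 < q0" "0 < q1" "s1 < s0"
  shows "seq_embeds s0 b0 q0 s1 b1 q1"
proof -
  have e: "0 < s0 - s1" using assms by simp
  obtain C where C: "0 < C" "lq_le q1 (\<lambda>n. 2 powr (- (s0 - s1) * real n) * (1 + real n) powr (b1 - b0)) C"
    by (rule lq_le_geometric[OF e assms(2)])
  show ?thesis
  proof (rule seq_embeds_of_bound[OF assms(2) C zero_less_one])
    fix x :: "nat \<Rightarrow> real" and R :: real and n
    assume H: "decseq x" "\<And>n. 0 \<le> x n" "x 0 \<le> R" "lq_le q0 (\<lambda>n. wt s0 b0 n * x n) R"
    have R: "0 \<le> R" using H(2)[of 0] H(3) by simp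
    have "wt s0 b0 n * x n \<le> R"
      by (rule lq_le_term[OF assms(1) _ R H(4)]) (simp add: H(2) wt_nonneg)
    then have "wt s0 b0 n * x n * (2 powr (- (s0 - s1) * real n) * (1 + real n) powr (b1 - b0)) \<le> R * (2 powr (- (s0 - s1) * real n) * (1 + real n) powr (b1 - b0))"
      by (intro mult_right_mono) auto
    moreover have "wt s0 b0 n * (2 powr (- (s0 - s1) * real n) * (1 + real n) powr (b1 - b0)) = wt s1 b1 n"
      unfolding wt_def by (simp add: powr_diff powr_minus left_diff_distrib field_simps)
    ultimately have "x n * wt s1 b1 n \<le> R * (2 powr (- (s0 - s1) * real n) * (1 + real n) powr (b1 - b0))"
      by (metis mult.assoc mult.commute)
    then show "wt s1 b1 n * x n \<le> 1 * R * (2 powr (- (s0 - s1) * real n) * (1 + real n) powr (b1 - b0))"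
      by (simp add: mult_ac)
  qed auto
qed

lemma seq_embeds_exponent:
  assumes "0 < q0" "q0 \<le> q1" "b1 \<le> b0"
  shows "seq_embeds s b0 q0 s b1 q1"
  unfolding seq_embeds_def
proof (intro exI conjI allI impI)
  fix x :: "nat \<Rightarrow> real" and R :: real
  assume H: "decseq x" "\<forall>n. 0 \<le> x n" "x 0 \<le> R" "lq_le q0 (\<lambda>n. wt s b0 n * x n) R"
  have R: "0 \<le> R" using H(2)[rule_format, of 0] H(3) by simp
  have "lq_le q1 (\<lambda>n. wt s b0 n * x n) R"
    by (rule lq_le_exponent_mono[OF assms(1,2) _ R H(4)]) (simp add: H(2) wt_nonneg)
  then show "lq_le q1 (\<lambda>n. wt s b1 n * x n) (1 * R)"
    unfolding mult_1
  proof (rule lq_le_mono[rotated -1])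
    show "0 < q1" using assms by simp
    show "wt s b1 n * x n \<le> wt s b0 n * x n" for n
      unfolding wt_def using assms H by (intro mult_right_mono mult_left_mono powr_mono) auto
  qed (use H wt_nonneg in auto)
qed auto

lemma mult_le_sum_powr:
  fixes a b u v :: real
  assumes "0 \<le> a" "0 \<le> b" "0 < u" "0 < v" "1 / u + 1 / v = 1"
  shows "a * b \<le> a powr u + b powr v"
proof -
  \<comment> \<open>Compare \<open>b\<close> with \<open>a powr (u - 1) = a powr (u / v)\<close>.\<close>
  have uv: "u = 1 + u / v" "v = 1 + v / u" using assms by (simp_all add: field_simps)
  show ?thesis
  proof (cases "b \<le> a powr (u / v)")
    case True
    have "a * b \<le> a powr 1 * a powr (u / v)" using True assms by (simp add: mult_left_mono)
    also have "\<dots> = a powr u" by (simp only: uv(1)[symmetric] flip: powr_add)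
    finally show ?thesis by (simp add: add_increasing2)
  next
    case False
    then have "(a powr (u / v)) powr (v / u) \<le> b powr (v / u)" using assms by (intro powr_mono2) auto
    then have "a \<le> b powr (v / u)" using assms by (simp add: powr_powr)
    then have "a * b \<le> b powr (v / u) * b powr 1" using assms by (simp add: mult_right_mono)
    also have "\<dots> = b powr v" by (simp only: uv(2)[symmetric] add.commute[of _ 1] flip: powr_add)
    finally show ?thesis by (simp add: add_increasing)
  qed
qed

text \<open>Hoelder's inequality: the quotient of the weights, (1 + n)^(b1 - b0), must lie in ell_t
  with 1/t = 1/q1 - 1/q0, which is the strict inequality assumed. For finite \<open>q0\<close>
  Young's inequality plays the part of Hoelder's, since constants do not matter.\<close>

lemma seq_embeds_weight:
  assumes "0 < q1" "q1 < q0" "b1 + recip q1 < b0 + recip q0"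
  shows "seq_embeds s b0 q0 s b1 q1"
proof -
  have "q1 \<noteq> top" using assms by auto
  then obtain r1 where r1: "0 < r1" "q1 = ennreal r1"
    by (rule_tac exponent_cases[OF assms(1)]) auto
  have "0 < q0" using assms by simp
  then show ?thesis
  proof (cases q0 rule: exponent_cases)
    case top
    have "recip q1 < b0 - b1" using assms top by simp
    then obtain C where C: "0 < C" "lq_le q1 (\<lambda>n. (1 + real n) powr (- (b0 - b1))) C"
      using lq_le_power_decay assms by blast
    show ?thesis
    proof (rule seq_embeds_of_bound[OF assms(1) C zero_less_one])
      fix x :: "nat \<Rightarrow> real" and R :: real and n
      assume H: "decseq x" "\<And>n. 0 \<le> x n" "x 0 \<le> R" "lq_le q0 (\<lambda>n. wt s b0 n * x n) R"
      have "wt s b0 n * x n * (1 + real n) powr (- (b0 - b1)) \<le> R * (1 + real n) powr (- (b0 - b1))"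
        using H(4) top by (intro mult_right_mono) (auto simp: lq_le_top)
      then show "wt s b1 n * x n \<le> 1 * R * (1 + real n) powr (- (b0 - b1))"
        by (simp add: wt_def powr_diff powr_minus field_simps)
    qed auto
  next
    case (real r0)
    have r10: "r1 < r0" using assms(2) r1 real by (simp add: ennreal_less_iff)
    \<comment> \<open>Conjugate exponents: \<open>u\<close> turns the power r1 into r0, and r1 v is
      the reciprocal of 1/r1 - 1/r0, so the hypothesis says exactly that \<open>g\<close> below is
      less than -1.\<close>
    define u v where "u = r0 / r1" and "v = r0 / (r0 - r1)"
    have uv: "0 < u" "0 < v" "1 / u + 1 / v = 1" using r1 real r10 by (auto simp: u_def v_def field_simps)
    define g where "g = (b1 - b0) * r1 * v"
    have "1 / r1 - 1 / r0 < b0 - b1" using assms(3) r1 real by (simp add: recip_ennreal)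
    then have "(1 / r1 - 1 / r0) * (r1 * v) < (b0 - b1) * (r1 * v)" using r1 uv by (intro mult_strict_right_mono) auto
    moreover have "(1 / r1 - 1 / r0) * (r1 * v) = 1" using r1 real r10 by (simp add: v_def field_simps)
    ultimately have "g < -1" by (simp add: g_def algebra_simps)
    then have "summable (\<lambda>n. real n powr g)" by (simp add: summable_real_powr_iff)
    then have sum: "summable (\<lambda>n. real (Suc n) powr g)" by (subst summable_Suc_iff)
    define S where "S = (\<Sum>n. real (Suc n) powr g)"
    have S: "0 \<le> S" using sum by (simp add: S_def suminf_nonneg)
    show ?thesis
      unfolding seq_embeds_def
    proof (intro exI conjI allI impI)
      show "0 < (1 + S) powr (1 / r1)" using S by simp
      fix x :: "nat \<Rightarrow> real" and R :: real
      assume H: "decseq x" "\<forall>n. 0 \<le> x n" "x 0 \<le> R" "lq_le q0 (\<lambda>n. wt s b0 n * x n) R"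
      have R: "0 \<le> R" using H(2)[rule_format, of 0] H(3) by simp
      show "lq_le q1 (\<lambda>n. wt s b1 n * x n) ((1 + S) powr (1 / r1) * R)"
      \<comment> \<open>Young's inequality is not homogeneous, so the terms are divided by
        \<open>R\<close> before it is applied; \<open>R = 0\<close> forces \<open>x\<close> to
        vanish.\<close>
      proof (cases "R = 0")
        case True
        then have "wt s b0 n * x n \<le> 0" for n
          using lq_le_term[OF \<open>0 < q0\<close> _ R H(4), of n] H(2) by (simp add: wt_nonneg)
        then have "x n = 0" for n using H(2) wt_pos[of s b0 n] by (metis antisym_conv mult_le_0_iff not_le)
        then show ?thesis using r1 True by (simp add: lq_le_real)
      next
        case False
        then have R: "0 < R" using R by simp
        have pt: "(wt s b1 n * x n) powr r1 \<le> R powr r1 * ((wt s b0 n * x n / R) powr r0 + real (Suc n) powr g)" for n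
        proof -
          define t where "t = wt s b0 n * x n / R"
          have t: "0 \<le> t" using H(2) R by (simp add: t_def wt_nonneg)
          have "(wt s b1 n * x n) = R * (t * (1 + real n) powr (b1 - b0))"
            using R by (simp add: t_def wt_def powr_diff field_simps)
          then have "(wt s b1 n * x n) powr r1 = R powr r1 * (t powr r1 * (1 + real n) powr ((b1 - b0) * r1))"
            using R t by (simp add: powr_mult powr_powr)
          also have "t powr r1 * (1 + real n) powr ((b1 - b0) * r1) \<le> (t powr r1) powr u + ((1 + real n) powr ((b1 - b0) * r1)) powr v"
            using uv by (intro mult_le_sum_powr) auto
          also have "\<dots> = t powr r0 + real (Suc n) powr g"
            using r1 by (simp add: powr_powr u_def g_def)
          finally show ?thesis using R by (simp add: t_def mult_left_mono)
        qed
        have "(\<Sum>n<N. (wt s b1 n * x n) powr r1) \<le> ((1 + S) powr (1 / r1) * R) powr r1" for N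
        proof -
          have "(\<Sum>n<N. (wt s b0 n * x n / R) powr r0) = (\<Sum>n<N. (wt s b0 n * x n) powr r0) / R powr r0"
            using H(2) R by (simp add: powr_divide wt_nonneg sum_divide_distrib)
          also have "\<dots> \<le> 1"
            using H(4) real lq_le_real[of r0] R by (auto simp: divide_le_eq)
          finally have 1: "(\<Sum>n<N. (wt s b0 n * x n / R) powr r0) \<le> 1" .
          have 2: "(\<Sum>n<N. real (Suc n) powr g) \<le> S" unfolding S_def by (rule sum_le_suminf[OF sum]) auto
          have "(\<Sum>n<N. (wt s b1 n * x n) powr r1) \<le> (\<Sum>n<N. R powr r1 * ((wt s b0 n * x n / R) powr r0 + real (Suc n) powr g))"
            by (intro sum_mono pt)
          also have "\<dots> = R powr r1 * ((\<Sum>n<N. (wt s b0 n * x n / R) powr r0) + (\<Sum>n<N. real (Suc n) powr g))"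
            by (simp only: sum_distrib_left sum.distrib distrib_left)
          also have "\<dots> \<le> R powr r1 * (1 + S)" using 1 2 by (intro mult_left_mono add_mono) auto
          also have "\<dots> = ((1 + S) powr (1 / r1) * R) powr r1" using R S r1 by (simp add: powr_mult powr_powr)
          finally show ?thesis .
        qed
        then show ?thesis using r1 lq_le_real by blast
      qed
    qed
  qed
qed

text \<open>By monotonicity x n = O((1 + n)^(-(b0 + 1/q0))), so the weight with exponent
  \<open>b1\<close> leaves a power that decays faster than (1 + n)^(-1/q1), whatever the order of
  \<open>q0\<close> and \<open>q1\<close>.\<close>

lemma seq_embeds_zero_strict:
  assumes "0 < q0" "0 < q1" "- recip q0 \<le> b0" "b1 + recip q1 < b0 + recip q0"
  shows "seq_embeds 0 b0 q0 0 b1 q1"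
proof -
  define g where "g = b0 + recip q0 - b1"
  have "recip q1 < g" using assms by (simp add: g_def)
  then obtain C where C: "0 < C" "lq_le q1 (\<lambda>n. (1 + real n) powr (- g)) C"
    using lq_le_power_decay assms by blast
  obtain K where K: "0 < K" "\<And>x R n. decseq x \<Longrightarrow> (\<And>n. 0 \<le> x n) \<Longrightarrow> x 0 \<le> R \<Longrightarrow>
       lq_le q0 (\<lambda>n. wt 0 b0 n * x n) R \<Longrightarrow> x n \<le> K * R * (1 + real n) powr (- (b0 + recip q0))"
    using decseq_term_bound[OF assms(1,3)] by blast
  show ?thesis
  proof (rule seq_embeds_of_bound[OF assms(2) C K(1)])
    fix x :: "nat \<Rightarrow> real" and R :: real and n
    assume H: "decseq x" "\<And>n. 0 \<le> x n" "x 0 \<le> R" "lq_le q0 (\<lambda>n. wt 0 b0 n * x n) R"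
    have "wt 0 b1 n * x n \<le> wt 0 b1 n * (K * R * (1 + real n) powr (- (b0 + recip q0)))"
      using K(2)[OF H] by (intro mult_left_mono wt_nonneg)
    also have "\<dots> = K * R * ((1 + real n) powr b1 * (1 + real n) powr (- (b0 + recip q0)))" by (simp add: wt_def)
    also have "(1 + real n) powr b1 * (1 + real n) powr (- (b0 + recip q0)) = (1 + real n) powr (- g)"
      by (simp add: g_def flip: powr_add) (simp add: algebra_simps)
    finally show "wt 0 b1 n * x n \<le> K * R * (1 + real n) powr (- g)" .
  qed auto
qed

text \<open>Interpolation between the ell_q0 bound and the uniform bound (1 + n)^c x n = O(R) that
  monotonicity supplies, where c is the common value of b + 1/q.\<close>

lemma seq_embeds_zero_eq:
  assumes "0 < q0" "q0 \<le> q1" "- recip q0 \<le> b0" "b1 + recip q1 = b0 + recip q0"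
  shows "seq_embeds 0 b0 q0 0 b1 q1"
proof -
  have q1: "0 < q1" using assms by simp
  define c where "c = b0 + recip q0"
  have c: "b1 = c - recip q1" "b0 = c - recip q0" using assms by (auto simp: c_def)
  obtain K where K: "0 < K" "\<And>x R n. decseq x \<Longrightarrow> (\<And>n. 0 \<le> x n) \<Longrightarrow> x 0 \<le> R \<Longrightarrow>
       lq_le q0 (\<lambda>n. wt 0 b0 n * x n) R \<Longrightarrow> x n \<le> K * R * (1 + real n) powr (- c)"
    using decseq_term_bound[OF assms(1,3)] unfolding c_def by blast
  show ?thesis
    using q1
  proof (cases q1 rule: exponent_cases)
    case top
    have "lq_le q1 (\<lambda>n. 1) 1" using top by (simp add: lq_le_top)
    then show ?thesis
    proof (rule seq_embeds_of_bound[OF q1 zero_less_one _ K(1)])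
      fix x :: "nat \<Rightarrow> real" and R :: real and n
      assume H: "decseq x" "\<And>n. 0 \<le> x n" "x 0 \<le> R" "lq_le q0 (\<lambda>n. wt 0 b0 n * x n) R"
      have "wt 0 b1 n * x n \<le> wt 0 b1 n * (K * R * (1 + real n) powr (- c))"
        using K(2)[OF H] by (intro mult_left_mono wt_nonneg)
      also have "\<dots> = K * R * 1" using c top by (simp add: wt_def powr_minus field_simps)
      finally show "wt 0 b1 n * x n \<le> K * R * 1" .
    qed auto
  next
    case (real r1)
    have "q0 \<noteq> top" using assms(2) real by (auto simp: top_unique)
    then obtain r0 where r0: "0 < r0" "q0 = ennreal r0"
      by (rule_tac exponent_cases[OF assms(1)]) auto
    have r01: "r0 \<le> r1" using assms(2) r0 real by simp
    define a where "a = (r1 - r0) / r1"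
    show ?thesis
      unfolding seq_embeds_def
    proof (intro exI conjI allI impI)
      show "0 < K powr a" using K by simp
      fix x :: "nat \<Rightarrow> real" and R :: real
      assume H: "decseq x" "\<forall>n. 0 \<le> x n" "x 0 \<le> R" "lq_le q0 (\<lambda>n. wt 0 b0 n * x n) R"
      have R: "0 \<le> R" using H(2)[rule_format, of 0] H(3) by simp
      have pt: "(wt 0 b1 n * x n) powr r1 \<le> (wt 0 b0 n * x n) powr r0 * (K * R) powr (r1 - r0)" for n
      proof -
        have x: "0 \<le> x n" using H by simp
        have "(1 + real n) powr c * x n \<le> (1 + real n) powr c * (K * R * (1 + real n) powr (- c))"
          using K(2)[of x R n] H by (intro mult_left_mono) auto
        then have cx: "(1 + real n) powr c * x n \<le> K * R" by (simp add: powr_minus field_simps)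
        have "(wt 0 b1 n * x n) powr r1 = (1 + real n) powr (b1 * r1) * x n powr r1"
          using x by (simp add: wt_def powr_mult powr_powr)
        \<comment> \<open>Since \<open>b0\<close> and \<open>b1\<close> are c - 1/r0 and c - 1/r1,
          the products with r0 and r1 are c r0 - 1 and c r1 - 1, and the two -1 cancel: this is
          where equality of the critical exponents enters.\<close>
        also have "b1 * r1 = b0 * r0 + c * (r1 - r0)"
        proof -
          have "b1 * r1 = c * r1 - 1" "b0 * r0 = c * r0 - 1"
            using c r0 real by (simp_all add: recip_ennreal left_diff_distrib)
          then show ?thesis by (simp add: algebra_simps)
        qed
        also have "x n powr r1 = x n powr r0 * x n powr (r1 - r0)" by (simp flip: powr_add)
        also have "(1 + real n) powr (b0 * r0 + c * (r1 - r0)) * (x n powr r0 * x n powr (r1 - r0)) =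
           (wt 0 b0 n * x n) powr r0 * ((1 + real n) powr c * x n) powr (r1 - r0)"
          using x by (simp add: wt_def powr_mult powr_powr powr_add)
        also have "\<dots> \<le> (wt 0 b0 n * x n) powr r0 * (K * R) powr (r1 - r0)"
          using cx x r01 by (intro mult_left_mono powr_mono2) auto
        finally show ?thesis .
      qed
      have "(\<Sum>n<N. (wt 0 b1 n * x n) powr r1) \<le> (K powr a * R) powr r1" for N
      proof -
        have "(\<Sum>n<N. (wt 0 b1 n * x n) powr r1) \<le> (\<Sum>n<N. (wt 0 b0 n * x n) powr r0 * (K * R) powr (r1 - r0))"
          by (intro sum_mono pt)
        also have "\<dots> = (\<Sum>n<N. (wt 0 b0 n * x n) powr r0) * (K * R) powr (r1 - r0)"
          by (simp add: sum_distrib_right)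
        also have "\<dots> \<le> R powr r0 * (K * R) powr (r1 - r0)"
          using H(4) r0 lq_le_real[of r0] by (intro mult_right_mono) auto
        also have "\<dots> = K powr (r1 - r0) * (R powr r0 * R powr (r1 - r0))"
          using K R by (simp add: powr_mult)
        also have "R powr r0 * R powr (r1 - r0) = R powr r1" by (simp flip: powr_add)
        also have "K powr (r1 - r0) * R powr r1 = (K powr a * R) powr r1"
          using K R real by (simp add: powr_mult powr_powr a_def)
        finally show ?thesis .
      qed
      then show "lq_le q1 (\<lambda>n. wt 0 b1 n * x n) (K powr a * R)" using real lq_le_real by blast
    qed
  qed
qed

lemma seq_embeds_if_condition:
  assumes "0 < q0" "0 < q1" "s0 = 0 \<Longrightarrow> - recip q0 \<le> b0" "embedding_condition s0 b0 q0 s1 b1 q1"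
  shows "seq_embeds s0 b0 q0 s1 b1 q1"
  using assms(4) unfolding embedding_condition_def
  using seq_embeds_smoothness[of q0 q1 s1 s0 b0 b1] seq_embeds_exponent[of q0 q1 b1 b0 s1]
    seq_embeds_weight[of q1 q0 b1 b0 s1] seq_embeds_zero_strict[of q0 q1 b0 b1]
    seq_embeds_zero_eq[of q0 q1 b0 b1] assms(1,2,3)
  by (elim disjE) auto

section \<open>Differences and moduli of smoothness in Lp\<close>

lemma epowr_ennreal: "0 \<le> x \<Longrightarrow> epowr (ennreal x) a = ennreal (x powr a)"
  by (simp add: epowr_def)

lemma epowr_mono:
  assumes "0 < a" "x \<le> y"
  shows "epowr x a \<le> epowr y a"
proof (cases "y = top")
  case False
  then have "x \<noteq> top" using assms by (auto simp: top_unique)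
  with False assms show ?thesis
    by (auto simp: epowr_def less_top intro!: ennreal_leI powr_mono2 enn2real_mono)
qed (simp add: epowr_def)

lemma epowr_le_iff:
  assumes "0 < a" "0 \<le> R"
  shows "epowr x (1 / a) \<le> ennreal R \<longleftrightarrow> x \<le> ennreal (R powr a)"
proof (cases x)
  case (real r)
  have "r powr (1 / a) \<le> R \<longleftrightarrow> r \<le> R powr a"
  proof
    assume "r powr (1 / a) \<le> R"
    then have "(r powr (1 / a)) powr a \<le> R powr a" using assms by (intro powr_mono2) auto
    then show "r \<le> R powr a" using assms real by (simp add: powr_powr)
  next
    assume "r \<le> R powr a"
    then have "r powr (1 / a) \<le> (R powr a) powr (1 / a)" using assms real by (intro powr_mono2) auto
    then show "r powr (1 / a) \<le> R" using assms by (simp add: powr_powr)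
  qed
  then show ?thesis using assms real by (simp add: epowr_ennreal)
qed (simp add: epowr_def top_unique)

lemma Lp_norm_le_iff:
  assumes "0 < p" "0 \<le> R"
  shows "Lp_norm M p f \<le> ennreal R \<longleftrightarrow> (\<integral>\<^sup>+x. ennreal (norm (f x) powr p) \<partial>M) \<le> ennreal (R powr p)"
  unfolding Lp_norm_def by (rule epowr_le_iff[OF assms])

lemma Lp_norm_cong:
  assumes "\<And>x. x \<in> space M \<Longrightarrow> norm (f x) = norm (g x)"
  shows "Lp_norm M p f = Lp_norm M p g"
  unfolding Lp_norm_def using assms by (simp cong: nn_integral_cong)

lemma Lp_norm_mono:
  assumes "0 < p" "\<And>x. x \<in> space M \<Longrightarrow> norm (f x) \<le> norm (g x)"
  shows "Lp_norm M p f \<le> Lp_norm M p g"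
  unfolding Lp_norm_def using assms
  by (intro epowr_mono nn_integral_mono ennreal_leI powr_mono2) auto

lemma powr_convex_combination:
  fixes u v l m p :: real
  assumes "1 \<le> p" "0 \<le> u" "0 \<le> v" "0 \<le> l" "0 \<le> m" "l + m = 1"
  shows "(l * u + m * v) powr p \<le> l * u powr p + m * v powr p"
proof -
  \<comment> \<open>The boundary case: with one argument equal to 0, convexity reduces to a^p <= a
    on [0, 1].\<close>
  have aux: "(a * b) powr p \<le> a * b powr p" if "0 \<le> a" "a \<le> 1" "0 \<le> b" for a b :: real
  proof (cases "a = 0")
    case False
    then have "a powr p \<le> a powr 1" using that assms by (intro powr_mono') auto
    then show ?thesis using that by (simp add: powr_mult mult_right_mono)
  qed simp
  consider "u = 0" | "v = 0" | "0 < u" "0 < v" using assms by fastforce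
  then show ?thesis
  proof cases
    case 1
    then show ?thesis using aux[of m v] assms by simp
  next
    case 2
    then show ?thesis using aux[of l u] assms by simp
  next
    case 3
    have l: "l = 1 - m" using assms by simp
    show ?thesis unfolding l using 3 convex_onD[OF powr_convex[OF assms(1)], of m u v] assms
      by simp
  qed
qed

text \<open>Minkowski's inequality from convexity of the p-th power: f / A and g / B have norm at
  most 1 and are combined with the weights A / (A + B) and B / (A + B). Positivity of
  \<open>A\<close> and \<open>B\<close> is what the division needs.\<close>

lemma Lp_norm_add_aux:
  assumes p: "1 \<le> p" and [measurable]: "f \<in> borel_measurable M" "g \<in> borel_measurable M"
    and AB: "0 < A" "0 < B" "Lp_norm M p f \<le> ennreal A" "Lp_norm M p g \<le> ennreal B"
  shows "Lp_norm M p (\<lambda>x. f x + g x) \<le> ennreal (A + B)"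
proof -
  have p0: "0 < p" using p by simp
  define l m where "l = A / (A + B)" and "m = B / (A + B)"
  have lm: "0 < l" "0 < m" "l + m = 1" using AB by (auto simp: l_def m_def add_divide_distrib[symmetric])
  have pt: "norm (f x + g x) powr p \<le>
      (A + B) powr p * l * A powr (- p) * norm (f x) powr p + (A + B) powr p * m * B powr (- p) * norm (g x) powr p" for x
  proof -
    have eq: "norm (f x) + norm (g x) = (A + B) * (l * (norm (f x) / A) + m * (norm (g x) / B))"
    proof -
      have "(A + B) * l = A" "(A + B) * m = B" using AB by (auto simp: l_def m_def)
      then have "(A + B) * (l * (norm (f x) / A) + m * (norm (g x) / B)) = A * (norm (f x) / A) + B * (norm (g x) / B)"
        by (metis distrib_left mult.assoc)
      then show ?thesis using AB by simp
    qed
    have "norm (f x + g x) powr p \<le> (norm (f x) + norm (g x)) powr p"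
      using p by (intro powr_mono2 norm_triangle_ineq) auto
    also have "\<dots> = (A + B) powr p * (l * (norm (f x) / A) + m * (norm (g x) / B)) powr p"
      unfolding eq using AB lm by (subst powr_mult) auto
    also have "\<dots> \<le> (A + B) powr p * (l * (norm (f x) / A) powr p + m * (norm (g x) / B) powr p)"
      using AB lm p by (intro mult_left_mono powr_convex_combination) auto
    also have "(norm (f x) / A) powr p = A powr (- p) * norm (f x) powr p"
      using AB by (simp add: powr_divide powr_minus field_simps)
    also have "(norm (g x) / B) powr p = B powr (- p) * norm (g x) powr p"
      using AB by (simp add: powr_divide powr_minus field_simps)
    finally show ?thesis by (simp add: distrib_left mult.assoc)
  qed
  have "(\<integral>\<^sup>+x. ennreal (norm (f x + g x) powr p) \<partial>M) \<le>
      (\<integral>\<^sup>+x. ennreal ((A + B) powr p * l * A powr (- p)) * ennreal (norm (f x) powr p) +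
            ennreal ((A + B) powr p * m * B powr (- p)) * ennreal (norm (g x) powr p) \<partial>M)"
    using AB lm by (intro nn_integral_mono order_trans[OF ennreal_leI[OF pt]])
      (simp add: ennreal_plus[symmetric] ennreal_mult[symmetric] del: ennreal_plus)
  also have "\<dots> = ennreal ((A + B) powr p * l * A powr (- p)) * (\<integral>\<^sup>+x. ennreal (norm (f x) powr p) \<partial>M) +
            ennreal ((A + B) powr p * m * B powr (- p)) * (\<integral>\<^sup>+x. ennreal (norm (g x) powr p) \<partial>M)"
    by (simp add: nn_integral_add nn_integral_cmult)
  also have "\<dots> \<le> ennreal ((A + B) powr p * l * A powr (- p)) * ennreal (A powr p) +
            ennreal ((A + B) powr p * m * B powr (- p)) * ennreal (B powr p)"
    using AB by (intro add_mono mult_left_mono) (auto simp: Lp_norm_le_iff[OF p0])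
  also have "\<dots> = ennreal ((A + B) powr p * l + (A + B) powr p * m)"
    using AB lm by (simp add: ennreal_plus[symmetric] ennreal_mult[symmetric] powr_minus mult.assoc del: ennreal_plus)
  also have "(A + B) powr p * l + (A + B) powr p * m = (A + B) powr p"
    unfolding distrib_left[symmetric] lm by simp
  finally show ?thesis using AB lm by (subst Lp_norm_le_iff[OF p0]) auto
qed

lemma Lp_norm_add:
  assumes p: "1 \<le> p" and [measurable]: "f \<in> borel_measurable M" "g \<in> borel_measurable M"
  shows "Lp_norm M p (\<lambda>x. f x + g x) \<le> Lp_norm M p f + Lp_norm M p g"
proof (cases "Lp_norm M p f" "Lp_norm M p g" rule: ennreal2_cases)
  case (real_real A B)
  note AB = real_real
  \<comment> \<open>Adding e / 2 to each norm makes both bounds positive, so a vanishing norm is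
    covered as well.\<close>
  have eps: "Lp_norm M p (\<lambda>x. f x + g x) \<le> ennreal (A + B) + ennreal e" if "0 < e" for e
  proof -
    have "Lp_norm M p (\<lambda>x. f x + g x) \<le> ennreal ((A + e / 2) + (B + e / 2))"
      using AB that by (intro Lp_norm_add_aux[OF p]) (auto intro!: ennreal_leI)
    also have "(A + e / 2) + (B + e / 2) = (A + B) + e" by simp
    finally show ?thesis using AB that by (simp add: ennreal_plus[symmetric] del: ennreal_plus)
  qed
  have "Lp_norm M p (\<lambda>x. f x + g x) \<le> ennreal (A + B)"
    by (rule ennreal_le_epsilon) (rule eps)
  then show ?thesis unfolding AB(2,4) ennreal_plus[OF AB(1,3)] .
qed (simp_all add: top_unique)

lemma Lp_norm_scale:
  assumes p: "0 < p" and [measurable]: "f \<in> borel_measurable M"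
  shows "Lp_norm M p (\<lambda>x. c * f x) = ennreal (norm c) * Lp_norm M p f"
proof (cases "c = 0")
  case True
  then show ?thesis by (simp add: Lp_norm_def epowr_def)
next
  case False
  have eq: "(\<integral>\<^sup>+x. ennreal (norm (c * f x) powr p) \<partial>M) = ennreal (norm c powr p) * (\<integral>\<^sup>+x. ennreal (norm (f x) powr p) \<partial>M)"
    by (subst nn_integral_cmult[symmetric]) (simp_all add: norm_mult powr_mult ennreal_mult'')
  show ?thesis
  proof (cases "(\<integral>\<^sup>+x. ennreal (norm (f x) powr p) \<partial>M)")
    case (real r)
    then show ?thesis unfolding Lp_norm_def eq using p
      by (simp add: ennreal_mult[symmetric] epowr_ennreal powr_mult powr_powr)
  next
    case top
    then show ?thesis unfolding Lp_norm_def eq using p False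
      by (simp add: epowr_def ennreal_mult_top)
  qed
qed

lemma diff1_linear:
  "(diff1 h ^^ n) (\<lambda>x. c * f x + d * g x) = (\<lambda>x. c * (diff1 h ^^ n) f x + d * (diff1 h ^^ n) g x)"
  by (induction n) (auto simp: diff1_def algebra_simps)

lemma diff1_scale: "(diff1 h ^^ n) (\<lambda>x. c * f x) = (\<lambda>x. c * (diff1 h ^^ n) f x)"
  by (induction n) (auto simp: diff1_def algebra_simps)

lemma diff1_sum: "(diff1 h ^^ n) (\<lambda>x. \<Sum>i\<in>I. f i x) = (\<lambda>x. \<Sum>i\<in>I. (diff1 h ^^ n) (f i) x)"
  by (induction n) (auto simp: diff1_def sum_subtractf)

lemma diff1_shift:
  fixes h v :: "'a::ab_group_add"
  shows "(diff1 h ^^ n) (\<lambda>x. f (x + v)) = (\<lambda>x. (diff1 h ^^ n) f (x + v))"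
  by (induction n) (auto simp: diff1_def add_ac)

lemma modulus_mono: "t \<le> u \<Longrightarrow> modulus M p k f t \<le> modulus M p k f u"
  unfolding modulus_def by (rule SUP_subset_mono) auto

text \<open>\<open>X\<close> is a linear, shift-invariant class of measurable functions on which the
  Lp norm is invariant: all measurable functions on Euclidean space, the periodic ones on the
  circle, whose measure on one period is invariant only on such functions. Finiteness of the norm is
  kept out of \<open>X\<close>.\<close>

locale shift_invariant_Lp =
  fixes M :: "'a::euclidean_space measure" and X :: "('a \<Rightarrow> complex) set" and p :: real
  assumes p: "1 < p"
    and X_meas: "f \<in> X \<Longrightarrow> f \<in> borel_measurable M"
    and X_add: "f \<in> X \<Longrightarrow> g \<in> X \<Longrightarrow> (\<lambda>x. f x + g x) \<in> X"
    and X_scale: "f \<in> X \<Longrightarrow> (\<lambda>x. c * f x) \<in> X"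
    and X_shift: "f \<in> X \<Longrightarrow> (\<lambda>x. f (x + h)) \<in> X"
    and X_zero: "(\<lambda>x. 0) \<in> X"
    and Lp_shift: "f \<in> X \<Longrightarrow> Lp_norm M p (\<lambda>x. f (x + h)) = Lp_norm M p f"
begin

lemma p1: "1 \<le> p" and p0: "0 < p" using p by auto

lemma Lp_add: "f \<in> X \<Longrightarrow> g \<in> X \<Longrightarrow> Lp_norm M p (\<lambda>x. f x + g x) \<le> Lp_norm M p f + Lp_norm M p g"
  by (intro Lp_norm_add p1 X_meas)

lemma Lp_scale: "f \<in> X \<Longrightarrow> Lp_norm M p (\<lambda>x. c * f x) = ennreal (norm c) * Lp_norm M p f"
  by (intro Lp_norm_scale p0 X_meas)

lemma X_diff: "f \<in> X \<Longrightarrow> g \<in> X \<Longrightarrow> (\<lambda>x. f x - g x) \<in> X"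
  using X_add[of f "\<lambda>x. (-1) * g x"] X_scale[of g "-1"] by simp

lemma Lp_diff: "f \<in> X \<Longrightarrow> g \<in> X \<Longrightarrow> Lp_norm M p (\<lambda>x. f x - g x) \<le> Lp_norm M p f + Lp_norm M p g"
  using Lp_add[of f "\<lambda>x. (-1) * g x"] X_scale[of g "-1"] Lp_scale[of g "-1"] by simp

lemma X_diff1: "f \<in> X \<Longrightarrow> (diff1 h ^^ k) f \<in> X"
  by (induction k) (auto simp: diff1_def intro!: X_diff X_shift)

lemma X_sum: "(\<And>i. i \<in> I \<Longrightarrow> f i \<in> X) \<Longrightarrow> (\<lambda>x. \<Sum>i\<in>I. f i x) \<in> X"
  by (induction I rule: infinite_finite_induct) (auto intro: X_add X_zero)

lemma Lp_sum: "finite I \<Longrightarrow> (\<And>i. i \<in> I \<Longrightarrow> f i \<in> X) \<Longrightarrow> Lp_norm M p (\<lambda>x. \<Sum>i\<in>I. f i x) \<le> (\<Sum>i\<in>I. Lp_norm M p (f i))"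
proof (induction I rule: finite_induct)
  case empty
  then show ?case by (simp add: Lp_norm_def epowr_def)
next
  case (insert i I)
  have "Lp_norm M p (\<lambda>x. f i x + (\<Sum>i\<in>I. f i x)) \<le> Lp_norm M p (f i) + Lp_norm M p (\<lambda>x. \<Sum>i\<in>I. f i x)"
    using insert by (intro Lp_add X_sum) auto
  also have "\<dots> \<le> Lp_norm M p (f i) + (\<Sum>i\<in>I. Lp_norm M p (f i))"
    using insert by (intro add_left_mono) auto
  finally show ?case using insert by simp
qed

lemma Lp_diff1_Suc:
  assumes "f \<in> X"
  shows "Lp_norm M p ((diff1 h ^^ Suc k) f) \<le> 2 * Lp_norm M p ((diff1 h ^^ k) f)"
proof -
  have "Lp_norm M p (\<lambda>x. (diff1 h ^^ k) f (x + h) - (diff1 h ^^ k) f x) \<le>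
      Lp_norm M p (\<lambda>x. (diff1 h ^^ k) f (x + h)) + Lp_norm M p ((diff1 h ^^ k) f)"
    by (intro Lp_diff X_shift X_diff1 assms)
  also have "\<dots> = 2 * Lp_norm M p ((diff1 h ^^ k) f)"
    using assms by (simp add: Lp_shift X_diff1 mult_2)
  finally show ?thesis by (simp add: diff1_def[of h "(diff1 h ^^ k) f"])
qed

lemma Lp_diff1_le:
  assumes "f \<in> X"
  shows "Lp_norm M p ((diff1 h ^^ k) f) \<le> 2 ^ k * Lp_norm M p f"
proof (induction k)
  case (Suc k)
  have "Lp_norm M p ((diff1 h ^^ Suc k) f) \<le> 2 * (2 ^ k * Lp_norm M p f)"
    by (rule order_trans[OF Lp_diff1_Suc[OF assms] mult_left_mono[OF Suc]]) simp
  then show ?case by (simp add: mult_ac)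
qed simp

lemma modulus_le:
  assumes "f \<in> X"
  shows "modulus M p k f t \<le> 2 ^ k * Lp_norm M p f"
  unfolding modulus_def by (intro SUP_least Lp_diff1_le assms)

lemma modulus_Suc_le:
  assumes "f \<in> X"
  shows "modulus M p (Suc k) f t \<le> 2 * modulus M p k f t"
  unfolding modulus_def
proof (rule SUP_least)
  fix h :: 'a assume h: "h \<in> {h. norm h \<le> t}"
  have "Lp_norm M p ((diff1 h ^^ Suc k) f) \<le> 2 * Lp_norm M p ((diff1 h ^^ k) f)"
    by (rule Lp_diff1_Suc[OF assms])
  also have "\<dots> \<le> 2 * (SUP h\<in>{h. norm h \<le> t}. Lp_norm M p ((diff1 h ^^ k) f))"
    using h by (intro mult_left_mono SUP_upper) auto
  finally show "Lp_norm M p ((diff1 h ^^ Suc k) f) \<le> 2 * (SUP h\<in>{h. norm h \<le> t}. Lp_norm M p ((diff1 h ^^ k) f))" .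
qed

lemma modulus_scale:
  assumes "f \<in> X"
  shows "modulus M p k (\<lambda>x. c * f x) t = ennreal (norm c) * modulus M p k f t"
  unfolding modulus_def by (simp add: diff1_scale Lp_scale X_diff1 assms SUP_mult_left_ennreal)

text \<open>A difference with step 2h is the sum of a difference with step h and its translate by h;
  each order therefore costs a factor 2.\<close>

lemma Lp_diff1_double_le:
  "f \<in> X \<Longrightarrow> Lp_norm M p ((diff1 (h + h) ^^ j) f) \<le> 2 ^ j * Lp_norm M p ((diff1 h ^^ j) f)"
proof (induction j arbitrary: f)
  case (Suc j)
  define g where "g = (\<lambda>x. diff1 h f (x + h) + diff1 h f x)"
  have d: "diff1 h f \<in> X" using X_diff1[OF Suc.prems, where h = h and k = 1] by simp
  have g: "g \<in> X" unfolding g_def by (intro X_add X_shift d)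
  have eq: "diff1 (h + h) f = g" by (auto simp: g_def diff1_def add_ac)
  have "(diff1 h ^^ j) g = (\<lambda>x. (diff1 h ^^ j) (diff1 h f) (x + h) + (diff1 h ^^ j) (diff1 h f) x)"
    using diff1_linear[of j h 1 "\<lambda>x. diff1 h f (x + h)" 1 "diff1 h f"] diff1_shift[of j h "diff1 h f" h]
    by (simp add: g_def)
  moreover have "Lp_norm M p (\<lambda>x. (diff1 h ^^ j) (diff1 h f) (x + h) + (diff1 h ^^ j) (diff1 h f) x) \<le>
     Lp_norm M p (\<lambda>x. (diff1 h ^^ j) (diff1 h f) (x + h)) + Lp_norm M p ((diff1 h ^^ j) (diff1 h f))"
    by (intro Lp_add X_shift X_diff1 d)
  ultimately have le: "Lp_norm M p ((diff1 h ^^ j) g) \<le> 2 * Lp_norm M p ((diff1 h ^^ Suc j) f)"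
    using Lp_shift[OF X_diff1[OF d], of j h h] by (simp add: mult_2 funpow_swap1)
  have "Lp_norm M p ((diff1 (h + h) ^^ Suc j) f) = Lp_norm M p ((diff1 (h + h) ^^ j) g)"
    by (simp add: funpow_Suc_right eq del: funpow.simps)
  also have "\<dots> \<le> 2 ^ j * Lp_norm M p ((diff1 h ^^ j) g)" by (rule Suc.IH[OF g])
  also have "\<dots> \<le> 2 ^ j * (2 * Lp_norm M p ((diff1 h ^^ Suc j) f))" by (intro mult_left_mono le) auto
  finally show ?case by (simp add: mult_ac)
qed simp

text \<open>The polynomial identity \<open>(z\<^sup>2 - 1)\<^sup>j - 2\<^sup>j (z - 1)\<^sup>j = (z - 1)\<^sup>j\<^sup>+\<^sup>1 Q(z)\<close>, read as an identity
  between difference operators, is the source of Marchaud's inequality.\<close>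

lemma diff1_double_minus:
  "f \<in> X \<Longrightarrow> Lp_norm M p (\<lambda>x. (diff1 (h + h) ^^ j) f x - 2 ^ j * (diff1 h ^^ j) f x) \<le>
     ennreal (real j * 2 ^ j) * Lp_norm M p ((diff1 h ^^ Suc j) f)"
proof (induction j arbitrary: f)
  case 0
  then show ?case by (simp add: Lp_norm_def epowr_def)
next
  case (Suc j)
  define g where "g = diff1 h f"
  have g: "g \<in> X" using X_diff1[OF Suc.prems, where h = h and k = 1] by (simp add: g_def)
  have dg: "diff1 h g \<in> X" using X_diff1[OF g, where h = h and k = 1] by simp
  \<comment> \<open>The identity z^2 - 1 = 2 (z - 1) + (z - 1)^2 with z the translation by h; the
    first term continues the induction, the second already carries one more difference.\<close>
  have "diff1 (h + h) f = (\<lambda>x. 2 * g x + 1 * diff1 h g x)"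
    by (auto simp: g_def diff1_def add_ac)
  then have "(diff1 (h + h) ^^ Suc j) f = (\<lambda>x. 2 * (diff1 (h + h) ^^ j) g x + 1 * (diff1 (h + h) ^^ j) (diff1 h g) x)"
    by (simp only: funpow_Suc_right o_apply diff1_linear)
  moreover have "(diff1 h ^^ Suc j) f = (diff1 h ^^ j) g" by (simp add: g_def funpow_swap1)
  ultimately have eq: "(\<lambda>x. (diff1 (h + h) ^^ Suc j) f x - 2 ^ Suc j * (diff1 h ^^ Suc j) f x) =
      (\<lambda>x. 2 * ((diff1 (h + h) ^^ j) g x - 2 ^ j * (diff1 h ^^ j) g x) + (diff1 (h + h) ^^ j) (diff1 h g) x)"
    by (simp add: algebra_simps)
  let ?E = "\<lambda>x. (diff1 (h + h) ^^ j) g x - 2 ^ j * (diff1 h ^^ j) g x"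
  have E: "?E \<in> X" by (intro X_diff X_scale X_diff1 g)
  have gS: "(diff1 h ^^ Suc j) g = (diff1 h ^^ Suc (Suc j)) f"
    by (simp add: g_def funpow_swap1)
  have gS': "(diff1 h ^^ j) (diff1 h g) = (diff1 h ^^ Suc (Suc j)) f"
    by (simp add: g_def funpow_swap1)
  have "Lp_norm M p (\<lambda>x. 2 * ?E x + (diff1 (h + h) ^^ j) (diff1 h g) x) \<le>
     Lp_norm M p (\<lambda>x. 2 * ?E x) + Lp_norm M p ((diff1 (h + h) ^^ j) (diff1 h g))"
    by (intro Lp_add X_scale E X_diff1 dg)
  also have "\<dots> \<le> 2 * (ennreal (real j * 2 ^ j) * Lp_norm M p ((diff1 h ^^ Suc (Suc j)) f)) + 2 ^ j * Lp_norm M p ((diff1 h ^^ Suc (Suc j)) f)"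
    using Suc.IH[OF g] Lp_diff1_double_le[OF dg, of j h] unfolding gS gS' Lp_scale[OF E]
    by (intro add_mono) (auto intro!: mult_left_mono)
  also have "\<dots> \<le> ennreal (real (Suc j) * 2 ^ Suc j) * Lp_norm M p ((diff1 h ^^ Suc (Suc j)) f)"
  proof -
    have "2 * (ennreal (real j * 2 ^ j)) + 2 ^ j = ennreal (2 * (real j * 2 ^ j) + 2 ^ j)"
      by (simp add: ennreal_mult ennreal_power flip: ennreal_numeral)
    also have "\<dots> \<le> ennreal (real (Suc j) * 2 ^ Suc j)" by (intro ennreal_leI) (simp add: algebra_simps)
    finally have "(2 * (ennreal (real j * 2 ^ j)) + 2 ^ j) * Lp_norm M p ((diff1 h ^^ Suc (Suc j)) f) \<le>
      ennreal (real (Suc j) * 2 ^ Suc j) * Lp_norm M p ((diff1 h ^^ Suc (Suc j)) f)"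
      by (rule mult_right_mono) simp
    then show ?thesis by (simp add: distrib_right mult.assoc)
  qed
  finally show ?case unfolding eq .
qed

text \<open>One step of Marchaud's inequality, by the triangle inequality applied to the differences
  of steps h and 2h. Iterated over dyadic t it becomes a sum over coarser scales.\<close>

lemma modulus_Marchaud:
  assumes f: "f \<in> X"
  shows "2 ^ j * modulus M p j f t \<le> modulus M p j f (2 * t) + ennreal (real j * 2 ^ j) * modulus M p (Suc j) f t"
proof -
  have "2 ^ j * Lp_norm M p ((diff1 h ^^ j) f) \<le> modulus M p j f (2 * t) + ennreal (real j * 2 ^ j) * modulus M p (Suc j) f t"
    if h: "norm h \<le> t" for h
  proof -
    let ?E = "\<lambda>x. (diff1 (h + h) ^^ j) f x - 2 ^ j * (diff1 h ^^ j) f x"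
    have E: "?E \<in> X" by (intro X_diff X_scale X_diff1 f)
    have "2 ^ j * Lp_norm M p ((diff1 h ^^ j) f) = Lp_norm M p (\<lambda>x. 2 ^ j * (diff1 h ^^ j) f x)"
      using Lp_scale[OF X_diff1[OF f], of "2 ^ j" j h] by (simp add: norm_power flip: ennreal_power)
    also have "\<dots> = Lp_norm M p (\<lambda>x. (diff1 (h + h) ^^ j) f x - ?E x)" by simp
    also have "\<dots> \<le> Lp_norm M p ((diff1 (h + h) ^^ j) f) + Lp_norm M p ?E"
      by (intro Lp_diff E X_diff1 f)
    also have "\<dots> \<le> modulus M p j f (2 * t) + ennreal (real j * 2 ^ j) * modulus M p (Suc j) f t"
    proof (rule add_mono)
      have "norm (h + h) \<le> 2 * t" using norm_triangle_ineq[of h h] h by linarith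
      then show "Lp_norm M p ((diff1 (h + h) ^^ j) f) \<le> modulus M p j f (2 * t)"
        unfolding modulus_def by (intro SUP_upper) auto
      have "Lp_norm M p ?E \<le> ennreal (real j * 2 ^ j) * Lp_norm M p ((diff1 h ^^ Suc j) f)"
        by (rule diff1_double_minus[OF f])
      also have "\<dots> \<le> ennreal (real j * 2 ^ j) * modulus M p (Suc j) f t"
        unfolding modulus_def using h by (intro mult_left_mono SUP_upper) auto
      finally show "Lp_norm M p ?E \<le> ennreal (real j * 2 ^ j) * modulus M p (Suc j) f t" .
    qed
    finally show ?thesis .
  qed
  then show ?thesis
    unfolding modulus_def[of M p j f t] by (subst SUP_mult_left_ennreal) (auto intro!: SUP_least)
qed

end

section \<open>Discretization of the quasi-norms\<close>

definition log_weight :: "real \<Rightarrow> real \<Rightarrow> real \<Rightarrow> real" where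
  "log_weight s b t = t powr (- s) * (1 - ln t) powr b"

lemma log_weight_nonneg: "0 \<le> log_weight s b t"
  by (simp add: log_weight_def)

lemma powr_le_two_powr_abs:
  fixes r a :: real
  assumes "1 / 2 \<le> r" "r \<le> 2"
  shows "r powr a \<le> 2 powr \<bar>a\<bar>"
proof (cases "0 \<le> a")
  case True
  then show ?thesis using assms by (simp add: powr_mono2)
next
  case False
  have "r powr a \<le> (1 / 2) powr a" using False assms by (intro powr_mono2') auto
  then show ?thesis using False by (simp add: powr_divide powr_minus field_simps)
qed

text \<open>With t = 2^(-u) and n <= u <= n + 1, the quotient of the two weights is a power of 2^(u
  - n) times a power of (1 + u ln 2) / (1 + n), and both bases lie between 1/2 and 2. Hence
  \<open>wt\<close> is the logarithmic weight at t = 2^(-n) up to a constant.\<close>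

lemma log_weight_bounds:
  obtains C where "1 \<le> C"
    "\<And>n t. 2 powr (- (real n + 1)) \<le> t \<Longrightarrow> t \<le> 2 powr (- real n) \<Longrightarrow>
       log_weight s b t \<le> C * wt s b n \<and> wt s b n \<le> C * log_weight s b t"
proof -
  define C :: real where "C = 2 powr \<bar>s\<bar> * 2 powr \<bar>b\<bar>"
  have "1 * 1 \<le> C" unfolding C_def by (intro mult_mono ge_one_powr_ge_zero) auto
  then have C1: "1 \<le> C" by simp
  have "log_weight s b t \<le> C * wt s b n \<and> wt s b n \<le> C * log_weight s b t"
    if t: "2 powr (- (real n + 1)) \<le> t" "t \<le> 2 powr (- real n)" for n t
  proof -
    have t0: "0 < t" using t(1) by (rule order.strict_trans2[rotated]) simp
    define u where "u = - log 2 t"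
    have tu: "t = 2 powr (- u)" using t0 by (simp add: u_def)
    have u: "real n \<le> u" "u \<le> real n + 1" using t unfolding tu by auto
    have lnt: "1 - ln t = 1 + u * ln 2" unfolding tu by (simp add: ln_powr)
    have ln2: "1 / 2 \<le> ln (2::real)" "ln 2 \<le> (1::real)" using ln2_ge_two_thirds ln_2_less_1 by auto
    have un: "u * (1/2) \<le> u * ln 2" "u * ln 2 \<le> u * 1" using mult_left_mono[OF ln2(1), of u] mult_left_mono[OF ln2(2), of u] u by auto
    define r where "r = (1 + u * ln 2) / (1 + real n)"
    have r: "1 / 2 \<le> r" "r \<le> 2" using u un by (auto simp: r_def field_simps)
    have q: "1 / 2 \<le> 2 powr (u - real n)" "2 powr (u - real n) \<le> 2"
    proof -
      have "2 powr (- 1) \<le> 2 powr (u - real n)" using u by (intro powr_mono) auto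
      then show "1 / 2 \<le> 2 powr (u - real n)" by (simp add: powr_minus)
      have "2 powr (u - real n) \<le> 2 powr (1::real)" using u by (intro powr_mono) auto
      then show "2 powr (u - real n) \<le> 2" by simp
    qed
    have "0 < 1 + u * ln 2" using u ln2 by (simp add: add_pos_nonneg)
    then have eq: "log_weight s b t = wt s b n * ((2 powr (u - real n)) powr s * r powr b)"
      unfolding log_weight_def lnt wt_def r_def
      by (simp add: tu powr_powr powr_divide powr_diff left_diff_distrib mult_ac)
    have "(2 powr (u - real n)) powr s * r powr b \<le> C"
      unfolding C_def by (intro mult_mono powr_le_two_powr_abs r q) auto
    then have "wt s b n * ((2 powr (u - real n)) powr s * r powr b) \<le> wt s b n * C"
      by (rule mult_left_mono[OF _ wt_nonneg])
    then have 1: "log_weight s b t \<le> C * wt s b n" by (simp only: eq mult.commute[of C])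
    have "(2 powr (u - real n)) powr (- s) * r powr (- b) \<le> C"
      unfolding C_def using powr_le_two_powr_abs[OF q, of "- s"] powr_le_two_powr_abs[OF r, of "- b"]
      by (intro mult_mono) auto
    then have "log_weight s b t * ((2 powr (u - real n)) powr (- s) * r powr (- b)) \<le> log_weight s b t * C"
      by (intro mult_left_mono log_weight_nonneg)
    moreover have "log_weight s b t * ((2 powr (u - real n)) powr (- s) * r powr (- b)) = wt s b n"
      unfolding eq using r by (simp add: powr_minus field_simps)
    ultimately show ?thesis using 1 by (simp add: mult.commute)
  qed
  then show ?thesis using that C1 by blast
qed

lemma dyadic_interval:
  assumes "0 < t" "t \<le> (1::real)"
  obtains n :: nat where "2 powr (- (real n + 1)) < t" "t \<le> 2 powr (- real n)"
proof -
  define u where "u = - log 2 t"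
  have tu: "t = 2 powr (- u)" using assms by (simp add: u_def)
  have "0 \<le> u" using assms by (simp add: u_def)
  then obtain n :: nat where "real n \<le> u" "u < real n + 1"
    by (metis add.commute floor_of_nat le_nat_floor of_nat_floor lessI nat_floor_neg not_less of_nat_Suc linorder_not_le)
  then show ?thesis
    by (intro that[of n]) (auto simp: tu)
qed

lemma half_interval_eq: "2 powr (- (real n + 1)) = (2 powr (- real n) :: real) / 2"
  unfolding minus_add_distrib powr_add by (simp add: powr_minus)

lemma dyadic_interval_unique:
  fixes t :: real
  assumes "2 powr (- (real m + 1)) < t" "t \<le> 2 powr (- real m)"
    "2 powr (- (real n + 1)) < t" "t \<le> 2 powr (- real n)"
  shows "m = n"
proof -
  have "2 powr (- (real m + 1)) < (2::real) powr (- real n)" "2 powr (- (real n + 1)) < (2::real) powr (- real m)"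
    using assms by linarith+
  then show ?thesis by simp
qed

section \<open>Equivalence of the integral quasi-norm with its dyadic form\<close>

context shift_invariant_Lp begin

text \<open>Real-valued for the sake of the sequence lemmas. An infinite modulus would be sent to 0,
  so the order properties of \<open>omega\<close> are derived through
  \<open>modulus_eq_omega\<close>, where an Lp bound guarantees finiteness.\<close>

definition omega :: "nat \<Rightarrow> ('a \<Rightarrow> complex) \<Rightarrow> nat \<Rightarrow> real" where
  "omega k f n = enn2real (modulus M p k f (2 powr (- real n)))"

text \<open>The discrete quasi-norm in predicate form. \<open>R\<close> bounds the Lp part and the
  sequence part separately, which differs from bounding their sum by a factor of at most 2.\<close>

definition besov_le :: "ennreal \<Rightarrow> real \<Rightarrow> real \<Rightarrow> nat \<Rightarrow> ('a \<Rightarrow> complex) \<Rightarrow> real \<Rightarrow> bool" where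
  "besov_le q s b k f R \<longleftrightarrow> f \<in> X \<and> Lp_norm M p f \<le> ennreal R \<and> lq_le q (\<lambda>n. wt s b n * omega k f n) R"

lemma omega_nonneg: "0 \<le> omega k f n"
  by (simp add: omega_def)

lemma wt_omega_nonneg: "0 \<le> wt s b n * omega k f n"
  by (simp add: omega_nonneg wt_nonneg)

lemma modulus_finite:
  assumes "f \<in> X" "Lp_norm M p f \<le> ennreal R"
  shows "modulus M p k f t < top"
proof -
  have "modulus M p k f t \<le> 2 ^ k * Lp_norm M p f" by (rule modulus_le[OF assms(1)])
  also have "\<dots> < top" using assms(2) by (simp add: ennreal_mult_less_top less_top power_less_top_ennreal order.strict_trans1[OF _ ennreal_less_top])
  finally show ?thesis .
qed

lemma modulus_eq_omega:
  assumes "f \<in> X" "Lp_norm M p f \<le> ennreal R"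
  shows "modulus M p k f (2 powr (- real n)) = ennreal (omega k f n)"
  using modulus_finite[OF assms, of k "2 powr (- real n)"] by (simp add: omega_def)

lemma omega_le:
  assumes "f \<in> X" "0 \<le> R" "Lp_norm M p f \<le> ennreal R"
  shows "omega k f n \<le> 2 ^ k * R"
proof -
  have "ennreal (omega k f n) \<le> 2 ^ k * Lp_norm M p f"
    unfolding modulus_eq_omega[OF assms(1,3), symmetric] by (rule modulus_le[OF assms(1)])
  also have "\<dots> \<le> 2 ^ k * ennreal R" by (intro mult_left_mono assms) simp
  also have "\<dots> = ennreal (2 ^ k * R)" using assms by (simp add: ennreal_mult ennreal_power[symmetric])
  finally show ?thesis using assms by (simp add: ennreal_le_iff)
qed

lemma decseq_omega:
  assumes "f \<in> X" "Lp_norm M p f \<le> ennreal R"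
  shows "decseq (omega k f)"
proof (rule decseq_SucI)
  fix n
  have "modulus M p k f (2 powr (- real (Suc n))) \<le> modulus M p k f (2 powr (- real n))"
    by (intro modulus_mono powr_mono) auto
  then show "omega k f (Suc n) \<le> omega k f n" unfolding modulus_eq_omega[OF assms]
    by (simp add: ennreal_le_iff omega_nonneg)
qed

lemma besov_le_scale:
  assumes q: "0 < q" "0 \<le> R" "0 \<le> c" "besov_le q s b k f R"
  shows "besov_le q s b k (\<lambda>x. of_real c * f x) (c * R)"
proof -
  have f: "f \<in> X" "Lp_norm M p f \<le> ennreal R" "lq_le q (\<lambda>n. wt s b n * omega k f n) R"
    using assms by (auto simp: besov_le_def)
  have "omega k (\<lambda>x. of_real c * f x) n = c * omega k f n" for n
    using assms by (simp add: omega_def modulus_scale[OF f(1)] enn2real_mult)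
  then have "(\<lambda>n. wt s b n * omega k (\<lambda>x. of_real c * f x) n) = (\<lambda>n. c * (wt s b n * omega k f n))" by auto
  then have "lq_le q (\<lambda>n. wt s b n * omega k (\<lambda>x. of_real c * f x) n) (c * R)"
    using lq_le_scale[OF q(1) wt_omega_nonneg q(2,3) f(3)] by simp
  moreover have "Lp_norm M p (\<lambda>x. of_real c * f x) \<le> ennreal (c * R)"
    using f q by (simp add: Lp_scale ennreal_mult mult_left_mono)
  ultimately show ?thesis using f by (simp add: besov_le_def X_scale)
qed

text \<open>For t between 2^(-(n+1)) and 2^(-n), the modulus at t is at least its value at level n +
  1, so the integrand dominates a step function. The term n = 0 belongs to t = 1, outside the range
  of integration, and is bounded by the Lp norm instead.\<close>

lemma besov_le_if_norm_le:
  assumes q: "0 < q"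
  obtains C where "1 \<le> C"
    "\<And>f R. f \<in> X \<Longrightarrow> 0 \<le> R \<Longrightarrow> besov_norm M p q s b k f \<le> ennreal R \<Longrightarrow> besov_le q s b k f (C * R)"
proof -
  obtain C0 where C0: "1 \<le> C0" "\<And>n t. 2 powr (- (real n + 1)) \<le> t \<Longrightarrow> t \<le> 2 powr (- real n) \<Longrightarrow>
       log_weight s b t \<le> C0 * wt s b n \<and> wt s b n \<le> C0 * log_weight s b t"
    using log_weight_bounds by metis
  have lw: "wt s b n \<le> C0 * log_weight s b t"
    if "2 powr (- (real n + 1)) \<le> t" "t \<le> 2 powr (- real n)" for n t
    using C0(2)[OF that] by simp
  show ?thesis
    using q
  proof (cases q rule: exponent_cases)
    case top
    \<comment> \<open>\<open>2 ^ k\<close> pays for the term n = 0, \<open>C0\<close> for all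
      others.\<close>
    define C where "C = 2 ^ k + C0"
    have C: "1 \<le> C" "2 ^ k \<le> C" "C0 \<le> C" using C0 by (auto simp: C_def add_increasing)
    show ?thesis
    proof (rule that[OF C(1)])
      fix f R assume f: "f \<in> X" "0 \<le> R" "besov_norm M p q s b k f \<le> ennreal R"
      have Lp: "Lp_norm M p f \<le> ennreal R" and semi: "besov_seminorm M p q s b k f \<le> ennreal R"
        using f(3) unfolding besov_norm_def by (auto intro: order_trans[rotated])
      have "wt s b n * omega k f n \<le> C * R" for n
      proof (cases "n = 0")
        case True
        have "omega k f 0 \<le> 2 ^ k * R" by (rule omega_le[OF f(1,2) Lp])
        also have "\<dots> \<le> C * R" using C f by (intro mult_right_mono) auto
        finally show ?thesis using True by simp
      next
        case False
        let ?t = "2 powr (- real n) :: real"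
        have "?t < 2 powr 0" using False by (intro powr_less_mono) auto
        then have "ennreal (log_weight s b ?t) * modulus M p k f ?t \<le> besov_seminorm M p q s b k f"
          unfolding besov_seminorm_def log_weight_def using top by (auto simp: Let_def intro!: SUP_upper2[of ?t])
        also note semi
        finally have "ennreal (log_weight s b ?t * omega k f n) \<le> ennreal R"
          unfolding modulus_eq_omega[OF f(1) Lp] by (simp add: ennreal_mult log_weight_nonneg omega_nonneg)
        then have le: "log_weight s b ?t * omega k f n \<le> R" using f by simp
        have "wt s b n * omega k f n \<le> C0 * log_weight s b ?t * omega k f n"
          by (intro mult_right_mono lw omega_nonneg powr_mono) auto
        also have "\<dots> \<le> C0 * R" using le C0 by (simp add: mult.assoc)
        also have "\<dots> \<le> C * R" using C f by (intro mult_right_mono) auto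
        finally show ?thesis .
      qed
      moreover have "Lp_norm M p f \<le> ennreal (C * R)"
        using Lp C f by (elim order_trans) (simp add: ennreal_leI mult_le_cancel_right1)
      ultimately show "besov_le q s b k f (C * R)" using f top by (simp add: besov_le_def lq_le_top)
    qed
  next
    case (real r)
    have er: "enn2real q = r" "q \<noteq> top" using real by auto
    define C where "C = (2 ^ k) + (2 * C0 powr (3 * r) + (2 ^ k) powr r) powr (1 / r)"
    have C: "1 \<le> C" by (auto simp: C_def add_increasing2)
    show ?thesis
    proof (rule that[OF C(1)])
      fix f R assume f: "f \<in> X" "0 \<le> R" "besov_norm M p q s b k f \<le> ennreal R"
      have Lp: "Lp_norm M p f \<le> ennreal R" and semi: "besov_seminorm M p q s b k f \<le> ennreal R"
        using f(3) unfolding besov_norm_def by (auto intro: order_trans[rotated])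
      define y where "y n = wt s b n * omega k f n" for n
      have y: "0 \<le> y n" for n by (simp add: y_def wt_omega_nonneg)
      define W where "W t = epowr (ennreal (log_weight s b t) * modulus M p k f t) r * ennreal (1 / t)" for t
      have int: "(\<integral>\<^sup>+t\<in>{0<..<1}. W t \<partial>lborel) \<le> ennreal (R powr r)"
        using semi real f(2) unfolding besov_seminorm_def W_def log_weight_def
        by (simp add: Let_def er epowr_le_iff)
      \<comment> \<open>Open intervals are disjoint and stay inside (0, 1). Each has length 2^(-n) /
        2, so the factor 2^n, a lower bound for 1 / t, contributes 1/2 per interval.\<close>
      define I :: "nat \<Rightarrow> real set" where "I n = {2 powr (- (real n + 1))<..<2 powr (- real n)}" for n
      have W_ge: "ennreal ((y (Suc n) / C0 ^ 3) powr r * 2 powr real n) \<le> W t" if "t \<in> I n" for n t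
      proof -
        have t: "2 powr (- (real n + 1)) < t" "t < 2 powr (- real n)" using that by (auto simp: I_def)
        have t0: "0 < t" using t(1) by (rule order.strict_trans[rotated]) simp
        \<comment> \<open>Three comparisons produce the factor C0^3: from level n + 1 to the common
          endpoint, from there to level n, and from level n to \<open>t\<close>.\<close>
        have "wt s b (Suc n) \<le> C0 * log_weight s b (2 powr (- (real n + 1)))"
          by (rule lw) (auto intro: powr_mono)
        also have "\<dots> \<le> C0 * (C0 * wt s b n)"
          using C0 by (intro mult_left_mono) (auto intro!: C0(2)[THEN conjunct1] powr_mono)
        also have "\<dots> \<le> C0 * (C0 * (C0 * log_weight s b t))"
          using C0 t by (intro mult_left_mono lw) auto
        finally have w: "wt s b (Suc n) \<le> C0 ^ 3 * log_weight s b t" by (simp add: power3_eq_cube mult_ac)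
        have x: "ennreal (omega k f (Suc n)) \<le> modulus M p k f t"
          unfolding modulus_eq_omega[OF f(1) Lp, symmetric] using t by (intro modulus_mono) (simp add: add.commute)
        have "ennreal (y (Suc n) / C0 ^ 3) \<le> ennreal (log_weight s b t * omega k f (Suc n))"
          using mult_right_mono[OF w omega_nonneg[of k f "Suc n"]] C0 unfolding y_def
          by (intro ennreal_leI) (simp add: field_simps)
        also have "\<dots> \<le> ennreal (log_weight s b t) * modulus M p k f t"
          using x by (simp add: ennreal_mult log_weight_nonneg omega_nonneg mult_left_mono)
        finally have "epowr (ennreal (y (Suc n) / C0 ^ 3)) r \<le> epowr (ennreal (log_weight s b t) * modulus M p k f t) r"
          by (intro epowr_mono real)
        then have 1: "ennreal ((y (Suc n) / C0 ^ 3) powr r) \<le> epowr (ennreal (log_weight s b t) * modulus M p k f t) r"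
          using y C0 by (simp add: epowr_ennreal)
        have "2 powr real n \<le> 1 / t" using t t0 by (simp add: powr_minus field_simps)
        then show ?thesis unfolding W_def using 1
          by (subst ennreal_mult) (auto intro!: mult_mono ennreal_leI)
      qed
      have part: "(\<Sum>n<N. (y (Suc n) / C0 ^ 3) powr r / 2) \<le> R powr r" for N
      proof -
        have I_meas: "I n \<in> sets lborel" for n by (simp add: I_def)
        have "ennreal (\<Sum>n<N. (y (Suc n) / C0 ^ 3) powr r / 2) = (\<Sum>n<N. ennreal ((y (Suc n) / C0 ^ 3) powr r / 2))"
          by (simp add: sum_ennreal)
        also have "\<dots> = (\<Sum>n<N. ennreal ((y (Suc n) / C0 ^ 3) powr r * 2 powr real n) * emeasure lborel (I n))"
        proof (intro sum.cong refl)
          fix n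
          have "emeasure lborel (I n) = ennreal (2 powr (- real n) - 2 powr (- (real n + 1)))"
            unfolding I_def by (intro emeasure_lborel_Ioo powr_mono) auto
          also have "2 powr (- real n) - 2 powr (- (real n + 1)) = (2::real) powr (- real n) / 2"
            unfolding half_interval_eq by simp
          finally show "ennreal ((y (Suc n) / C0 ^ 3) powr r / 2) = ennreal ((y (Suc n) / C0 ^ 3) powr r * 2 powr real n) * emeasure lborel (I n)"
            by (simp add: ennreal_mult[symmetric] powr_minus)
        qed
        also have "\<dots> = (\<Sum>n<N. \<integral>\<^sup>+t. ennreal ((y (Suc n) / C0 ^ 3) powr r * 2 powr real n) * indicator (I n) t \<partial>lborel)"
          using I_meas by (simp add: nn_integral_cmult_indicator)
        also have "\<dots> = (\<integral>\<^sup>+t. (\<Sum>n<N. ennreal ((y (Suc n) / C0 ^ 3) powr r * 2 powr real n) * indicator (I n) t) \<partial>lborel)"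
          using I_meas by (intro nn_integral_sum[symmetric]) auto
        also have "\<dots> \<le> (\<integral>\<^sup>+t\<in>{0<..<1}. W t \<partial>lborel)"
        proof (rule nn_integral_mono)
          fix t :: real
          show "(\<Sum>n<N. ennreal ((y (Suc n) / C0 ^ 3) powr r * 2 powr real n) * indicator (I n) t) \<le> W t * indicator {0<..<1} t"
          proof (cases "\<exists>m<N. t \<in> I m")
            case True
            then obtain m where m: "m < N" "t \<in> I m" by blast
            have t: "2 powr (- (real m + 1)) < t" "t < 2 powr (- real m)" using m by (auto simp: I_def)
            have t0: "0 < t" using t(1) by (rule order.strict_trans[rotated]) simp
            have "(2::real) powr (- real m) \<le> 2 powr 0" by (intro powr_mono) auto
            then have t1: "t < 1" using t by simp
            have "t \<notin> I n" if "n \<noteq> m" for n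
              using dyadic_interval_unique[of m t n] t that by (force simp: I_def)
            then have "(\<Sum>n<N. ennreal ((y (Suc n) / C0 ^ 3) powr r * 2 powr real n) * indicator (I n) t) =
               (\<Sum>n\<in>{m}. ennreal ((y (Suc n) / C0 ^ 3) powr r * 2 powr real n) * indicator (I n) t)"
              using m by (intro sum.mono_neutral_right) auto
            also have "\<dots> \<le> W t" using W_ge[OF m(2)] m by simp
            finally show ?thesis using t0 t1 by simp
          next
            case False
            then have "(\<Sum>n<N. ennreal ((y (Suc n) / C0 ^ 3) powr r * 2 powr real n) * indicator (I n) t) = 0"
              by (intro sum.neutral) auto
            then show ?thesis by simp
          qed
        qed
        also note int
        finally show ?thesis by (simp add: ennreal_le_iff)
      qed
      have x0: "y 0 powr r \<le> (2 ^ k * R) powr r"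
        using omega_le[OF f(1,2) Lp, of k 0] real omega_nonneg by (intro powr_mono2) (auto simp: y_def)
      have "(\<Sum>n<N. y n powr r) \<le> (C * R) powr r" for N
      proof -
        have C03: "(C0 ^ 3) powr r = C0 powr (3 * r)"
          using C0 by (simp add: powr_powr flip: powr_numeral)
        have C0p: "0 < C0 powr (3 * r)" using C0 by simp
        have "(\<Sum>n<N. y n powr r) \<le> (\<Sum>n<Suc N. y n powr r)" by simp
        also have "\<dots> = y 0 powr r + (\<Sum>n<N. y (Suc n) powr r)" by (rule sum.lessThan_Suc_shift)
        also have "(\<Sum>n<N. y (Suc n) powr r) = 2 * C0 powr (3 * r) * (\<Sum>n<N. (y (Suc n) / C0 ^ 3) powr r / 2)"
          unfolding sum_distrib_left using y C0 C0p by (intro sum.cong refl) (simp add: powr_divide C03)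
        also have "\<dots> \<le> 2 * C0 powr (3 * r) * R powr r" by (intro mult_left_mono part) auto
        finally have "(\<Sum>n<N. y n powr r) \<le> (2 ^ k * R) powr r + 2 * C0 powr (3 * r) * R powr r" using x0 by simp
        also have "\<dots> = (2 * C0 powr (3 * r) + (2 ^ k) powr r) * R powr r"
          using f by (simp add: powr_mult algebra_simps)
        also have "\<dots> = ((2 * C0 powr (3 * r) + (2 ^ k) powr r) powr (1 / r) * R) powr r"
          using f real by (simp add: powr_mult powr_powr)
        also have "\<dots> \<le> (C * R) powr r"
          using f real by (intro powr_mono2 mult_right_mono) (auto simp: C_def)
        finally show ?thesis .
      qed
      then have "lq_le q y (C * R)" using real lq_le_real by blast
      moreover have "Lp_norm M p f \<le> ennreal (C * R)"
        using Lp C f by (elim order_trans) (simp add: ennreal_leI mult_le_cancel_right1)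
      ultimately show "besov_le q s b k f (C * R)" using f by (simp add: besov_le_def y_def[abs_def])
    qed
  qed
qed

text \<open>For t in the n-th dyadic interval, both factors of the integrand are at most a constant
  times their values at the level of the right endpoint, so a step function dominates the
  integrand.\<close>

lemma norm_le_if_besov_le:
  assumes q: "0 < q"
  obtains C where "1 \<le> C"
    "\<And>f R. 0 \<le> R \<Longrightarrow> besov_le q s b k f R \<Longrightarrow> besov_norm M p q s b k f \<le> ennreal (C * R)"
proof -
  obtain C0 where C0: "1 \<le> C0" "\<And>n t. 2 powr (- (real n + 1)) \<le> t \<Longrightarrow> t \<le> 2 powr (- real n) \<Longrightarrow>
       log_weight s b t \<le> C0 * wt s b n \<and> wt s b n \<le> C0 * log_weight s b t"
    using log_weight_bounds by metis
  have "besov_norm M p q s b k f \<le> ennreal ((1 + C0) * R)" if R: "0 \<le> R" and D: "besov_le q s b k f R" for f R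
  proof -
    have f: "f \<in> X" "Lp_norm M p f \<le> ennreal R" "lq_le q (\<lambda>n. wt s b n * omega k f n) R"
      using D by (auto simp: besov_le_def)
    define y where "y n = wt s b n * omega k f n" for n
    have y: "0 \<le> y n" for n by (simp add: y_def wt_omega_nonneg)
    have W_le: "ennreal (log_weight s b t) * modulus M p k f t \<le> ennreal (C0 * y n)"
      if t: "2 powr (- (real n + 1)) < t" "t \<le> 2 powr (- real n)" for n t
    proof -
      have "ennreal (log_weight s b t) * modulus M p k f t \<le> ennreal (C0 * wt s b n) * ennreal (omega k f n)"
        unfolding modulus_eq_omega[OF f(1,2), symmetric] using C0(2)[of n t] t
        by (intro mult_mono ennreal_leI modulus_mono) auto
      also have "\<dots> = ennreal (C0 * y n)"
        using C0 by (simp add: ennreal_mult[symmetric] wt_nonneg omega_nonneg y_def mult.assoc)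
      finally show ?thesis .
    qed
    have "besov_seminorm M p q s b k f \<le> ennreal (C0 * R)"
      using q
    proof (cases q rule: exponent_cases)
      case top
      have "ennreal (log_weight s b t) * modulus M p k f t \<le> ennreal (C0 * R)" if t: "t \<in> {0<..<1}" for t
      proof -
        have "0 < t" "t \<le> 1" using t by auto
        then obtain n :: nat where n: "2 powr (- (real n + 1)) < t" "t \<le> 2 powr (- real n)" by (rule dyadic_interval)
        have "y n \<le> R" using f(3) top by (simp add: y_def lq_le_top)
        then have "ennreal (C0 * y n) \<le> ennreal (C0 * R)" using C0 by (intro ennreal_leI mult_left_mono) auto
        with W_le[OF n] show ?thesis by (rule order_trans)
      qed
      then show ?thesis
        unfolding besov_seminorm_def log_weight_def using top by (auto simp: Let_def intro!: SUP_least)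
    next
      case (real r)
      have er: "enn2real q = r" "q \<noteq> top" using real by auto
      define W where "W t = epowr (ennreal (log_weight s b t) * modulus M p k f t) r * ennreal (1 / t)" for t
      \<comment> \<open>Half-open intervals, since here they have to cover all of (0, 1). The length
        2^(-(n+1)) cancels the bound 2^(n+1) for 1 / t.\<close>
      define J :: "nat \<Rightarrow> real set" where "J n = {2 powr (- (real n + 1))<..2 powr (- real n)}" for n
      have J_meas: "J n \<in> sets lborel" for n by (simp add: J_def)
      have "(\<integral>\<^sup>+t\<in>{0<..<1}. W t \<partial>lborel) \<le> (\<integral>\<^sup>+t. (\<Sum>n. ennreal ((C0 * y n) powr r * 2 powr (real n + 1)) * indicator (J n) t) \<partial>lborel)"
      proof (rule nn_integral_mono)
        fix t :: real
        show "W t * indicator {0<..<1} t \<le> (\<Sum>n. ennreal ((C0 * y n) powr r * 2 powr (real n + 1)) * indicator (J n) t)"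
        proof (cases "t \<in> {0<..<1}")
          case True
          then have "0 < t" "t \<le> 1" by auto
          then obtain n :: nat where n: "2 powr (- (real n + 1)) < t" "t \<le> 2 powr (- real n)" by (rule dyadic_interval)
          have "epowr (ennreal (log_weight s b t) * modulus M p k f t) r \<le> epowr (ennreal (C0 * y n)) r"
            by (intro epowr_mono real W_le n)
          also have "\<dots> = ennreal ((C0 * y n) powr r)" using C0 y by (simp add: epowr_ennreal)
          finally have 1: "epowr (ennreal (log_weight s b t) * modulus M p k f t) r \<le> ennreal ((C0 * y n) powr r)" .
          have "1 / t \<le> 2 powr (real n + 1)" using n(1) \<open>0 < t\<close> unfolding half_interval_eq by (simp add: powr_minus field_simps powr_add)
          then have "W t \<le> ennreal ((C0 * y n) powr r * 2 powr (real n + 1)) * indicator (J n) t"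
            unfolding W_def using 1 n by (subst ennreal_mult) (auto simp: J_def intro!: mult_mono ennreal_leI)
          also have "\<dots> \<le> (\<Sum>n. ennreal ((C0 * y n) powr r * 2 powr (real n + 1)) * indicator (J n) t)"
          proof -
            have "F n \<le> suminf F" for F :: "nat \<Rightarrow> ennreal"
              using sum_le_suminf[OF summableI, of "{n}" F] by simp
            then show ?thesis .
          qed
          finally show ?thesis using True by simp
        qed simp
      qed
      also have "\<dots> = (\<Sum>n. \<integral>\<^sup>+t. ennreal ((C0 * y n) powr r * 2 powr (real n + 1)) * indicator (J n) t \<partial>lborel)"
        using J_meas by (intro nn_integral_suminf) auto
      also have "\<dots> = (\<Sum>n. ennreal ((C0 * y n) powr r))"
      proof (rule suminf_cong)
        fix n
        have "emeasure lborel (J n) = ennreal (2 powr (- real n) - 2 powr (- (real n + 1)))"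
          unfolding J_def by (intro emeasure_lborel_Ioc powr_mono) auto
        also have "2 powr (- real n) - 2 powr (- (real n + 1)) = (2::real) powr (- (real n + 1))"
          unfolding half_interval_eq by simp
        finally show "(\<integral>\<^sup>+t. ennreal ((C0 * y n) powr r * 2 powr (real n + 1)) * indicator (J n) t \<partial>lborel) = ennreal ((C0 * y n) powr r)"
          using J_meas by (simp add: nn_integral_cmult_indicator ennreal_mult[symmetric] flip: powr_add)
      qed
      also have "\<dots> \<le> ennreal ((C0 * R) powr r)"
      proof (rule suminf_le_const[OF summableI])
        fix N
        have "(\<Sum>n<N. (C0 * y n) powr r) = C0 powr r * (\<Sum>n<N. y n powr r)"
          using C0 y by (simp add: powr_mult sum_distrib_left)
        also have "\<dots> \<le> C0 powr r * R powr r"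
          using f(3) real lq_le_real[of r] unfolding y_def by (intro mult_left_mono) auto
        finally show "(\<Sum>n<N. ennreal ((C0 * y n) powr r)) \<le> ennreal ((C0 * R) powr r)"
          using C0 R by (simp add: sum_ennreal ennreal_leI powr_mult)
      qed
      finally show ?thesis
        using real C0 R unfolding besov_seminorm_def W_def log_weight_def
        by (simp add: Let_def er epowr_le_iff)
    qed
    then have "besov_norm M p q s b k f \<le> ennreal R + ennreal (C0 * R)"
      unfolding besov_norm_def using f(2) by (intro add_mono)
    also have "\<dots> = ennreal ((1 + C0) * R)" using R C0 by (simp add: ennreal_plus[symmetric] distrib_right del: ennreal_plus)
    finally show ?thesis .
  qed
  then show ?thesis using that[of "1 + C0"] C0 by auto
qed

section \<open>Continuous embeddings as quasi-norm inequalities\<close>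

definition besov_set :: "ennreal \<Rightarrow> real \<Rightarrow> real \<Rightarrow> nat \<Rightarrow> ('a \<Rightarrow> complex) set" where
  "besov_set q s b k = {f \<in> X. Lp_norm M p f < \<infinity> \<and> besov_norm M p q s b k f < \<infinity>}"

definition besov_bounded ::
    "ennreal \<Rightarrow> real \<Rightarrow> real \<Rightarrow> nat \<Rightarrow> ennreal \<Rightarrow> real \<Rightarrow> real \<Rightarrow> nat \<Rightarrow> bool" where
  "besov_bounded q0 s0 b0 k0 q1 s1 b1 k1 \<longleftrightarrow>
     (\<exists>C>0. \<forall>f R. 0 < R \<longrightarrow> besov_le q0 s0 b0 k0 f R \<longrightarrow> besov_le q1 s1 b1 k1 f (C * R))"

lemma besov_boundedI:
  assumes "0 < C" "\<And>f R. 0 < R \<Longrightarrow> besov_le q0 s0 b0 k0 f R \<Longrightarrow> besov_le q1 s1 b1 k1 f (C * R)"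
  shows "besov_bounded q0 s0 b0 k0 q1 s1 b1 k1"
  using assms unfolding besov_bounded_def by blast

lemma besov_boundedE:
  assumes "besov_bounded q0 s0 b0 k0 q1 s1 b1 k1"
  obtains C where "0 < C" "\<And>f R. 0 < R \<Longrightarrow> besov_le q0 s0 b0 k0 f R \<Longrightarrow> besov_le q1 s1 b1 k1 f (C * R)"
proof -
  obtain C where "0 < C" "\<forall>f R. 0 < R \<longrightarrow> besov_le q0 s0 b0 k0 f R \<longrightarrow> besov_le q1 s1 b1 k1 f (C * R)"
    using assms unfolding besov_bounded_def by blast
  then show ?thesis by (intro that[of C]) auto
qed

lemma besov_bounded_trans:
  assumes "besov_bounded q0 s0 b0 k0 q1 s1 b1 k1" "besov_bounded q1 s1 b1 k1 q2 s2 b2 k2"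
  shows "besov_bounded q0 s0 b0 k0 q2 s2 b2 k2"
proof -
  obtain C where C: "0 < C" "\<And>f R. 0 < R \<Longrightarrow> besov_le q0 s0 b0 k0 f R \<Longrightarrow> besov_le q1 s1 b1 k1 f (C * R)"
    by (rule besov_boundedE[OF assms(1)]) blast
  obtain D where D: "0 < D" "\<And>f R. 0 < R \<Longrightarrow> besov_le q1 s1 b1 k1 f R \<Longrightarrow> besov_le q2 s2 b2 k2 f (D * R)"
    by (rule besov_boundedE[OF assms(2)]) blast
  show ?thesis
  proof (rule besov_boundedI)
    show "0 < D * C" using C D by simp
    fix f and R :: real assume "0 < R" "besov_le q0 s0 b0 k0 f R"
    then have "besov_le q2 s2 b2 k2 f (D * (C * R))" using C by (intro D(2)) auto
    then show "besov_le q2 s2 b2 k2 f (D * C * R)" by (simp add: mult.assoc)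
  qed
qed

lemma besov_le_zero: "0 < q \<Longrightarrow> besov_le q s b k (\<lambda>x. 0) 0"
proof -
  assume q: "0 < q"
  have Lp: "Lp_norm M p (\<lambda>x. 0::complex) = 0" by (simp add: Lp_norm_def epowr_def)
  have omega0: "omega k (\<lambda>x. 0) n = 0" for n
    using omega_le[OF X_zero, of 0 k n] omega_nonneg[of k "\<lambda>x. 0" n] by (simp add: Lp)
  show ?thesis
    using q by (cases q rule: exponent_cases) (auto simp: besov_le_def X_zero lq_le_top lq_le_real Lp omega0)
qed

text \<open>Continuity at 0 and rescaling give the inequality. Conversely the inequality is applied
  to g - f, which lies in \<open>X\<close>, so no triangle inequality for the quasi-norm is
  involved.\<close>

lemma continuously_embedded_iff:
  assumes q: "0 < q0" "0 < q1"
  shows "continuously_embedded (besov_set q0 s0 b0 k0) (besov_norm M p q0 s0 b0 k0)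
      (besov_set q1 s1 b1 k1) (besov_norm M p q1 s1 b1 k1) \<longleftrightarrow> besov_bounded q0 s0 b0 k0 q1 s1 b1 k1"
    (is "?E \<longleftrightarrow> ?B")
proof
  obtain C0 where C0: "1 \<le> C0" "\<And>f R. 0 \<le> R \<Longrightarrow> besov_le q0 s0 b0 k0 f R \<Longrightarrow> besov_norm M p q0 s0 b0 k0 f \<le> ennreal (C0 * R)"
    using norm_le_if_besov_le[OF q(1)] by metis
  obtain C1 where C1: "1 \<le> C1" "\<And>f R. f \<in> X \<Longrightarrow> 0 \<le> R \<Longrightarrow> besov_norm M p q1 s1 b1 k1 f \<le> ennreal R \<Longrightarrow> besov_le q1 s1 b1 k1 f (C1 * R)"
    using besov_le_if_norm_le[OF q(2)] by metis
  assume E: ?E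
  have in_set: "f \<in> besov_set q0 s0 b0 k0" if "0 \<le> R" "besov_le q0 s0 b0 k0 f R" for f R
    using C0(2)[OF that] that(2) unfolding besov_set_def besov_le_def
    by (auto intro: order.strict_trans1[OF _ ennreal_less_top])
  have zero: "(\<lambda>x. 0) \<in> besov_set q0 s0 b0 k0"
    by (rule in_set[OF order_refl besov_le_zero[OF q(1)]])
  have "\<exists>d>0. \<forall>g\<in>besov_set q0 s0 b0 k0. besov_norm M p q0 s0 b0 k0 (\<lambda>x. g x - 0) < ennreal d \<longrightarrow>
      besov_norm M p q1 s1 b1 k1 (\<lambda>x. g x - 0) < ennreal 1"
    by (rule E[unfolded continuously_embedded_def, THEN conjunct2, rule_format, OF zero zero_less_one])
  then obtain d :: real where d: "0 < d" "\<And>g. g \<in> besov_set q0 s0 b0 k0 \<Longrightarrow>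
      besov_norm M p q0 s0 b0 k0 g < ennreal d \<Longrightarrow> besov_norm M p q1 s1 b1 k1 g < ennreal 1"
    by auto
  \<comment> \<open>The size to which \<open>f\<close> is rescaled: the factor 2 keeps C0 e strictly
    below the radius \<open>d\<close> of continuity.\<close>
  define e where "e = d / (2 * C0)"
  have e: "0 < e" "C0 * e < d" using d C0 by (auto simp: e_def)
  show ?B
  proof (rule besov_boundedI)
    show "0 < C1 / e" using C1 e by simp
    fix f and R :: real assume R: "0 < R" and f: "besov_le q0 s0 b0 k0 f R"
    define g where "g = (\<lambda>x. of_real (e / R) * f x)"
    have "besov_le q0 s0 b0 k0 g (e / R * R)"
      unfolding g_def using R e f by (intro besov_le_scale q) auto
    then have g: "besov_le q0 s0 b0 k0 g e" using R by simp
    have "besov_norm M p q0 s0 b0 k0 g \<le> ennreal (C0 * e)" using e g by (intro C0(2)) auto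
    also have "\<dots> < ennreal d" using e d C0 by (intro ennreal_lessI) auto
    finally have "besov_norm M p q1 s1 b1 k1 g < ennreal 1"
      using d(2)[OF in_set[OF less_imp_le[OF e(1)] g]] by simp
    then have "besov_le q1 s1 b1 k1 g (C1 * 1)"
      using g by (intro C1(2)) (auto simp: besov_le_def)
    then have "besov_le q1 s1 b1 k1 (\<lambda>x. of_real (R / e) * g x) (R / e * (C1 * 1))"
      using R e C1 by (intro besov_le_scale q) auto
    moreover have "(\<lambda>x. of_real (R / e) * g x) = f" using R e by (auto simp: g_def fun_eq_iff)
    ultimately show "besov_le q1 s1 b1 k1 f (C1 / e * R)" by (simp add: mult.commute)
  qed
next
  obtain C0 where C0: "1 \<le> C0" "\<And>f R. f \<in> X \<Longrightarrow> 0 \<le> R \<Longrightarrow> besov_norm M p q0 s0 b0 k0 f \<le> ennreal R \<Longrightarrow> besov_le q0 s0 b0 k0 f (C0 * R)"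
    using besov_le_if_norm_le[OF q(1)] by metis
  obtain C1 where C1: "1 \<le> C1" "\<And>f R. 0 \<le> R \<Longrightarrow> besov_le q1 s1 b1 k1 f R \<Longrightarrow> besov_norm M p q1 s1 b1 k1 f \<le> ennreal (C1 * R)"
    using norm_le_if_besov_le[OF q(2)] by metis
  assume ?B
  then obtain C where C: "0 < C" "\<And>f R. 0 < R \<Longrightarrow> besov_le q0 s0 b0 k0 f R \<Longrightarrow> besov_le q1 s1 b1 k1 f (C * R)"
    by (rule besov_boundedE) blast
  define K where "K = C1 * (C * C0)"
  have K: "0 < K" using C C0 C1 by (simp add: K_def)
  have bound: "besov_norm M p q1 s1 b1 k1 f \<le> ennreal (K * R)"
    if "f \<in> X" "0 < R" "besov_norm M p q0 s0 b0 k0 f \<le> ennreal R" for f R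
  proof -
    have "besov_le q0 s0 b0 k0 f (C0 * R)" using that by (intro C0(2)) auto
    then have "besov_le q1 s1 b1 k1 f (C * (C0 * R))" using that C0 by (intro C(2)) auto
    then have "besov_norm M p q1 s1 b1 k1 f \<le> ennreal (C1 * (C * (C0 * R)))"
      using that C C0 by (intro C1(2)) auto
    then show ?thesis by (simp add: K_def mult.assoc)
  qed
  show ?E
    unfolding continuously_embedded_def
  proof (intro conjI ballI allI impI)
    show "besov_set q0 s0 b0 k0 \<subseteq> besov_set q1 s1 b1 k1"
    proof
      fix f assume f: "f \<in> besov_set q0 s0 b0 k0"
      then obtain r where r: "0 \<le> r" "besov_norm M p q0 s0 b0 k0 f = ennreal r"
        by (cases "besov_norm M p q0 s0 b0 k0 f") (auto simp: besov_set_def)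
      \<comment> \<open>\<open>r + 1\<close> instead of \<open>r\<close>, because
        \<open>bound\<close> requires a positive radius and the norm may be 0.\<close>
      have "besov_norm M p q1 s1 b1 k1 f \<le> ennreal (K * (r + 1))"
        using f r by (intro bound) (auto simp: besov_set_def intro!: ennreal_leI)
      then show "f \<in> besov_set q1 s1 b1 k1" using f
        by (auto simp: besov_set_def intro: order.strict_trans1[OF _ ennreal_less_top])
    qed
  next
    fix f and e :: real assume f: "f \<in> besov_set q0 s0 b0 k0" and e: "0 < e"
    show "\<exists>d>0. \<forall>g\<in>besov_set q0 s0 b0 k0. besov_norm M p q0 s0 b0 k0 (\<lambda>x. g x - f x) < ennreal d \<longrightarrow>
        besov_norm M p q1 s1 b1 k1 (\<lambda>x. g x - f x) < ennreal e"
    proof (intro exI[of _ "e / (2 * K)"] conjI ballI impI)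
      show d: "0 < e / (2 * K)" using e K by simp
      fix g assume g: "g \<in> besov_set q0 s0 b0 k0" "besov_norm M p q0 s0 b0 k0 (\<lambda>x. g x - f x) < ennreal (e / (2 * K))"
      have "besov_norm M p q1 s1 b1 k1 (\<lambda>x. g x - f x) \<le> ennreal (K * (e / (2 * K)))"
        using f g d by (intro bound X_diff) (auto simp: besov_set_def)
      also have "\<dots> < ennreal e" using K e by (intro ennreal_lessI) auto
      finally show "besov_norm M p q1 s1 b1 k1 (\<lambda>x. g x - f x) < ennreal e" .
    qed
  qed
qed

section \<open>Independence of the order of the difference\<close>

lemma omega_Suc_le:
  assumes "f \<in> X" "Lp_norm M p f \<le> ennreal R"
  shows "omega (Suc k) f n \<le> 2 * omega k f n"
proof -
  have "ennreal (omega (Suc k) f n) \<le> ennreal (2 * omega k f n)"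
    using modulus_Suc_le[OF assms(1), of k "2 powr (- real n)"] unfolding modulus_eq_omega[OF assms]
    by (simp add: ennreal_mult' omega_nonneg)
  then show ?thesis by (simp add: ennreal_le_iff omega_nonneg)
qed

lemma besov_bounded_order_Suc:
  assumes q: "0 < q"
  shows "besov_bounded q s b k q s b (Suc k)"
proof (rule besov_boundedI[of 2])
  fix f and R :: real assume R: "0 < R" and f: "besov_le q s b k f R"
  have f': "f \<in> X" "Lp_norm M p f \<le> ennreal R" "lq_le q (\<lambda>n. wt s b n * omega k f n) R"
    using f by (auto simp: besov_le_def)
  have "lq_le q (\<lambda>n. 2 * (wt s b n * omega k f n)) (2 * R)"
    using R by (intro lq_le_scale q f' wt_omega_nonneg) auto
  then have "lq_le q (\<lambda>n. wt s b n * omega (Suc k) f n) (2 * R)"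
  proof (rule lq_le_mono[OF q wt_omega_nonneg, rotated])
    fix n
    show "wt s b n * omega (Suc k) f n \<le> 2 * (wt s b n * omega k f n)"
      using mult_left_mono[OF omega_Suc_le[OF f'(1,2), of k n] wt_nonneg[of s b n]] by simp
  qed
  moreover have "Lp_norm M p f \<le> ennreal (2 * R)"
    using f'(2) R by (elim order_trans) (simp add: ennreal_leI)
  ultimately show "besov_le q s b (Suc k) f (2 * R)" using f' by (simp add: besov_le_def)
qed simp

lemma omega_Marchaud:
  assumes "f \<in> X" "Lp_norm M p f \<le> ennreal R"
  shows "omega j f (Suc n) \<le> 2 powr (- real j) * omega j f n + real j * omega (Suc j) f (Suc n)"
proof -
  have t: "2 * 2 powr (- real (Suc n)) = (2::real) powr (- real n)"
    using half_interval_eq[of n] by (simp add: add.commute)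
  have "2 ^ j * ennreal (omega j f (Suc n)) \<le> ennreal (omega j f n) + ennreal (real j * 2 ^ j) * ennreal (omega (Suc j) f (Suc n))"
    using modulus_Marchaud[OF assms(1), of j "2 powr (- real (Suc n))"] unfolding t modulus_eq_omega[OF assms] .
  also have "2 ^ j * ennreal (omega j f (Suc n)) = ennreal (2 ^ j * omega j f (Suc n))"
    by (simp add: ennreal_mult omega_nonneg flip: ennreal_power)
  also have "ennreal (omega j f n) + ennreal (real j * 2 ^ j) * ennreal (omega (Suc j) f (Suc n)) =
      ennreal (omega j f n + real j * 2 ^ j * omega (Suc j) f (Suc n))"
    by (simp add: ennreal_mult ennreal_plus omega_nonneg)
  finally have "2 ^ j * omega j f (Suc n) \<le> omega j f n + real j * 2 ^ j * omega (Suc j) f (Suc n)"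
    by (simp add: ennreal_le_iff omega_nonneg del: ennreal_plus)
  then show ?thesis by (simp add: powr_minus powr_realpow field_simps)
qed

text \<open>Iterating Marchaud's inequality bounds \<open>omega j f n\<close> by a sum over coarser
  levels i with factor 2^(-j(n - i)). The weights grow like 2^(s(n - i)), so s < j leaves
  exponential decay and the discrete Hardy inequality applies.\<close>

lemma besov_bounded_order_pred:
  assumes q: "0 < q" and s: "s < real j"
  shows "besov_bounded q s b (Suc j) q s b j"
proof -
  \<comment> \<open>Half of the gap between j and s: one \<open>e\<close> is lost when the weights
    are compared, the other remains as decay.\<close>
  define e where "e = (real j - s) / 2"
  have e: "0 < e" using s by (simp add: e_def)
  obtain C1 where C1: "0 < C1"
    "\<And>n i. wt s b n \<le> C1 * 2 powr (s * (real n - real i) + e * \<bar>real n - real i\<bar>) * wt s b i"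
    using wt_ratio[OF e] by metis
  obtain C2 where C2: "1 \<le> C2"
    "\<And>y R. (\<And>n. 0 \<le> y n) \<Longrightarrow> 0 \<le> R \<Longrightarrow> lq_le q y R \<Longrightarrow> lq_le q (y(0 := R)) (C2 * R)"
    using lq_le_update_0[OF q] by metis
  obtain C3 where C3: "0 < C3"
    "\<And>y z J B. (\<And>n. 0 \<le> y n) \<Longrightarrow> (\<And>n. 0 \<le> z n) \<Longrightarrow> 0 \<le> B \<Longrightarrow>
       (\<And>n. z n \<le> (\<Sum>j<J n. 2 powr (- e * \<bar>real n - real j\<bar>) * y j)) \<Longrightarrow>
       lq_le q y B \<Longrightarrow> lq_le q z (C3 * B)"
    by (rule lq_le_convolution[OF e q]) blast
  define A where "A = (2::real) ^ j + real j"
  have A: "0 < A" "2 ^ j \<le> A" "real j \<le> A" by (auto simp: A_def add_pos_nonneg)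
  define K where "K = 1 + C3 * (C1 * (C2 * A))"
  have K: "1 \<le> K" "C3 * (C1 * (C2 * A)) \<le> K" using A C1 C2 C3 by (auto simp: K_def)
  show ?thesis
  proof (rule besov_boundedI)
    show "0 < K" using K by simp
    fix f and R :: real assume R: "0 < R" and f: "besov_le q s b (Suc j) f R"
    have f': "f \<in> X" "Lp_norm M p f \<le> ennreal R" "lq_le q (\<lambda>n. wt s b n * omega (Suc j) f n) R"
      using f by (auto simp: besov_le_def)
    \<comment> \<open>The entry at 0 starts the recursion: at level 0 the modulus is bounded by 2^j
      times the Lp norm.\<close>
    define y where "y n = (if n = 0 then 2 ^ j * R else real j * omega (Suc j) f n)" for n
    have x_le: "omega j f n \<le> (\<Sum>i<Suc n. 2 powr (- real j * (real n - real i)) * y i)" for n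
    proof (induction n)
      case 0
      then show ?case using omega_le[OF f'(1) less_imp_le[OF R] f'(2), of j 0] by (simp add: y_def)
    next
      case (Suc n)
      have "omega j f (Suc n) \<le> 2 powr (- real j) * omega j f n + real j * omega (Suc j) f (Suc n)"
        by (rule omega_Marchaud[OF f'(1,2)])
      also have "\<dots> \<le> 2 powr (- real j) * (\<Sum>i<Suc n. 2 powr (- real j * (real n - real i)) * y i) + y (Suc n)"
        using mult_left_mono[OF Suc, of "2 powr (- real j)"] by (simp add: y_def)
      also have "2 powr (- real j) * (\<Sum>i<Suc n. 2 powr (- real j * (real n - real i)) * y i) =
          (\<Sum>i<Suc n. 2 powr (- real j * (real (Suc n) - real i)) * y i)"
        unfolding sum_distrib_left
      proof (intro sum.cong refl)
        fix i
        have "- real j * (real (Suc n) - real i) = - real j + - real j * (real n - real i)" by (simp add: algebra_simps)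
        then show "2 powr (- real j) * (2 powr (- real j * (real n - real i)) * y i) = 2 powr (- real j * (real (Suc n) - real i)) * y i"
          by (simp only: powr_add mult.assoc)
      qed
      finally show ?case by simp
    qed
    \<comment> \<open>A majorant of the weighted \<open>y\<close> whose entry at 0 is a multiple of
      \<open>R\<close>, the form that \<open>lq_le_update_0\<close> can estimate.\<close>
    define v where "v = (\<lambda>n. A * (wt s b n * omega (Suc j) f n))(0 := A * R)"
    have v0: "0 \<le> v n" for n using A R by (auto simp: v_def wt_nonneg omega_nonneg)
    have wy: "wt s b n * y n \<le> v n" for n
    proof (cases "n = 0")
      case False
      have "real j * (wt s b n * omega (Suc j) f n) \<le> A * (wt s b n * omega (Suc j) f n)"
        by (intro mult_right_mono A wt_omega_nonneg)
      then show ?thesis using False by (simp add: y_def v_def mult_ac)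
    qed (use A R in \<open>simp add: y_def v_def\<close>)
    have "lq_le q (\<lambda>n. A * (wt s b n * omega (Suc j) f n)) (A * R)"
      using A R by (intro lq_le_scale q f' wt_omega_nonneg) auto
    then have "lq_le q v (C2 * (A * R))"
      unfolding v_def using A R by (intro C2(2)) (auto simp: wt_nonneg omega_nonneg)
    then have "lq_le q (\<lambda>n. C1 * v n) (C1 * (C2 * (A * R)))"
      using A R C1 C2 v0 by (intro lq_le_scale q) auto
    then have "lq_le q (\<lambda>n. wt s b n * omega j f n) (C3 * (C1 * (C2 * (A * R))))"
    proof (rule C3(2)[rotated -1])
      show "wt s b n * omega j f n \<le> (\<Sum>i<Suc n. 2 powr (- e * \<bar>real n - real i\<bar>) * (C1 * v i))" for n
      proof -
        have "wt s b n * omega j f n \<le> wt s b n * (\<Sum>i<Suc n. 2 powr (- real j * (real n - real i)) * y i)"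
          by (intro mult_left_mono x_le wt_nonneg)
        also have "\<dots> = (\<Sum>i<Suc n. 2 powr (- real j * (real n - real i)) * (wt s b n * y i))"
          unfolding sum_distrib_left by (intro sum.cong refl) (simp add: mult_ac)
        also have "\<dots> \<le> (\<Sum>i<Suc n. 2 powr (- e * \<bar>real n - real i\<bar>) * (C1 * v i))"
        proof (rule sum_mono)
          fix i assume i: "i \<in> {..<Suc n}"
          have y0: "0 \<le> y i" using R by (simp add: y_def omega_nonneg)
          have "2 powr (- real j * (real n - real i)) * (wt s b n * y i) \<le>
              2 powr (- real j * (real n - real i)) * (C1 * 2 powr (s * (real n - real i) + e * \<bar>real n - real i\<bar>) * wt s b i * y i)"
            by (intro mult_left_mono mult_right_mono C1 y0) auto
          also have "\<dots> = C1 * (2 powr (- real j * (real n - real i)) * 2 powr (s * (real n - real i) + e * \<bar>real n - real i\<bar>)) * (wt s b i * y i)"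
            by (simp add: mult_ac)
          also have "2 powr (- real j * (real n - real i)) * 2 powr (s * (real n - real i) + e * \<bar>real n - real i\<bar>) =
              2 powr (- e * \<bar>real n - real i\<bar>)"
          proof -
            have a: "\<bar>real n - real i\<bar> = real n - real i" using i by auto
            have "- real j * (real n - real i) + (s * (real n - real i) + e * \<bar>real n - real i\<bar>) = - e * \<bar>real n - real i\<bar>"
              unfolding a e_def by (simp add: field_simps)
            then show ?thesis by (simp only: powr_add[symmetric])
          qed
          also have "C1 * 2 powr (- e * \<bar>real n - real i\<bar>) * (wt s b i * y i) \<le> C1 * 2 powr (- e * \<bar>real n - real i\<bar>) * v i"
            using C1 wy by (intro mult_left_mono) auto
          finally show "2 powr (- real j * (real n - real i)) * (wt s b n * y i) \<le> 2 powr (- e * \<bar>real n - real i\<bar>) * (C1 * v i)"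
            by (simp add: mult_ac)
        qed
        finally show ?thesis .
      qed
    qed (use A R C1 C2 v0 wt_omega_nonneg in auto)
    then have "lq_le q (\<lambda>n. wt s b n * omega j f n) (C3 * (C1 * (C2 * A)) * R)" by (simp add: mult_ac)
    then have "lq_le q (\<lambda>n. wt s b n * omega j f n) (K * R)"
      by (rule lq_le_mono_bound[OF q, rotated -1]) (use A C1 C2 C3 K R in \<open>auto intro!: mult_right_mono\<close>)
    moreover have "Lp_norm M p f \<le> ennreal (K * R)"
      using f'(2) K R by (elim order_trans) (simp add: ennreal_leI)
    ultimately show "besov_le q s b j f (K * R)" using f' by (simp add: besov_le_def)
  qed
qed

lemma besov_bounded_refl: "besov_bounded q s b k q s b k"
  by (rule besov_boundedI[of 1]) auto

lemma besov_bounded_order: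
  assumes q: "0 < q" and s: "s < real k" "s < real k'"
  shows "besov_bounded q s b k q s b k'"
proof (cases "k \<le> k'")
  case True
  then show ?thesis
    by (induction k' rule: dec_induct)
      (auto intro: besov_bounded_refl besov_bounded_trans besov_bounded_order_Suc[OF q])
next
  case False
  then have "k' \<le> k" by simp
  then show ?thesis
  proof (induction k rule: dec_induct)
    case (step n)
    then have "besov_bounded q s b (Suc n) q s b n"
      using s by (intro besov_bounded_order_pred q) auto
    then show ?case using step besov_bounded_trans by blast
  qed (rule besov_bounded_refl)
qed

lemma besov_bounded_order_iff:
  assumes "0 < q0" "0 < q1" "s0 < real k0" "s1 < real k1" "s0 < real k" "s1 < real k"
  shows "besov_bounded q0 s0 b0 k0 q1 s1 b1 k1 \<longleftrightarrow> besov_bounded q0 s0 b0 k q1 s1 b1 k"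
proof
  assume "besov_bounded q0 s0 b0 k0 q1 s1 b1 k1"
  then show "besov_bounded q0 s0 b0 k q1 s1 b1 k"
    by (rule besov_bounded_trans[OF besov_bounded_order[OF assms(1,5,3)]
          besov_bounded_trans[OF _ besov_bounded_order[OF assms(2,4,6)]]])
next
  assume "besov_bounded q0 s0 b0 k q1 s1 b1 k"
  then show "besov_bounded q0 s0 b0 k0 q1 s1 b1 k1"
    by (rule besov_bounded_trans[OF besov_bounded_order[OF assms(1,3,5)]
          besov_bounded_trans[OF _ besov_bounded_order[OF assms(2,6,4)]]])
qed

lemma besov_bounded_if_seq_embeds:
  assumes q: "0 < q0" "0 < q1" and "seq_embeds s0 b0 q0 s1 b1 q1"
  shows "besov_bounded q0 s0 b0 k q1 s1 b1 k"
proof -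
  obtain C where C: "0 < C" "\<And>x R. decseq x \<Longrightarrow> (\<And>n. 0 \<le> x n) \<Longrightarrow> x 0 \<le> R \<Longrightarrow>
     lq_le q0 (\<lambda>n. wt s0 b0 n * x n) R \<Longrightarrow> lq_le q1 (\<lambda>n. wt s1 b1 n * x n) (C * R)"
    using assms(3) unfolding seq_embeds_def by blast
  define K where "K = 1 + C * 2 ^ k"
  have K: "1 \<le> K" "C * 2 ^ k \<le> K" using C by (auto simp: K_def)
  show ?thesis
  proof (rule besov_boundedI)
    show "0 < K" using K by simp
    fix f and R :: real assume R: "0 < R" and f: "besov_le q0 s0 b0 k f R"
    have f': "f \<in> X" "Lp_norm M p f \<le> ennreal R" "lq_le q0 (\<lambda>n. wt s0 b0 n * omega k f n) R"
      using f by (auto simp: besov_le_def)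
    \<comment> \<open>\<open>seq_embeds\<close> uses one bound for the first term and for the
      quasi-norm; the first term is only known to be at most 2^k R.\<close>
    have "1 * R \<le> 2 ^ k * R" using R by (intro mult_right_mono) auto
    then have "lq_le q0 (\<lambda>n. wt s0 b0 n * omega k f n) (2 ^ k * R)"
      using R by (intro lq_le_mono_bound[OF q(1) _ _ f'(3)]) auto
    then have "lq_le q1 (\<lambda>n. wt s1 b1 n * omega k f n) (C * (2 ^ k * R))"
      using R by (intro C(2) decseq_omega[OF f'(1,2)] omega_nonneg omega_le f') auto
    then have "lq_le q1 (\<lambda>n. wt s1 b1 n * omega k f n) (C * 2 ^ k * R)" by (simp add: mult.assoc)
    then have "lq_le q1 (\<lambda>n. wt s1 b1 n * omega k f n) (K * R)"
      by (rule lq_le_mono_bound[OF q(2), rotated -1]) (use C K R in \<open>auto intro!: mult_right_mono\<close>)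
    moreover have "Lp_norm M p f \<le> ennreal (K * R)"
      using f'(2) K R by (elim order_trans) (simp add: ennreal_leI)
    ultimately show "besov_le q1 s1 b1 k f (K * R)" using f' by (simp add: besov_le_def)
  qed
qed

end

section \<open>Test sums\<close>

text \<open>The q-th power of the ell_q norm of (1 + n)^(-1/q) for n <= N, for every finite q: the
  borderline sequence of ell_q.\<close>

definition harm_sum :: "nat \<Rightarrow> real" where
  "harm_sum N = (\<Sum>n<Suc N. 1 / (1 + real n))"

lemma harm_sum_ge_1: "1 \<le> harm_sum N"
proof -
  have "(\<Sum>n<Suc 0. 1 / (1 + real n)) \<le> (\<Sum>n<Suc N. 1 / (1 + real n))" by (intro sum_mono2) auto
  then show ?thesis by (simp add: harm_sum_def)
qed

lemma harm_sum_unbounded: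
  obtains N0 where "\<And>N. N0 \<le> N \<Longrightarrow> C < harm_sum N"
proof -
  have "\<exists>N. C < harm_sum N"
  proof (rule ccontr)
    assume "\<nexists>N. C < harm_sum N"
    then have *: "(\<Sum>n<Suc N. 1 / (1 + real n)) \<le> C" for N by (auto simp: harm_sum_def not_less)
    have "(\<Sum>n<N. 1 / (1 + real n)) \<le> C" for N
    proof -
      have "(\<Sum>n<N. 1 / (1 + real n)) \<le> (\<Sum>n<Suc N. 1 / (1 + real n))" by simp
      with * show ?thesis by (rule order_trans[rotated])
    qed
    then have "summable (\<lambda>n. 1 / (1 + real n))" by (intro summableI_nonneg_bounded) auto
    moreover have "(\<lambda>n. 1 / (1 + real n)) = (\<lambda>n. real (Suc n) powr (-1))" by (auto simp: powr_minus_divide)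
    ultimately have "summable (\<lambda>n. real (Suc n) powr (-1))" by (simp only:)
    then have "summable (\<lambda>n. real n powr (-1))" by (rule summable_Suc_iff[THEN iffD1])
    then show False by (simp only: summable_real_powr_iff)
  qed
  then obtain N0 where N0: "C < harm_sum N0" by blast
  have "C < harm_sum N" if "N0 \<le> N" for N
  proof -
    have "harm_sum N0 \<le> harm_sum N" unfolding harm_sum_def using that by (intro sum_mono2) auto
    with N0 show ?thesis by simp
  qed
  then show ?thesis by (rule that)
qed

lemma recip_strict_antimono:
  assumes "0 < q1" "q1 < q0"
  shows "recip q0 < recip q1"
proof -
  obtain r1 where r1: "0 < r1" "q1 = ennreal r1"
    using assms by (cases q1) auto
  show ?thesis
    using order.strict_trans[OF assms]
  proof (cases q0 rule: exponent_cases)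
    case (real r0)
    then show ?thesis using assms r1 by (simp add: recip_ennreal ennreal_less_iff frac_less2)
  qed (use r1 in \<open>simp add: recip_ennreal\<close>)
qed

lemma powr_unbounded:
  assumes "0 < d" "\<And>N::nat. (1 + real N) powr d \<le> C"
  shows False
proof -
  have C: "0 < C" using assms(2)[of 0] by simp
  obtain N :: nat where "C powr (1 / d) < real N" using reals_Archimedean2 by blast
  then have "(C powr (1 / d)) powr d < (1 + real N) powr d" using assms by (intro powr_less_mono2) auto
  then show False using assms C by (simp add: powr_powr not_le[symmetric])
qed

text \<open>Since 1/q1 > 1/q0 and the harmonic sums diverge, the higher power wins. Arbitrarily
  large N suffice, which matters because the lacunary test family exists only for N a power of
  2.\<close>

lemma harm_sum_powr_contradiction:
  assumes "0 < q1" "q1 < q0" "\<And>M. \<exists>N\<ge>M. harm_sum N powr recip q1 \<le> C * harm_sum N powr recip q0"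
  shows False
proof -
  define d where "d = recip q1 - recip q0"
  have d: "0 < d" using recip_strict_antimono[OF assms(1,2)] by (simp add: d_def)
  obtain N0 where N0: "\<And>N. N0 \<le> N \<Longrightarrow> \<bar>C\<bar> powr (1 / d) < harm_sum N"
    by (rule harm_sum_unbounded[of "\<bar>C\<bar> powr (1 / d)"]) blast
  obtain N where N: "N0 \<le> N" "harm_sum N powr recip q1 \<le> C * harm_sum N powr recip q0" using assms(3) by blast
  have H: "0 < harm_sum N" using harm_sum_ge_1[of N] by simp
  have "harm_sum N powr d \<le> C" using N(2) H by (simp add: d_def powr_diff field_simps)
  moreover have "(\<bar>C\<bar> powr (1 / d)) powr d < harm_sum N powr d"
    using d N0[OF N(1)] by (intro powr_less_mono2) auto
  ultimately show False using d by (simp add: powr_powr)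
qed

lemma powr_neg_inverse_powr: "0 < r \<Longrightarrow> ((1 + real j) powr (- (1 / r))) powr r = 1 / (1 + real j)"
  unfolding powr_powr by (simp add: powr_minus_divide)

lemma lq_le_harmonic:
  assumes "0 < q"
  shows "lq_le q (\<lambda>j. if j \<le> N then (1 + real j) powr (- recip q) else 0) (harm_sum N powr recip q)"
  using assms
proof (cases q rule: exponent_cases)
  case top
  \<comment> \<open>For q infinite the bound reads x^0, and \<open>powr\<close> gives 1 there only
    for nonzero x.\<close>
  have "harm_sum N \<noteq> 0" using harm_sum_ge_1[of N] by simp
  then show ?thesis using top by (auto simp: lq_le_top)
next
  case (real r)
  have "(\<Sum>j<K. (if j \<le> N then (1 + real j) powr (- (1 / r)) else 0) powr r) \<le> (harm_sum N powr (1 / r)) powr r" for K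
  proof -
    have "(\<Sum>j<K. (if j \<le> N then (1 + real j) powr (- (1 / r)) else 0) powr r) = (\<Sum>j<K. if j \<in> {..<Suc N} then 1 / (1 + real j) else 0)"
      using real by (intro sum.cong) (auto simp: powr_neg_inverse_powr)
    also have "\<dots> = (\<Sum>j\<in>{..<K} \<inter> {..<Suc N}. 1 / (1 + real j))" by (simp add: sum.inter_restrict)
    also have "\<dots> \<le> harm_sum N" unfolding harm_sum_def by (intro sum_mono2) auto
    also have "\<dots> = (harm_sum N powr (1 / r)) powr r" using real harm_sum_ge_1[of N] by (simp add: powr_powr)
    finally show ?thesis .
  qed
  then show ?thesis unfolding real(2) recip_ennreal[OF real(1)] lq_le_real[OF real(1)] by blast
qed

lemma harm_sum_le_if_lq_le:
  assumes "0 < r" "0 < c" "0 \<le> B" "lq_le (ennreal r) z B"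
    "\<And>n. n \<le> N \<Longrightarrow> c * (1 + real n) powr (- recip (ennreal r)) \<le> z n"
  shows "c * harm_sum N powr recip (ennreal r) \<le> B"
proof -
  have "c powr r * harm_sum N = (\<Sum>n<Suc N. (c * (1 + real n) powr (- (1 / r))) powr r)"
    unfolding harm_sum_def sum_distrib_left using assms
    by (intro sum.cong refl) (simp add: powr_mult powr_neg_inverse_powr)
  also have "\<dots> \<le> (\<Sum>n<Suc N. z n powr r)"
    using assms by (intro sum_mono powr_mono2) (auto simp: recip_ennreal)
  also have "\<dots> \<le> B powr r" using assms lq_le_real by blast
  finally have "(c powr r * harm_sum N) powr (1 / r) \<le> (B powr r) powr (1 / r)"
    using assms harm_sum_ge_1[of N] by (intro powr_mono2) auto
  then show ?thesis using assms harm_sum_ge_1[of N] by (simp add: powr_mult powr_powr recip_ennreal)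
qed

text \<open>This is min 1 (2^(j - n)) ^ k, the effect of a k-th difference with step at most 2^(-n)
  on a bump at scale 2^(-j), written as one power of 2.\<close>

definition decay :: "nat \<Rightarrow> nat \<Rightarrow> nat \<Rightarrow> real" where
  "decay k n j = 2 powr (- real k * max 0 (real n - real j))"

lemma decay_le_1: "decay k n j \<le> 1"
proof -
  have "(2::real) powr (- real k * max 0 (real n - real j)) \<le> 2 powr 0"
    by (intro powr_mono) auto
  then show ?thesis by (simp add: decay_def)
qed

lemma decay_nonneg: "0 \<le> decay k n j"
  by (simp add: decay_def)

lemma decay_0 [simp]: "decay k 0 j = 1"
  by (simp add: decay_def)

lemma lq_le_single:
  assumes "0 < q" "0 \<le> v"
  shows "lq_le q (\<lambda>j. if j = N then v else 0) v"
  using assms(1)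
proof (cases q rule: exponent_cases)
  case top
  then show ?thesis using assms by (auto simp: lq_le_top)
next
  case (real r)
  have "(\<Sum>j<K. (if j = N then v else 0) powr r) \<le> v powr r" for K
  proof -
    have "(\<Sum>j<K. (if j = N then v else 0) powr r) = (\<Sum>j<K. if j = N then v powr r else 0)"
      using real by (intro sum.cong) auto
    then show ?thesis by simp
  qed
  then show ?thesis using real lq_le_real by blast
qed

section \<open>Quasi-norm bounds for test sums\<close>

context shift_invariant_Lp begin

text \<open>All that the necessity part retains of a sum of bumps: two upper bounds from the
  triangle inequality and the lower bound on the modulus. The counterexamples then choose only
  coefficients.\<close>

definition test_sum :: "real \<Rightarrow> nat \<Rightarrow> (nat \<Rightarrow> real) \<Rightarrow> nat \<Rightarrow> ('a \<Rightarrow> complex) \<Rightarrow> bool" where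
  "test_sum C k a N f \<longleftrightarrow> f \<in> X \<and> Lp_norm M p f \<le> ennreal (C * (\<Sum>j<Suc N. a j)) \<and>
     (\<forall>n. omega k f n \<le> C * (\<Sum>j<Suc N. decay k n j * a j)) \<and> (\<forall>n\<le>N. a n \<le> omega k f n)"

text \<open>Reduces the quasi-norm of a test sum to a pointwise comparison with a convolution, to
  which the discrete Hardy inequality applies.\<close>

lemma besov_le_test_sum:
  assumes "0 < e" "0 < q" "0 < K" "0 < C"
  obtains D where "0 < D"
    "\<And>a N y B f. (\<And>j. 0 \<le> a j) \<Longrightarrow> (\<And>j. 0 \<le> y j) \<Longrightarrow> 0 \<le> B \<Longrightarrow> test_sum C k a N f \<Longrightarrow>
       (\<And>n. wt s b n * (\<Sum>j<Suc N. decay k n j * a j) \<le> K * (\<Sum>j<Suc N. 2 powr (- e * \<bar>real n - real j\<bar>) * y j)) \<Longrightarrow>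
       lq_le q y B \<Longrightarrow> besov_le q s b k f (D * B)"
proof -
  obtain C3 where C3: "0 < C3"
    "\<And>y z J B. (\<And>n. 0 \<le> y n) \<Longrightarrow> (\<And>n. 0 \<le> z n) \<Longrightarrow> 0 \<le> B \<Longrightarrow>
       (\<And>n. z n \<le> (\<Sum>j<J n. 2 powr (- e * \<bar>real n - real j\<bar>) * y j)) \<Longrightarrow>
       lq_le q y B \<Longrightarrow> lq_le q z (C3 * B)"
    by (rule lq_le_convolution[OF assms(1,2)]) blast
  define D where "D = C3 * (C * K)"
  have D: "0 < D" using C3 assms by (simp add: D_def)
  have "besov_le q s b k f (D * B)"
    if a: "\<And>j. 0 \<le> a j" and y: "\<And>j. 0 \<le> y j" and B: "0 \<le> B" and T: "test_sum C k a N f" and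
      le: "\<And>n. wt s b n * (\<Sum>j<Suc N. decay k n j * a j) \<le> K * (\<Sum>j<Suc N. 2 powr (- e * \<bar>real n - real j\<bar>) * y j)" and
      ly: "lq_le q y B" for a N y B f
  proof -
    have T': "f \<in> X" "Lp_norm M p f \<le> ennreal (C * (\<Sum>j<Suc N. a j))"
      "\<And>n. omega k f n \<le> C * (\<Sum>j<Suc N. decay k n j * a j)"
      using T by (auto simp: test_sum_def)
    define z where "z n = wt s b n * (C * (\<Sum>j<Suc N. decay k n j * a j))" for n
    have z0: "0 \<le> z n" for n
      unfolding z_def using a assms by (intro mult_nonneg_nonneg wt_nonneg sum_nonneg decay_nonneg) auto
    have "lq_le q (\<lambda>j. (C * K) * y j) ((C * K) * B)" using assms B y ly by (intro lq_le_scale) auto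
    then have lz: "lq_le q z (C3 * ((C * K) * B))"
    proof (rule C3(2)[rotated -1])
      show "z n \<le> (\<Sum>j<Suc N. 2 powr (- e * \<bar>real n - real j\<bar>) * ((C * K) * y j))" for n
      proof -
        have "z n = C * (wt s b n * (\<Sum>j<Suc N. decay k n j * a j))" by (simp only: z_def mult_ac)
        also have "\<dots> \<le> C * (K * (\<Sum>j<Suc N. 2 powr (- e * \<bar>real n - real j\<bar>) * y j))"
          using assms by (intro mult_left_mono le) auto
        also have "\<dots> = (\<Sum>j<Suc N. 2 powr (- e * \<bar>real n - real j\<bar>) * ((C * K) * y j))"
          unfolding sum_distrib_left by (intro sum.cong refl) (simp add: mult_ac)
        finally show ?thesis .
      qed
    qed (use y z0 B assms in auto)
    then have lz: "lq_le q z (D * B)" by (simp only: D_def mult.assoc)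
    have "lq_le q (\<lambda>n. wt s b n * omega k f n) (D * B)"
    proof (rule lq_le_mono[OF assms(2) wt_omega_nonneg _ lz])
      show "wt s b n * omega k f n \<le> z n" for n
        unfolding z_def by (intro mult_left_mono T' wt_nonneg)
    qed
    \<comment> \<open>At n = 0 both \<open>decay\<close> and \<open>wt\<close> equal 1, so this term
      is the Lp bound of the test sum; no separate estimate is needed.\<close>
    moreover have "z 0 \<le> D * B"
      using D B by (intro lq_le_term[OF assms(2) z0 _ lz]) auto
    then have "C * (\<Sum>j<Suc N. a j) \<le> D * B" by (simp add: z_def)
    then have "Lp_norm M p f \<le> ennreal (D * B)" using T'(2) by (elim order_trans) (rule ennreal_leI)
    ultimately show ?thesis using T' by (simp add: besov_le_def)
  qed
  then show ?thesis by (rule that[OF D])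
qed

text \<open>Off the diagonal both directions decay: for j > n because s > 0 makes the weight at j
  larger, for j < n because the order k of the difference exceeds s.\<close>

lemma besov_le_test_sum_pos:
  assumes "0 < s" "s < real k" "0 < q" "0 < C"
  obtains D where "0 < D"
    "\<And>a N B f. (\<And>j. 0 \<le> a j) \<Longrightarrow> 0 \<le> B \<Longrightarrow> test_sum C k a N f \<Longrightarrow>
       lq_le q (\<lambda>j. if j \<le> N then wt s b j * a j else 0) B \<Longrightarrow> besov_le q s b k f (D * B)"
proof -
  \<comment> \<open>Twice \<open>e\<close> fits into both gaps s and k - s; one \<open>e\<close> is
    spent on the ratio of the weights.\<close>
  define e where "e = min s (real k - s) / 2"
  have e: "0 < e" "2 * e \<le> s" "2 * e \<le> real k - s" using assms by (auto simp: e_def)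
  obtain K where K: "0 < K"
    "\<And>n j. wt s b n \<le> K * 2 powr (s * (real n - real j) + e * \<bar>real n - real j\<bar>) * wt s b j"
    using wt_ratio[OF e(1)] by metis
  obtain D where D: "0 < D"
    "\<And>a N y B f. (\<And>j. 0 \<le> a j) \<Longrightarrow> (\<And>j. 0 \<le> y j) \<Longrightarrow> 0 \<le> B \<Longrightarrow> test_sum C k a N f \<Longrightarrow>
       (\<And>n. wt s b n * (\<Sum>j<Suc N. decay k n j * a j) \<le> K * (\<Sum>j<Suc N. 2 powr (- e * \<bar>real n - real j\<bar>) * y j)) \<Longrightarrow>
       lq_le q y B \<Longrightarrow> besov_le q s b k f (D * B)"
    by (rule besov_le_test_sum[OF e(1) assms(3) K(1) assms(4)]) blast
  show ?thesis
  proof (rule that[OF D(1)])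
    fix a :: "nat \<Rightarrow> real" and N B f
    assume a: "\<And>j. 0 \<le> a j" and B: "0 \<le> B" "test_sum C k a N f"
      and l: "lq_le q (\<lambda>j. if j \<le> N then wt s b j * a j else 0) B"
    show "besov_le q s b k f (D * B)"
    proof (rule D(2)[OF a _ B _ l])
      show "0 \<le> (if j \<le> N then wt s b j * a j else 0)" for j using a wt_nonneg by simp
      fix n
      have "wt s b n * (\<Sum>j<Suc N. decay k n j * a j) = (\<Sum>j<Suc N. decay k n j * (wt s b n * a j))"
        unfolding sum_distrib_left by (intro sum.cong refl) (simp add: mult_ac)
      also have "\<dots> \<le> (\<Sum>j<Suc N. K * (2 powr (- e * \<bar>real n - real j\<bar>) * (wt s b j * a j)))"
      proof (rule sum_mono)
        fix j
        have "decay k n j * (wt s b n * a j) \<le> decay k n j * (K * 2 powr (s * (real n - real j) + e * \<bar>real n - real j\<bar>) * wt s b j * a j)"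
          by (intro mult_left_mono mult_right_mono K a decay_nonneg)
        also have "\<dots> = K * (decay k n j * 2 powr (s * (real n - real j) + e * \<bar>real n - real j\<bar>)) * (wt s b j * a j)"
          by (simp add: mult_ac)
        also have "\<dots> \<le> K * 2 powr (- e * \<bar>real n - real j\<bar>) * (wt s b j * a j)"
        proof (intro mult_right_mono mult_left_mono)
          have "- real k * max 0 (real n - real j) + (s * (real n - real j) + e * \<bar>real n - real j\<bar>) \<le> - e * \<bar>real n - real j\<bar>"
          proof (cases "j \<le> n")
            case True
            then have "(2 * e) * (real n - real j) \<le> (real k - s) * (real n - real j)" by (intro mult_right_mono e) auto
            then show ?thesis using True by (simp add: max_def algebra_simps)
          next
            case False
            then have "(2 * e) * (real j - real n) \<le> s * (real j - real n)" by (intro mult_right_mono e) auto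
            then show ?thesis using False by (simp add: max_def algebra_simps)
          qed
          then show "decay k n j * 2 powr (s * (real n - real j) + e * \<bar>real n - real j\<bar>) \<le> 2 powr (- e * \<bar>real n - real j\<bar>)"
            unfolding decay_def powr_add[symmetric] by (intro powr_mono) auto
        qed (use K a wt_nonneg in auto)
        finally show "decay k n j * (wt s b n * a j) \<le> K * (2 powr (- e * \<bar>real n - real j\<bar>) * (wt s b j * a j))"
          by (simp add: mult.assoc)
      qed
      also have "\<dots> = K * (\<Sum>j<Suc N. 2 powr (- e * \<bar>real n - real j\<bar>) * (if j \<le> N then wt s b j * a j else 0))"
        unfolding sum_distrib_left by (intro sum.cong refl) auto
      finally show "wt s b n * (\<Sum>j<Suc N. decay k n j * a j) \<le> K * (\<Sum>j<Suc N. 2 powr (- e * \<bar>real n - real j\<bar>) * (if j \<le> N then wt s b j * a j else 0))" .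
    qed
  qed
qed

text \<open>Without smoothness nothing damps the levels j > n, so the decay of the tails of the
  coefficients is an explicit hypothesis. The levels j < n are still damped by the
  difference.\<close>

lemma besov_le_test_sum_zero:
  assumes "0 < k" "0 < q" "0 < C" "0 < L"
  obtains D where "0 < D"
    "\<And>a N f. (\<And>j. 0 \<le> a j) \<Longrightarrow> test_sum C k a N f \<Longrightarrow>
       (\<And>j. a j \<le> (1 + real j) powr (- (b + recip q))) \<Longrightarrow>
       (\<And>n. n \<le> N \<Longrightarrow> (\<Sum>j\<in>{n..N}. a j) \<le> L * (1 + real n) powr (- (b + recip q))) \<Longrightarrow>
       besov_le q 0 b k f (D * harm_sum N powr recip q)"
proof -
  \<comment> \<open>The differences decay at least at rate 1 because k >= 1; half of it pays for the
    ratio of the weights.\<close>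
  define e :: real where "e = 1 / 2"
  have e: "0 < e" by (simp add: e_def)
  obtain K1 where K1: "0 < K1"
    "\<And>n j. wt 0 b n \<le> K1 * 2 powr (0 * (real n - real j) + e * \<bar>real n - real j\<bar>) * wt 0 b j"
    using wt_ratio[OF e] by metis
  define K where "K = L + K1"
  have K: "0 < K" using K1 assms by (simp add: K_def)
  obtain D where D: "0 < D"
    "\<And>a N y B f. (\<And>j. 0 \<le> a j) \<Longrightarrow> (\<And>j. 0 \<le> y j) \<Longrightarrow> 0 \<le> B \<Longrightarrow> test_sum C k a N f \<Longrightarrow>
       (\<And>n. wt 0 b n * (\<Sum>j<Suc N. decay k n j * a j) \<le> K * (\<Sum>j<Suc N. 2 powr (- e * \<bar>real n - real j\<bar>) * y j)) \<Longrightarrow>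
       lq_le q y B \<Longrightarrow> besov_le q 0 b k f (D * B)"
    by (rule besov_le_test_sum[OF e assms(2) K assms(3)]) blast
  show ?thesis
  proof (rule that[OF D(1)])
    fix a :: "nat \<Rightarrow> real" and N f
    assume a: "\<And>j. 0 \<le> a j" and T: "test_sum C k a N f"
      and a_le: "\<And>j. a j \<le> (1 + real j) powr (- (b + recip q))"
      and tail: "\<And>n. n \<le> N \<Longrightarrow> (\<Sum>j\<in>{n..N}. a j) \<le> L * (1 + real n) powr (- (b + recip q))"
    define y where "y j = (if j \<le> N then (1 + real j) powr (- recip q) else 0)" for j
    have y0: "0 \<le> y j" for j by (simp add: y_def)
    have wy: "wt 0 b j * (1 + real j) powr (- (b + recip q)) = (1 + real j) powr (- recip q)" for j
      unfolding wt_def by (simp flip: powr_add)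
    show "besov_le q 0 b k f (D * harm_sum N powr recip q)"
    proof (rule D(2)[OF a y0 _ T])
      \<comment> \<open>The comparison sequence is the borderline one: the weight turns (1 + j)^(-(b
        + 1/q)) into (1 + j)^(-1/q).\<close>
      show "lq_le q y (harm_sum N powr recip q)"
        unfolding y_def by (rule lq_le_harmonic[OF assms(2)])
      fix n
      let ?S = "\<Sum>j<Suc N. 2 powr (- e * \<bar>real n - real j\<bar>) * y j"
      have dec: "decay k n j * a j \<le> (if n \<le> j then a j else 0) + 2 powr (- \<bar>real n - real j\<bar>) * a j" for j
      proof (cases "n \<le> j")
        case True
        have "decay k n j * a j \<le> 1 * a j" by (intro mult_right_mono decay_le_1 a)
        moreover have "0 \<le> 2 powr (- \<bar>real n - real j\<bar>) * a j" using a by simp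
        ultimately show ?thesis using True by auto
      next
        case False
        then have "1 * (real n - real j) \<le> real k * (real n - real j)" using assms by (intro mult_right_mono) auto
        moreover have "max 0 (real n - real j) = real n - real j" "\<bar>real n - real j\<bar> = real n - real j"
          using False by auto
        ultimately have "- real k * max 0 (real n - real j) \<le> - \<bar>real n - real j\<bar>"
          by (simp only: mult_minus_left neg_le_iff_le mult_1)
        then have "decay k n j \<le> 2 powr (- \<bar>real n - real j\<bar>)"
          unfolding decay_def by (rule powr_mono) simp
        then show ?thesis using False a[of j] by (simp add: mult_right_mono)
      qed
      have "wt 0 b n * (\<Sum>j<Suc N. decay k n j * a j) \<le>
          wt 0 b n * (\<Sum>j<Suc N. (if n \<le> j then a j else 0) + 2 powr (- \<bar>real n - real j\<bar>) * a j)"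
        by (intro mult_left_mono sum_mono dec wt_nonneg)
      also have "\<dots> = wt 0 b n * (\<Sum>j<Suc N. if n \<le> j then a j else 0) + (\<Sum>j<Suc N. 2 powr (- \<bar>real n - real j\<bar>) * (wt 0 b n * a j))"
        unfolding sum.distrib distrib_left sum_distrib_left by (simp add: mult_ac)
      also have "\<dots> \<le> L * ?S + K1 * ?S"
      proof (rule add_mono)
        have "(\<Sum>j<Suc N. if n \<le> j then a j else 0) = (\<Sum>j\<in>{n..N}. a j)"
          by (rule sum.mono_neutral_cong_right) auto
        moreover have "wt 0 b n * (\<Sum>j\<in>{n..N}. a j) \<le> L * ?S"
        proof (cases "n \<le> N")
          case True
          have "wt 0 b n * (\<Sum>j\<in>{n..N}. a j) \<le> wt 0 b n * (L * (1 + real n) powr (- (b + recip q)))"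
            by (intro mult_left_mono tail True wt_nonneg)
          also have "\<dots> = L * y n" using True wy[of n] by (simp add: y_def)
          also have "y n = 2 powr (- e * \<bar>real n - real n\<bar>) * y n" by simp
          also have "\<dots> \<le> ?S" using True y0 by (intro member_le_sum) auto
          finally show ?thesis using assms by simp
        next
          case False
          have "0 \<le> L * ?S" using assms y0 by (intro mult_nonneg_nonneg sum_nonneg) auto
          then show ?thesis using False by simp
        qed
        ultimately show "wt 0 b n * (\<Sum>j<Suc N. if n \<le> j then a j else 0) \<le> L * ?S" by simp
        show "(\<Sum>j<Suc N. 2 powr (- \<bar>real n - real j\<bar>) * (wt 0 b n * a j)) \<le> K1 * ?S"
          unfolding sum_distrib_left
        proof (rule sum_mono)
          fix j assume j: "j \<in> {..<Suc N}"
          have "wt 0 b n * a j \<le> (K1 * 2 powr (0 * (real n - real j) + e * \<bar>real n - real j\<bar>) * wt 0 b j) * (1 + real j) powr (- (b + recip q))"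
            using K1 wt_nonneg by (intro mult_mono a a_le K1(2)) auto
          also have "\<dots> = K1 * 2 powr (e * \<bar>real n - real j\<bar>) * (wt 0 b j * (1 + real j) powr (- (b + recip q)))" by simp
          also have "\<dots> = K1 * 2 powr (e * \<bar>real n - real j\<bar>) * y j" using j wy[of j] by (simp add: y_def)
          finally have "2 powr (- \<bar>real n - real j\<bar>) * (wt 0 b n * a j) \<le> 2 powr (- \<bar>real n - real j\<bar>) * (K1 * 2 powr (e * \<bar>real n - real j\<bar>) * y j)"
            by (intro mult_left_mono) auto
          also have "\<dots> = K1 * ((2 powr (- \<bar>real n - real j\<bar>) * 2 powr (e * \<bar>real n - real j\<bar>)) * y j)" by (simp add: mult_ac)
          also have "2 powr (- \<bar>real n - real j\<bar>) * 2 powr (e * \<bar>real n - real j\<bar>) = 2 powr (- e * \<bar>real n - real j\<bar>)"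
            unfolding powr_add[symmetric] e_def by simp
          finally show "2 powr (- \<bar>real n - real j\<bar>) * (wt 0 b n * a j) \<le> K1 * (2 powr (- e * \<bar>real n - real j\<bar>) * y j)" .
        qed
      qed
      also have "\<dots> = K * ?S" by (simp only: K_def distrib_right)
      finally show "wt 0 b n * (\<Sum>j<Suc N. decay k n j * a j) \<le> K * ?S" .
    qed auto
  qed
qed

lemma test_sum_lower:
  assumes "test_sum C k a N f" "n \<le> N"
  shows "a N \<le> omega k f n"
proof -
  have "a N \<le> omega k f N" using assms by (simp add: test_sum_def)
  also have "\<dots> \<le> omega k f n" using assms decseqD[OF decseq_omega] by (auto simp: test_sum_def)
  finally show ?thesis .
qed

end

text \<open>On powers of 2 the sequence (1 + j)^(-c) is bounded by a geometric one, so a tail is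
  comparable to its first term.\<close>

lemma lacunary_tail:
  assumes c: "0 < c"
  obtains L where "0 < L"
    "\<And>n M. (\<Sum>j\<in>{n..2 ^ M}. if \<exists>m. j = 2 ^ m then (1 + real j) powr (- c) else 0) \<le> L * (1 + real n) powr (- c)"
proof -
  define t :: real where "t = 2 powr (- c)"
  have t: "0 < t" "t < 1" using c by (auto simp: t_def powr_less_one)
  have tp: "(2 ^ m) powr (- c) = t ^ m" for m
    by (simp add: t_def powr_powr powr_power mult.commute flip: powr_realpow)
  define L where "L = 2 powr c / (1 - t)"
  have "(\<Sum>j\<in>{n..2 ^ M}. if \<exists>m. j = 2 ^ m then (1 + real j) powr (- c) else 0) \<le> L * (1 + real n) powr (- c)" for n M :: nat
  proof -
    define I where "I = {m. n \<le> 2 ^ m \<and> (2::nat) ^ m \<le> 2 ^ M}"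
    have fin: "finite I" by (rule finite_subset[of _ "{..M}"]) (auto simp: I_def)
    have inj: "inj_on (\<lambda>m. (2::nat) ^ m) I" by (auto simp: inj_on_def)
    have "(\<Sum>j\<in>{n..2 ^ M}. if \<exists>m. j = 2 ^ m then (1 + real j) powr (- c) else 0) =
        (\<Sum>j\<in>(\<lambda>m. 2 ^ m) ` I. (1 + real j) powr (- c))"
      by (rule sum.mono_neutral_cong_right) (auto simp: I_def image_iff)
    also have "\<dots> = (\<Sum>m\<in>I. (1 + real (2 ^ m)) powr (- c))"
      by (simp add: sum.reindex[OF inj])
    also have "\<dots> \<le> (\<Sum>m\<in>I. t ^ m)"
    proof (rule sum_mono)
      fix m
      have "(1 + real (2 ^ m)) powr (- c) \<le> (2 ^ m) powr (- c)" using c by (intro powr_mono2') auto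
      then show "(1 + real (2 ^ m)) powr (- c) \<le> t ^ m" by (simp only: tp)
    qed
    also have "\<dots> \<le> L * (1 + real n) powr (- c)"
    proof (cases "I = {}")
      case True
      then show ?thesis using t by (simp add: L_def)
    next
      case False
      define i where "i = Min I"
      have i: "i \<in> I" "\<And>m. m \<in> I \<Longrightarrow> i \<le> m" using False fin by (auto simp: i_def)
      obtain K where K: "I \<subseteq> {..<K}" using fin finite_nat_bounded by blast
      have "(\<Sum>m\<in>I. t ^ m) \<le> (\<Sum>m\<in>{i..<i + K}. t ^ m)"
        using K i t by (intro sum_mono2) (auto intro: trans_less_add2)
      also have "\<dots> = t ^ i * (\<Sum>m<K. t ^ m)"
        using sum.shift_bounds_nat_ivl[of "\<lambda>m. t ^ m" 0 i K] by (simp add: sum_distrib_left power_add mult.commute add.commute atLeast0LessThan)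
      also have "\<dots> \<le> t ^ i * (1 / (1 - t))"
        using t sum_le_suminf[of "\<lambda>j. t ^ j" "{..<K}"] by (intro mult_left_mono) (auto simp: suminf_geometric)
      also have "\<dots> \<le> L * (1 + real n) powr (- c)"
      proof -
        \<comment> \<open>The first power of 2 in the tail is at least n and at least 1, hence at
          least (1 + n) / 2; the second bound covers n = 0.\<close>
        have "real n \<le> 2 ^ i" using i(1) unfolding I_def by (simp add: numeral_power_le_of_nat_cancel_iff of_nat_le_numeral_power_cancel_iff)
        moreover have "(1::real) \<le> 2 ^ i" by simp
        moreover have "(1 + real n) / 2 \<le> x" if "real n \<le> x" "1 \<le> x" for x using that by simp
        ultimately have "(1 + real n) / 2 \<le> 2 ^ i" by blast
        then have "(2 ^ i) powr (- c) \<le> ((1 + real n) / 2) powr (- c)" using c by (intro powr_mono2') auto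
        also have "\<dots> = 2 powr c * (1 + real n) powr (- c)" by (simp add: powr_divide powr_minus field_simps)
        finally show ?thesis using t by (simp add: tp L_def divide_right_mono)
      qed
      finally show ?thesis .
    qed
    finally show ?thesis .
  qed
  moreover have "0 < L" using t by (simp add: L_def)
  ultimately show ?thesis using that by blast
qed

lemma diff1_eq_0:
  fixes f :: "'a::real_normed_vector \<Rightarrow> complex"
  assumes "\<And>i. i \<le> k \<Longrightarrow> f (x + real i *\<^sub>R h) = 0"
  shows "(diff1 h ^^ k) f x = 0"
  using assms
proof (induction k arbitrary: x)
  case (Suc k)
  have "(diff1 h ^^ k) f (x + h) = 0"
  proof (rule Suc.IH)
    fix i assume "i \<le> k"
    then show "f (x + h + real i *\<^sub>R h) = 0" using Suc.prems[of "Suc i"] by (simp add: scaleR_left_distrib add.assoc)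
  qed
  moreover have "(diff1 h ^^ k) f x = 0" by (rule Suc.IH) (use Suc.prems in auto)
  ultimately show ?case by (simp add: diff1_def[of h "(diff1 h ^^ k) f"])
qed (use assms[of 0] in simp)

text \<open>In the binomial expansion of the k-th difference only the term at \<open>x\<close>
  itself survives.\<close>

lemma diff1_eq_sign:
  fixes f :: "'a::real_normed_vector \<Rightarrow> complex"
  assumes "\<And>i. 1 \<le> i \<Longrightarrow> i \<le> k \<Longrightarrow> f (x + real i *\<^sub>R h) = 0"
  shows "(diff1 h ^^ k) f x = (- 1) ^ k * f x"
  using assms
proof (induction k)
  case (Suc k)
  have "(diff1 h ^^ k) f (x + h) = 0"
  proof (rule diff1_eq_0)
    fix i assume "i \<le> k"
    then show "f (x + h + real i *\<^sub>R h) = 0" using Suc.prems[of "Suc i"] by (simp add: scaleR_left_distrib add.assoc)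
  qed
  moreover have "(diff1 h ^^ k) f x = (- 1) ^ k * f x" by (rule Suc.IH) (use Suc.prems in auto)
  ultimately show ?case by (simp add: diff1_def[of h "(diff1 h ^^ k) f"])
qed simp

section \<open>From bump families to test sums\<close>

context shift_invariant_Lp begin

text \<open>The step \<open>h n\<close> moves \<open>E n\<close> off the supports of all bumps: on \<open>E n\<close> the difference of order \<open>k\<close>
  of a sum of bumps is, up to sign, the sum itself. The number \<open>m n\<close> is the order of the measure of
  both \<open>E n\<close> and \<open>S n\<close>.\<close>

definition bump_family :: "nat \<Rightarrow> real \<Rightarrow> (nat \<Rightarrow> 'a \<Rightarrow> real) \<Rightarrow> (nat \<Rightarrow> 'a set) \<Rightarrow> (nat \<Rightarrow> 'a set) \<Rightarrow> (nat \<Rightarrow> 'a) \<Rightarrow> (nat \<Rightarrow> real) \<Rightarrow> bool" where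
  "bump_family k B U S E h m \<longleftrightarrow> 0 < B \<and> (\<forall>n.
     (\<lambda>x. complex_of_real (U n x)) \<in> X \<and> (\<lambda>x. indicator (S n) x) \<in> X \<and>
     (\<forall>x. 0 \<le> U n x \<and> U n x \<le> 1 \<and> (x \<notin> S n \<longrightarrow> U n x = 0)) \<and>
     (\<forall>v x. norm ((diff1 v ^^ k) (\<lambda>x. complex_of_real (U n x)) x) \<le> (B * 2 powr real n * norm v) ^ k) \<and>
     0 < m n \<and> Lp_norm M p (indicator (S n)) \<le> ennreal (B * m n powr (1 / p)) \<and>
     E n \<in> sets M \<and> ennreal (m n) \<le> emeasure M (E n) \<and> (\<forall>x\<in>E n. U n x = 1) \<and>
     norm (h n) \<le> 2 powr (- real n) \<and>
     (\<forall>x\<in>E n. \<forall>i j. 1 \<le> i \<longrightarrow> i \<le> k \<longrightarrow> U j (x + real i *\<^sub>R h n) = 0))"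

text \<open>Two bounds meet at steps of length 2^(-n): for large steps each difference costs a
  factor 2, for small steps the pointwise smoothness bound is integrated over k + 1 translates of
  \<open>S n\<close>. The factor m^(-1/p) cancels the measure in both.\<close>

lemma Lp_diff1_bump:
  assumes "bump_family k B U S E h m"
  shows "Lp_norm M p ((diff1 v ^^ k) (\<lambda>x. complex_of_real (m n powr (- (1 / p)) * U n x))) \<le>
    ennreal (B * 2 ^ k + real (Suc k) * B * B ^ k) * ennreal (min 1 ((2 powr real n * norm v) ^ k))"
proof -
  note bump = assms[unfolded bump_family_def, THEN conjunct2, rule_format, of n]
  have B: "0 < B" using assms by (simp add: bump_family_def)
  define u where "u = (\<lambda>x. complex_of_real (U n x))"
  define w where "w = m n powr (- (1 / p))"
  define T where "T = B * m n powr (1 / p)"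
  have u: "u \<in> X" using bump by (simp add: u_def)
  have m: "0 < m n" using bump by simp
  have wT: "0 \<le> w" "0 \<le> T" "w * T = B" using m B by (auto simp: w_def T_def powr_minus)
  have IX: "(\<lambda>x. indicator (S n) x :: complex) \<in> X" using bump by simp
  have IT: "Lp_norm M p (indicator (S n)) \<le> ennreal T" using bump by (simp add: T_def)
  have scale: "Lp_norm M p ((diff1 v ^^ k) (\<lambda>x. complex_of_real (m n powr (- (1 / p)) * U n x))) = ennreal w * Lp_norm M p ((diff1 v ^^ k) u)"
    using Lp_scale[OF X_diff1[OF u], of "complex_of_real w" k v] wT
    by (simp add: u_def w_def flip: diff1_scale)
  have 1: "Lp_norm M p ((diff1 v ^^ k) u) \<le> ennreal (2 ^ k * T)"
  proof -
    have "Lp_norm M p u \<le> Lp_norm M p (indicator (S n))"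
    proof (rule Lp_norm_mono[OF p0])
      fix x
      show "norm (u x) \<le> norm (indicator (S n) x :: complex)"
        using bump[THEN conjunct2, THEN conjunct2, THEN conjunct1, rule_format, of x] by (auto simp: u_def indicator_def)
    qed
    with IT have "Lp_norm M p u \<le> ennreal T" by (rule order_trans[rotated])
    then have "2 ^ k * Lp_norm M p u \<le> 2 ^ k * ennreal T" by (rule mult_left_mono) simp
    also have "2 ^ k * ennreal T = ennreal (2 ^ k * T)" by (simp add: ennreal_mult wT flip: ennreal_power)
    finally show ?thesis using Lp_diff1_le[OF u, of k v] by (rule order_trans[rotated])
  qed
  have 2: "Lp_norm M p ((diff1 v ^^ k) u) \<le> ennreal ((B * 2 powr real n * norm v) ^ k * (real (Suc k) * T))"
  proof -
    let ?c = "(B * 2 powr real n * norm v) ^ k"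
    \<comment> \<open>Counts how many of the points x + i v lie in \<open>S n\<close>. If none does,
      the difference vanishes; otherwise the count is at least 1 and the pointwise bound
      applies.\<close>
    let ?g = "\<lambda>x. \<Sum>i\<in>{..k}. (indicator (S n) (x + real i *\<^sub>R v) :: complex)"
    have c: "0 \<le> ?c" using B by simp
    have gX: "?g \<in> X" by (intro X_sum X_shift IX)
    have "Lp_norm M p ((diff1 v ^^ k) u) \<le> Lp_norm M p (\<lambda>x. of_real ?c * ?g x)"
    proof (rule Lp_norm_mono[OF p0])
      fix x
      have g: "?g x = of_real (\<Sum>i\<in>{..k}. indicator (S n) (x + real i *\<^sub>R v))"
        by (simp add: indicator_def of_real_sum if_distrib cong: if_cong)
      have g0: "0 \<le> (\<Sum>i\<in>{..k}. indicator (S n) (x + real i *\<^sub>R v) :: real)" by (intro sum_nonneg) auto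
      show "norm ((diff1 v ^^ k) u x) \<le> norm (of_real ?c * ?g x)"
      proof (cases "\<exists>i\<le>k. x + real i *\<^sub>R v \<in> S n")
        case True
        then obtain i where i: "i \<le> k" "x + real i *\<^sub>R v \<in> S n" by blast
        have "indicator (S n) (x + real i *\<^sub>R v) \<le> (\<Sum>i\<in>{..k}. indicator (S n) (x + real i *\<^sub>R v) :: real)"
          using i by (intro member_le_sum) auto
        then have "1 \<le> (\<Sum>i\<in>{..k}. indicator (S n) (x + real i *\<^sub>R v) :: real)" using i by simp
        then have "?c * 1 \<le> ?c * (\<Sum>i\<in>{..k}. indicator (S n) (x + real i *\<^sub>R v))" by (rule mult_left_mono[OF _ c])
        moreover have "norm ((diff1 v ^^ k) u x) \<le> ?c" using bump unfolding u_def by blast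
        ultimately show ?thesis unfolding g norm_mult norm_of_real using c g0 by simp
      next
        case False
        then have "u (x + real i *\<^sub>R v) = 0" if "i \<le> k" for i
          using bump[THEN conjunct2, THEN conjunct2, THEN conjunct1, rule_format, of "x + real i *\<^sub>R v"] that by (auto simp: u_def)
        then show ?thesis by (simp add: diff1_eq_0)
      qed
    qed
    also have "\<dots> = ennreal ?c * Lp_norm M p ?g" by (simp only: Lp_scale[OF gX] norm_of_real abs_of_nonneg[OF c])
    also have "Lp_norm M p ?g \<le> (\<Sum>i\<in>{..k}. Lp_norm M p (\<lambda>x. indicator (S n) (x + real i *\<^sub>R v)))"
      by (intro Lp_sum X_shift IX) simp
    also have "\<dots> = (\<Sum>i\<in>{..k}. Lp_norm M p (indicator (S n)))"
      by (intro sum.cong refl Lp_shift IX)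
    also have "\<dots> \<le> (\<Sum>i\<in>{..k}. ennreal T)" by (intro sum_mono IT)
    also have "\<dots> = ennreal (real (Suc k) * T)"
      using wT by (simp add: ennreal_mult ennreal_of_nat_eq_real_of_nat)
    finally show ?thesis using c wT by (simp add: ennreal_mult mult_left_mono)
  qed
  define c where "c = (2 powr real n * norm v) ^ k"
  have c0: "0 \<le> c" by (simp add: c_def)
  have "ennreal w * Lp_norm M p ((diff1 v ^^ k) u) \<le> ennreal ((B * 2 ^ k + real (Suc k) * B * B ^ k) * min 1 c)"
  proof (cases "1 \<le> c")
    case True
    have "ennreal w * Lp_norm M p ((diff1 v ^^ k) u) \<le> ennreal w * ennreal (2 ^ k * T)" by (intro mult_left_mono 1) simp
    also have "\<dots> = ennreal (w * (2 ^ k * T))" using wT by (simp add: ennreal_mult)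
    also have "w * (2 ^ k * T) = 2 ^ k * (w * T)" by (simp only: mult_ac)
    also have "\<dots> \<le> ennreal ((B * 2 ^ k + real (Suc k) * B * B ^ k) * min 1 c)"
      using True wT B by (intro ennreal_leI) (simp add: mult.commute)
    finally show ?thesis .
  next
    case False
    have "ennreal w * Lp_norm M p ((diff1 v ^^ k) u) \<le> ennreal w * ennreal ((B * 2 powr real n * norm v) ^ k * (real (Suc k) * T))"
      by (intro mult_left_mono 2) simp
    also have "\<dots> = ennreal ((real (Suc k) * (w * T) * B ^ k) * c)"
      using wT B by (simp add: ennreal_mult[symmetric] c_def power_mult_distrib mult_ac del: of_nat_Suc)
    also have "\<dots> \<le> ennreal ((B * 2 ^ k + real (Suc k) * B * B ^ k) * min 1 c)"
      using False wT B c0 by (intro ennreal_leI) (auto simp: min_def intro!: mult_right_mono)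
    finally show ?thesis .
  qed
  then show ?thesis unfolding scale c_def[symmetric]
    using B c0 by (subst ennreal_mult[symmetric]) (auto intro!: add_nonneg_nonneg mult_nonneg_nonneg)
qed

text \<open>The upper bounds follow summand by summand from the previous estimate; the lower bound
  comes from the single step \<open>h n\<close>, for which the difference on \<open>E n\<close> is
  the function itself up to sign.\<close>

lemma ex_test_sums:
  assumes bf: "bump_family k B U S E h m"
  obtains C where "0 < C" "\<And>a N. (\<And>j. 0 \<le> a j) \<Longrightarrow> \<exists>f. test_sum C k a N f"
proof -
  define C0 where "C0 = B * 2 ^ k + real (Suc k) * B * B ^ k"
  have B: "0 < B" using bf by (simp add: bump_family_def)
  note bump = bf[unfolded bump_family_def, THEN conjunct2, rule_format]
  have C0: "0 < C0" using B by (auto simp: C0_def intro!: add_pos_nonneg)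
  have BC0: "B \<le> C0"
  proof -
    have "B * 1 \<le> B * 2 ^ k" using B by (intro mult_left_mono) auto
    moreover have "0 \<le> real (Suc k) * B * B ^ k" using B by simp
    ultimately show ?thesis by (simp add: C0_def)
  qed
  have ex: "\<exists>f. test_sum C0 k a N f" if a: "\<And>j. 0 \<le> a j" for a N
  proof -
    define G where "G j x = complex_of_real (m j powr (- (1 / p)) * U j x)" for j x
    have GX: "G j \<in> X" for j
      using X_scale[of "\<lambda>x. complex_of_real (U j x)" "complex_of_real (m j powr (- (1 / p)))"] bump[of j]
      by (simp add: G_def[abs_def])
    define f where "f x = (\<Sum>j<Suc N. complex_of_real (a j) * G j x)" for x
    have fX: "f \<in> X" unfolding f_def[abs_def] by (intro X_sum X_scale GX)
    have LG: "Lp_norm M p (G j) \<le> ennreal C0" for j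
    proof -
      have m: "0 < m j" using bump[of j] by simp
      have "Lp_norm M p (G j) \<le> Lp_norm M p (\<lambda>x. complex_of_real (m j powr (- (1 / p))) * indicator (S j) x)"
      proof (rule Lp_norm_mono[OF p0])
        fix x
        show "norm (G j x) \<le> norm (complex_of_real (m j powr (- (1 / p))) * indicator (S j) x)"
          using bump[of j, THEN conjunct2, THEN conjunct2, THEN conjunct1, rule_format, of x]
          by (auto simp: G_def norm_mult indicator_def mult_left_le)
      qed
      also have "\<dots> = ennreal (m j powr (- (1 / p))) * Lp_norm M p (indicator (S j))"
        using bump[of j] by (subst Lp_scale) auto
      also have "\<dots> \<le> ennreal (m j powr (- (1 / p))) * ennreal (B * m j powr (1 / p))"
        using bump[of j] by (intro mult_left_mono) auto
      also have "\<dots> = ennreal B" using m B by (simp add: ennreal_mult[symmetric] powr_minus)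
      also have "\<dots> \<le> ennreal C0" by (rule ennreal_leI[OF BC0])
      finally show ?thesis .
    qed
    have "Lp_norm M p f \<le> (\<Sum>j<Suc N. Lp_norm M p (\<lambda>x. complex_of_real (a j) * G j x))"
      unfolding f_def[abs_def] by (intro Lp_sum X_scale GX) simp
    also have "\<dots> \<le> (\<Sum>j<Suc N. ennreal (C0 * a j))"
    proof (rule sum_mono)
      fix j
      have "Lp_norm M p (\<lambda>x. complex_of_real (a j) * G j x) = ennreal (a j) * Lp_norm M p (G j)"
        using a by (simp add: Lp_scale GX)
      also have "\<dots> \<le> ennreal (a j) * ennreal C0" by (intro mult_left_mono LG) simp
      finally show "Lp_norm M p (\<lambda>x. complex_of_real (a j) * G j x) \<le> ennreal (C0 * a j)"
        using a C0 by (simp add: ennreal_mult[symmetric] mult.commute)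
    qed
    also have "\<dots> = ennreal (C0 * (\<Sum>j<Suc N. a j))"
      using a C0 unfolding sum_distrib_left by (intro sum_ennreal) auto
    finally have Lf: "Lp_norm M p f \<le> ennreal (C0 * (\<Sum>j<Suc N. a j))" .
    have up: "omega k f n \<le> C0 * (\<Sum>j<Suc N. decay k n j * a j)" for n
    proof -
      have nn: "0 \<le> C0 * (\<Sum>j<Suc N. decay k n j * a j)"
        using C0 a by (intro mult_nonneg_nonneg sum_nonneg decay_nonneg) auto
      have "modulus M p k f (2 powr (- real n)) \<le> ennreal (C0 * (\<Sum>j<Suc N. decay k n j * a j))"
        unfolding modulus_def
      proof (rule SUP_least)
        fix v :: 'a assume "v \<in> {h. norm h \<le> 2 powr (- real n)}"
        then have v: "norm v \<le> 2 powr (- real n)" by simp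
        have "Lp_norm M p ((diff1 v ^^ k) f) = Lp_norm M p (\<lambda>x. \<Sum>j<Suc N. complex_of_real (a j) * (diff1 v ^^ k) (G j) x)"
          unfolding f_def[abs_def] diff1_sum diff1_scale ..
        also have "\<dots> \<le> (\<Sum>j<Suc N. Lp_norm M p (\<lambda>x. complex_of_real (a j) * (diff1 v ^^ k) (G j) x))"
          by (intro Lp_sum X_scale X_diff1 GX) simp
        also have "\<dots> \<le> (\<Sum>j<Suc N. ennreal (C0 * (decay k n j * a j)))"
        proof (rule sum_mono)
          fix j
          have min: "min 1 ((2 powr real j * norm v) ^ k) \<le> decay k n j"
          proof (cases "n \<le> j")
            case True
            then show ?thesis by (simp add: decay_def max_def)
          next
            case False
            have "2 powr real j * norm v \<le> 2 powr real j * 2 powr (- real n)" by (intro mult_left_mono v) simp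
            then have "(2 powr real j * norm v) ^ k \<le> (2 powr real j * 2 powr (- real n)) ^ k"
              by (intro power_mono) auto
            also have "\<dots> = 2 powr (- real k * (real n - real j))"
              unfolding powr_add[symmetric] by (simp add: powr_power algebra_simps)
            finally show ?thesis using False by (simp add: decay_def max_def)
          qed
          have "Lp_norm M p (\<lambda>x. complex_of_real (a j) * (diff1 v ^^ k) (G j) x) = ennreal (a j) * Lp_norm M p ((diff1 v ^^ k) (G j))"
            using a by (simp add: Lp_scale X_diff1 GX)
          also have "\<dots> \<le> ennreal (a j) * (ennreal C0 * ennreal (min 1 ((2 powr real j * norm v) ^ k)))"
            using Lp_diff1_bump[OF bf, of v j] unfolding G_def[abs_def] C0_def by (intro mult_left_mono) auto
          also have "\<dots> \<le> ennreal (a j) * (ennreal C0 * ennreal (decay k n j))"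
            by (intro mult_left_mono ennreal_leI min) auto
          also have "\<dots> = ennreal (C0 * (decay k n j * a j))"
            using a C0 decay_nonneg by (simp add: ennreal_mult[symmetric] mult_ac)
          finally show "Lp_norm M p (\<lambda>x. complex_of_real (a j) * (diff1 v ^^ k) (G j) x) \<le> ennreal (C0 * (decay k n j * a j))" .
        qed
        also have "\<dots> = ennreal (C0 * (\<Sum>j<Suc N. decay k n j * a j))"
          using a C0 decay_nonneg unfolding sum_distrib_left by (intro sum_ennreal) auto
        finally show "Lp_norm M p ((diff1 v ^^ k) f) \<le> ennreal (C0 * (\<Sum>j<Suc N. decay k n j * a j))" .
      qed
      then show ?thesis unfolding modulus_eq_omega[OF fX Lf] using nn by (simp add: ennreal_le_iff del: sum.lessThan_Suc)
    qed
    have low: "a n \<le> omega k f n" if n: "n \<le> N" for n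
    proof -
      have bn: "E n \<in> sets M" "ennreal (m n) \<le> emeasure M (E n)" "\<forall>x\<in>E n. U n x = 1" "norm (h n) \<le> 2 powr (- real n)"
        "0 < m n" using bump[of n] by auto
      define r where "r = (a n * m n powr (- (1 / p))) powr p"
      have pt: "a n * m n powr (- (1 / p)) \<le> norm ((diff1 (h n) ^^ k) f x)" if x: "x \<in> E n" for x
      proof -
        have "f (x + real i *\<^sub>R h n) = 0" if "1 \<le> i" "i \<le> k" for i
          using bump[of n] x that by (simp add: f_def G_def)
        then have "(diff1 (h n) ^^ k) f x = (- 1) ^ k * f x" by (rule diff1_eq_sign)
        then have "norm ((diff1 (h n) ^^ k) f x) = norm (f x)" by (simp add: norm_mult norm_power)
        also have "f x = complex_of_real (\<Sum>j<Suc N. a j * (m j powr (- (1 / p)) * U j x))"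
          by (simp add: f_def G_def)
        also have "norm \<dots> = \<bar>\<Sum>j<Suc N. a j * (m j powr (- (1 / p)) * U j x)\<bar>" by (rule norm_of_real)
        also have "\<dots> \<ge> (\<Sum>j<Suc N. a j * (m j powr (- (1 / p)) * U j x))" by (rule abs_ge_self)
        \<comment> \<open>Nonnegativity of coefficients and bumps: dropping all terms but the n-th
          only decreases the sum.\<close>
        also have "(\<Sum>j<Suc N. a j * (m j powr (- (1 / p)) * U j x)) \<ge> a n * (m n powr (- (1 / p)) * U n x)"
        proof (rule member_le_sum[of n "{..<Suc N}" "\<lambda>j. a j * (m j powr (- (1 / p)) * U j x)"])
          fix j
          have "0 \<le> U j x" using bump[of j] by blast
          then show "0 \<le> a j * (m j powr (- (1 / p)) * U j x)" using a by simp
        qed (use n in auto)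
        finally show ?thesis using x bn by simp
      qed
      \<comment> \<open>The normalization of the bumps is made for this cancellation: on a set of
        measure m n the constant a n m(n)^(-1/p) has Lp norm exactly a n.\<close>
      have "(m n powr (- (1 / p))) powr p * m n = 1"
        using bn p0 unfolding powr_powr by (simp add: powr_minus)
      then have "ennreal (a n powr p) = ennreal (r * m n)"
        using a by (simp add: r_def powr_mult mult.assoc)
      also have "\<dots> = ennreal r * ennreal (m n)" using bn by (intro ennreal_mult) (auto simp: r_def)
      also have "\<dots> \<le> ennreal r * emeasure M (E n)" by (intro mult_left_mono bn) simp
      also have "\<dots> = (\<integral>\<^sup>+x. ennreal r * indicator (E n) x \<partial>M)" using bn by (simp add: nn_integral_cmult_indicator)
      also have "\<dots> \<le> (\<integral>\<^sup>+x. ennreal (norm ((diff1 (h n) ^^ k) f x) powr p) \<partial>M)"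
      proof (rule nn_integral_mono)
        fix x
        show "ennreal r * indicator (E n) x \<le> ennreal (norm ((diff1 (h n) ^^ k) f x) powr p)"
        proof (cases "x \<in> E n")
          case True
          then show ?thesis using pt[OF True] a p0 by (auto simp: r_def intro!: ennreal_leI powr_mono2)
        qed simp
      qed
      finally have "epowr (ennreal (a n powr p)) (1 / p) \<le> Lp_norm M p ((diff1 (h n) ^^ k) f)"
        unfolding Lp_norm_def using p0 by (intro epowr_mono) auto
      also have "\<dots> \<le> modulus M p k f (2 powr (- real n))"
        unfolding modulus_def using bn by (intro SUP_upper) auto
      finally show ?thesis unfolding modulus_eq_omega[OF fX Lf] using a p0
        by (simp add: epowr_ennreal powr_powr ennreal_le_iff omega_nonneg)
    qed
    show ?thesis using fX Lf up low by (auto simp: test_sum_def simp del: sum.lessThan_Suc)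
  qed
  show ?thesis by (rule that[OF C0 ex])
qed

section \<open>Failure of the inequality outside the listed conditions\<close>

lemma lq_le_besov_term:
  assumes "0 < q" "0 \<le> R" "besov_le q s b k f R"
  shows "wt s b n * omega k f n \<le> R"
proof -
  have "lq_le q (\<lambda>n. wt s b n * omega k f n) R" using assms(3) by (simp add: besov_le_def)
  then show ?thesis by (rule lq_le_term[OF assms(1) wt_omega_nonneg assms(2)])
qed

text \<open>A single bump suffices. The source is first shrunk to an intermediate smoothness
  \<open>s\<close> with q infinite, which is positive even if \<open>s0\<close> is 0, so that the
  bound for positive smoothness applies.\<close>

lemma not_besov_bounded_smoothness:
  assumes q: "0 < q0" "0 < q1" and s: "0 \<le> s0" "s0 < s1" "s1 < real k"
    and C: "0 < C" "\<And>a N. (\<And>j. 0 \<le> a j) \<Longrightarrow> \<exists>f. test_sum C k a N f"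
  shows "\<not> besov_bounded q0 s0 b0 k q1 s1 b1 k"
proof
  assume "besov_bounded q0 s0 b0 k q1 s1 b1 k"
  define s where "s = (s0 + s1) / 2"
  have s': "0 < s" "s0 < s" "s < s1" "s < real k" using s by (auto simp: s_def)
  have "besov_bounded top s 0 k q0 s0 b0 k"
    using q s' by (intro besov_bounded_if_seq_embeds seq_embeds_smoothness) auto
  then have "besov_bounded top s 0 k q1 s1 b1 k" by (rule besov_bounded_trans) fact
  then obtain A where A: "0 < A" "\<And>f R. 0 < R \<Longrightarrow> besov_le top s 0 k f R \<Longrightarrow> besov_le q1 s1 b1 k f (A * R)"
    by (rule besov_boundedE) blast
  obtain D where D: "0 < D"
    "\<And>a N B f. (\<And>j. 0 \<le> a j) \<Longrightarrow> 0 \<le> B \<Longrightarrow> test_sum C k a N f \<Longrightarrow>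
       lq_le top (\<lambda>j. if j \<le> N then wt s 0 j * a j else 0) B \<Longrightarrow> besov_le top s 0 k f (D * B)"
    by (rule besov_le_test_sum_pos[of s k top C 0]) (use s' C in auto)
  define e where "e = s1 - s"
  have e: "0 < e" using s' by (simp add: e_def)
  \<comment> \<open>The exponent 1 - b1 is chosen so that the factor (1 + N)^b1 of the target weight
    leaves exactly 1 + N, which is unbounded.\<close>
  obtain K where K: "0 < K" "\<And>n::nat. (1 + real n) powr (1 - b1) \<le> K * 2 powr (e * real n)"
    using powr_le_geometric[OF e] by metis
  have "(1 + real N) powr 1 \<le> K * (A * D)" for N
  proof -
    define a where "a j = (if j = N then 1 else 0 :: real)" for j
    have a: "0 \<le> a j" for j by (simp add: a_def)
    obtain f where f: "test_sum C k a N f" using C(2)[of a N, OF a] by blast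
    have "lq_le top (\<lambda>j. if j \<le> N then wt s 0 j * a j else 0) (wt s 0 N)"
      using wt_nonneg[of s 0 N] by (auto simp: lq_le_top a_def)
    then have "besov_le top s 0 k f (D * wt s 0 N)" by (rule D(2)[OF a wt_nonneg f])
    then have "besov_le q1 s1 b1 k f (A * (D * wt s 0 N))" using D wt_pos by (intro A(2)) auto
    then have "wt s1 b1 N * omega k f N \<le> A * (D * wt s 0 N)"
      using A D wt_nonneg by (intro lq_le_besov_term[OF q(2)]) auto
    moreover have "1 \<le> omega k f N" using test_sum_lower[OF f, of N] by (simp add: a_def)
    then have "wt s1 b1 N * 1 \<le> wt s1 b1 N * omega k f N" by (intro mult_left_mono wt_nonneg)
    ultimately have "wt s1 b1 N \<le> A * D * wt s 0 N" by simp
    moreover have "wt s1 b1 N = 2 powr (e * real N) * wt s 0 N * (1 + real N) powr b1"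
      by (simp add: wt_def e_def left_diff_distrib powr_diff)
    ultimately have "2 powr (e * real N) * (1 + real N) powr b1 * wt s 0 N \<le> A * D * wt s 0 N" by (simp add: mult_ac)
    then have le: "2 powr (e * real N) * (1 + real N) powr b1 \<le> A * D" using wt_pos[of s 0 N] by simp
    have "(1 + real N) powr 1 = (1 + real N) powr (1 - b1) * (1 + real N) powr b1" by (simp flip: powr_add)
    also have "\<dots> \<le> K * 2 powr (e * real N) * (1 + real N) powr b1" by (intro mult_right_mono K) auto
    also have "\<dots> = K * (2 powr (e * real N) * (1 + real N) powr b1)" by (simp only: mult.assoc)
    also have "\<dots> \<le> K * (A * D)" using K by (intro mult_left_mono le) auto
    finally show ?thesis .
  qed
  then show False by (rule powr_unbounded[OF zero_less_one])
qed

text \<open>On a single bump at level N both quasi-norms are essentially the weights at N, whose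
  quotient (1 + N)^(b1 - b0) is unbounded.\<close>

lemma not_besov_bounded_log_smoothness:
  assumes q: "0 < q0" "0 < q1" and s: "0 < s" "s < real k" and b: "b0 < b1"
    and C: "0 < C" "\<And>a N. (\<And>j. 0 \<le> a j) \<Longrightarrow> \<exists>f. test_sum C k a N f"
  shows "\<not> besov_bounded q0 s b0 k q1 s b1 k"
proof
  assume "besov_bounded q0 s b0 k q1 s b1 k"
  then obtain A where A: "0 < A" "\<And>f R. 0 < R \<Longrightarrow> besov_le q0 s b0 k f R \<Longrightarrow> besov_le q1 s b1 k f (A * R)"
    by (rule besov_boundedE) blast
  obtain D where D: "0 < D"
    "\<And>a N B f. (\<And>j. 0 \<le> a j) \<Longrightarrow> 0 \<le> B \<Longrightarrow> test_sum C k a N f \<Longrightarrow>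
       lq_le q0 (\<lambda>j. if j \<le> N then wt s b0 j * a j else 0) B \<Longrightarrow> besov_le q0 s b0 k f (D * B)"
    by (rule besov_le_test_sum_pos[OF s q(1) C(1), of b0]) blast
  have bound: "(1 + real N) powr (b1 - b0) \<le> A * D" for N
  proof -
    define a where "a j = (if j = N then 1 else 0 :: real)" for j
    have a: "0 \<le> a j" for j by (simp add: a_def)
    obtain f where f: "test_sum C k a N f" using C(2)[of a N, OF a] by blast
    have "(\<lambda>j. if j \<le> N then wt s b0 j * a j else 0) = (\<lambda>j. if j = N then wt s b0 N else 0)"
      by (auto simp: a_def)
    then have "lq_le q0 (\<lambda>j. if j \<le> N then wt s b0 j * a j else 0) (wt s b0 N)"
      using lq_le_single[OF q(1) wt_nonneg] by simp
    then have "besov_le q0 s b0 k f (D * wt s b0 N)" by (rule D(2)[OF a wt_nonneg f])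
    then have "besov_le q1 s b1 k f (A * (D * wt s b0 N))" using D wt_pos by (intro A(2)) auto
    then have "wt s b1 N * omega k f N \<le> A * (D * wt s b0 N)"
      using A D wt_nonneg by (intro lq_le_besov_term[OF q(2)]) auto
    moreover have "1 \<le> omega k f N" using test_sum_lower[OF f, of N] by (simp add: a_def)
    then have "wt s b1 N * 1 \<le> wt s b1 N * omega k f N" by (intro mult_left_mono wt_nonneg)
    ultimately have "wt s b1 N \<le> A * D * wt s b0 N" by simp
    moreover have "wt s b1 N = (1 + real N) powr (b1 - b0) * wt s b0 N"
      by (simp add: wt_def powr_diff)
    ultimately have "(1 + real N) powr (b1 - b0) * wt s b0 N \<le> A * D * wt s b0 N" by simp
    then show ?thesis using wt_pos[of s b0 N] by simp
  qed
  show False by (rule powr_unbounded[OF _ bound]) (use b in simp)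
qed

text \<open>The coefficients are borderline for the target, whose quasi-norm is then at least the
  power 1/q1 of the harmonic sum, while the hypothesis on the exponents bounds the source by a
  multiple of the power 1/q0.\<close>

lemma not_besov_bounded_weight:
  assumes q: "0 < q1" "q1 < q0" and s: "0 < s" "s < real k" and b: "b0 + recip q0 \<le> b1 + recip q1"
    and C: "0 < C" "\<And>a N. (\<And>j. 0 \<le> a j) \<Longrightarrow> \<exists>f. test_sum C k a N f"
  shows "\<not> besov_bounded q0 s b0 k q1 s b1 k"
proof
  assume "besov_bounded q0 s b0 k q1 s b1 k"
  then obtain A where A: "0 < A" "\<And>f R. 0 < R \<Longrightarrow> besov_le q0 s b0 k f R \<Longrightarrow> besov_le q1 s b1 k f (A * R)"
    by (rule besov_boundedE) blast
  have q0: "0 < q0" using q by simp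
  obtain r where r: "0 < r" "q1 = ennreal r" using q by (cases q1) auto
  obtain D where D: "0 < D"
    "\<And>a N B f. (\<And>j. 0 \<le> a j) \<Longrightarrow> 0 \<le> B \<Longrightarrow> test_sum C k a N f \<Longrightarrow>
       lq_le q0 (\<lambda>j. if j \<le> N then wt s b0 j * a j else 0) B \<Longrightarrow> besov_le q0 s b0 k f (D * B)"
    by (rule besov_le_test_sum_pos[OF s q0 C(1), of b0]) blast
  have "harm_sum N powr recip q1 \<le> (A * D) * harm_sum N powr recip q0" for N
  proof -
    define a where "a j = 2 powr (- s * real j) * (1 + real j) powr (- (b1 + recip q1))" for j
    have a: "0 \<le> a j" for j by (simp add: a_def)
    have wa: "wt s b j * a j = (1 + real j) powr (b - (b1 + recip q1))" for b j
    proof -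
      have "wt s b j * a j = (2 powr (s * real j) * 2 powr (- s * real j)) * ((1 + real j) powr b * (1 + real j) powr (- (b1 + recip q1)))"
        by (simp only: wt_def a_def mult_ac)
      then show ?thesis unfolding diff_conv_add_uminus[of b] powr_add[symmetric] by simp
    qed
    obtain f where f: "test_sum C k a N f" using C(2)[of a N, OF a] by blast
    have H: "0 < harm_sum N" using harm_sum_ge_1[of N] by simp
    have "lq_le q0 (\<lambda>j. if j \<le> N then wt s b0 j * a j else 0) (harm_sum N powr recip q0)"
    proof (rule lq_le_mono[OF q0 _ _ lq_le_harmonic[OF q0]])
      fix j
      show "0 \<le> (if j \<le> N then wt s b0 j * a j else 0)" using a wt_nonneg by simp
      have "(1 + real j) powr (b0 - (b1 + recip q1)) \<le> (1 + real j) powr (- recip q0)"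
        using b by (intro powr_mono) auto
      then show "(if j \<le> N then wt s b0 j * a j else 0) \<le> (if j \<le> N then (1 + real j) powr (- recip q0) else 0)"
        by (simp add: wa)
    qed
    then have "besov_le q0 s b0 k f (D * harm_sum N powr recip q0)" by (rule D(2)[OF a _ f, rotated]) simp
    then have "besov_le q1 s b1 k f (A * (D * harm_sum N powr recip q0))" using D H by (intro A(2)) auto
    then have l: "lq_le (ennreal r) (\<lambda>n. wt s b1 n * omega k f n) (A * (D * harm_sum N powr recip q0))"
      by (simp add: besov_le_def r)
    have "1 * harm_sum N powr recip (ennreal r) \<le> A * (D * harm_sum N powr recip q0)"
    proof (rule harm_sum_le_if_lq_le[OF r(1) _ _ l])
      fix n assume "n \<le> N"
      then have "a n \<le> omega k f n" using f by (simp add: test_sum_def)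
      then have "wt s b1 n * a n \<le> wt s b1 n * omega k f n" by (intro mult_left_mono wt_nonneg)
      then show "1 * (1 + real n) powr (- recip (ennreal r)) \<le> wt s b1 n * omega k f n" by (simp add: wa r)
    qed (use A D in auto)
    then show ?thesis by (simp add: r mult.assoc)
  qed
  then show False using harm_sum_powr_contradiction[OF q] by blast
qed

lemma besov_le_zero_decay:
  assumes "0 < q" "- recip q \<le> b"
  obtains K where "0 < K"
    "\<And>f R n. 0 < R \<Longrightarrow> besov_le q 0 b k f R \<Longrightarrow> omega k f n \<le> K * R * (1 + real n) powr (- (b + recip q))"
proof -
  obtain K where K: "0 < K"
    "\<And>x R n. decseq x \<Longrightarrow> (\<And>n. 0 \<le> x n) \<Longrightarrow> x 0 \<le> R \<Longrightarrow>
       lq_le q (\<lambda>n. wt 0 b n * x n) R \<Longrightarrow> x n \<le> K * R * (1 + real n) powr (- (b + recip q))"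
    using decseq_term_bound[OF assms] by blast
  show ?thesis
  proof (rule that[of "K * 2 ^ k"])
    show "0 < K * 2 ^ k" using K by simp
    fix f R n assume R: "0 < R" and f: "besov_le q 0 b k f R"
    have f': "f \<in> X" "Lp_norm M p f \<le> ennreal R" "lq_le q (\<lambda>n. wt 0 b n * omega k f n) R"
      using f by (auto simp: besov_le_def)
    have "1 * R \<le> 2 ^ k * R" using R by (intro mult_right_mono) auto
    then have "lq_le q (\<lambda>n. wt 0 b n * omega k f n) (2 ^ k * R)"
      using R by (intro lq_le_mono_bound[OF assms(1) _ _ f'(3)]) auto
    then have "omega k f n \<le> K * (2 ^ k * R) * (1 + real n) powr (- (b + recip q))"
      using R by (intro K(2) decseq_omega[OF f'(1,2)] omega_nonneg omega_le f') auto
    then show "omega k f n \<le> K * 2 ^ k * R * (1 + real n) powr (- (b + recip q))" by (simp only: mult_ac)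
  qed
qed

text \<open>The target forces the moduli to decay with exponent b1 + 1/q1. An exponent
  \<open>c\<close> strictly between the critical values still embeds into the source, and a bump of
  height (1 + N)^(-c) violates the forced decay.\<close>

lemma not_besov_bounded_zero_strict:
  assumes q: "0 < q0" "0 < q1" and k: "0 < k" and b: "- recip q0 \<le> b0" "- recip q1 \<le> b1"
      "b0 + recip q0 < b1 + recip q1"
    and C: "0 < C" "\<And>a N. (\<And>j. 0 \<le> a j) \<Longrightarrow> \<exists>f. test_sum C k a N f"
  shows "\<not> besov_bounded q0 0 b0 k q1 0 b1 k"
proof
  assume bd: "besov_bounded q0 0 b0 k q1 0 b1 k"
  define c where "c = (b0 + recip q0 + (b1 + recip q1)) / 2"
  have c: "b0 + recip q0 < c" "c < b1 + recip q1" "0 \<le> c" using b by (auto simp: c_def)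
  have "besov_bounded top 0 c k q0 0 b0 k"
    using q c by (intro besov_bounded_if_seq_embeds seq_embeds_zero_strict) auto
  then have "besov_bounded top 0 c k q1 0 b1 k" using bd by (rule besov_bounded_trans)
  then obtain A where A: "0 < A" "\<And>f R. 0 < R \<Longrightarrow> besov_le top 0 c k f R \<Longrightarrow> besov_le q1 0 b1 k f (A * R)"
    by (rule besov_boundedE) blast
  obtain D where D: "0 < D"
    "\<And>a N f. (\<And>j. 0 \<le> a j) \<Longrightarrow> test_sum C k a N f \<Longrightarrow>
       (\<And>j. a j \<le> (1 + real j) powr (- (c + recip top))) \<Longrightarrow>
       (\<And>n. n \<le> N \<Longrightarrow> (\<Sum>j\<in>{n..N}. a j) \<le> 1 * (1 + real n) powr (- (c + recip top))) \<Longrightarrow>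
       besov_le top 0 c k f (D * harm_sum N powr recip top)"
    by (rule besov_le_test_sum_zero[OF k _ C(1) zero_less_one, of top c]) (simp, blast)
  obtain K where K: "0 < K"
    "\<And>f R n. 0 < R \<Longrightarrow> besov_le q1 0 b1 k f R \<Longrightarrow> omega k f n \<le> K * R * (1 + real n) powr (- (b1 + recip q1))"
    by (rule besov_le_zero_decay[OF q(2) b(2), of k]) blast
  have bound: "(1 + real N) powr (b1 + recip q1 - c) \<le> K * (A * D)" for N
  proof -
    define a where "a j = (if j = N then (1 + real N) powr (- c) else 0)" for j
    have a: "0 \<le> a j" for j by (simp add: a_def)
    obtain f where f: "test_sum C k a N f" using C(2)[of a N, OF a] by blast
    have H: "harm_sum N \<noteq> 0" using harm_sum_ge_1[of N] by simp
    have "besov_le top 0 c k f (D * harm_sum N powr recip top)"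
      by (rule D(2)[OF a f]) (use c(3) in \<open>auto simp: a_def powr_mono2' sum.delta\<close>)
    then have "besov_le top 0 c k f D" using H by simp
    then have "besov_le q1 0 b1 k f (A * D)" using D by (intro A(2)) auto
    then have "omega k f N \<le> K * (A * D) * (1 + real N) powr (- (b1 + recip q1))" using A D by (intro K(2)) auto
    moreover have "(1 + real N) powr (- c) \<le> omega k f N" using test_sum_lower[OF f, of N] by (simp add: a_def)
    ultimately have le: "(1 + real N) powr (- c) \<le> K * (A * D) * (1 + real N) powr (- (b1 + recip q1))" by simp
    have "(1 + real N) powr (b1 + recip q1 - c) = (1 + real N) powr (- c) * (1 + real N) powr (b1 + recip q1)"
      by (simp flip: powr_add)
    also have "\<dots> \<le> K * (A * D) * (1 + real N) powr (- (b1 + recip q1)) * (1 + real N) powr (b1 + recip q1)"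
      by (intro mult_right_mono le) simp
    also have "\<dots> = K * (A * D)"
      unfolding mult.assoc powr_add[symmetric] by simp
    finally show ?thesis .
  qed
  show False by (rule powr_unbounded[OF _ bound]) (use c in simp)
qed

lemma not_besov_bounded_zero_eq:
  assumes q: "0 < q1" "q1 < q0" and k: "0 < k" and b: "- recip q0 \<le> b0" "b0 + recip q0 = b1 + recip q1"
    and C: "0 < C" "\<And>a N. (\<And>j. 0 \<le> a j) \<Longrightarrow> \<exists>f. test_sum C k a N f"
  shows "\<not> besov_bounded q0 0 b0 k q1 0 b1 k"
proof
  assume "besov_bounded q0 0 b0 k q1 0 b1 k"
  then obtain A where A: "0 < A" "\<And>f R. 0 < R \<Longrightarrow> besov_le q0 0 b0 k f R \<Longrightarrow> besov_le q1 0 b1 k f (A * R)"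
    by (rule besov_boundedE) blast
  have q0: "0 < q0" using q by simp
  obtain r where r: "0 < r" "q1 = ennreal r" using q by (cases q1) auto
  define c where "c = b0 + recip q0"
  have c: "0 \<le> c" "b1 = c - recip q1" using b by (auto simp: c_def)
  \<comment> \<open>For \<open>c > 0\<close> the sums \<open>\<Sum>2 powr (- m c) G (2 ^ m)\<close> have moduli of the exact size
    \<open>(1 + n) powr (- c)\<close>; for \<open>c = 0\<close> a single bump does.\<close>
  have "\<exists>L l. 0 < L \<and> 0 < l \<and> (\<forall>M. \<exists>N\<ge>M. \<exists>a. (\<forall>j. 0 \<le> a j) \<and>
     (\<forall>j. a j \<le> (1 + real j) powr (- c)) \<and>
     (\<forall>n\<le>N. (\<Sum>j\<in>{n..N}. a j) \<le> L * (1 + real n) powr (- c)) \<and>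
     (\<forall>n\<le>N. \<exists>i\<ge>n. i \<le> N \<and> l * (1 + real n) powr (- c) \<le> a i))"
  proof (cases "c = 0")
    case True
    have "\<exists>N\<ge>M. \<exists>a. (\<forall>j. 0 \<le> a j) \<and>
       (\<forall>j. a j \<le> (1 + real j) powr (- c)) \<and>
       (\<forall>n\<le>N. (\<Sum>j\<in>{n..N}. a j) \<le> 1 * (1 + real n) powr (- c)) \<and>
       (\<forall>n\<le>N. \<exists>i\<ge>n. i \<le> N \<and> 1 * (1 + real n) powr (- c) \<le> a i)" for M :: nat
      using True by (intro exI[of _ M] conjI exI[of _ "\<lambda>j. if j = M then 1 else 0 :: real"]) auto
    then show ?thesis using zero_less_one by blast
  next
    case False
    then have c0: "0 < c" using c by simp
    obtain L where L: "0 < L"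
      "\<And>n M. (\<Sum>j\<in>{n..2 ^ M}. if \<exists>m. j = 2 ^ m then (1 + real j) powr (- c) else 0) \<le> L * (1 + real n) powr (- c)"
      using lacunary_tail[OF c0] by blast
    have "\<exists>N\<ge>M. \<exists>a. (\<forall>j. 0 \<le> a j) \<and>
       (\<forall>j. a j \<le> (1 + real j) powr (- c)) \<and>
       (\<forall>n\<le>N. (\<Sum>j\<in>{n..N}. a j) \<le> L * (1 + real n) powr (- c)) \<and>
       (\<forall>n\<le>N. \<exists>i\<ge>n. i \<le> N \<and> 2 powr (- c) * (1 + real n) powr (- c) \<le> a i)" for M :: nat
    proof (rule exI[of _ "2 ^ M"], rule conjI, goal_cases)
      case 2
      show ?case
      proof (rule exI[of _ "\<lambda>j. if \<exists>m. j = 2 ^ m then (1 + real j) powr (- c) else 0"], intro conjI allI impI)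
        fix n :: nat assume n: "n \<le> 2 ^ M"
        define m where "m = (LEAST m. n \<le> 2 ^ m)"
        have m: "n \<le> 2 ^ m" "m \<le> M" unfolding m_def by (rule LeastI[of _ M], rule n) (rule Least_le, rule n)
        \<comment> \<open>The next power of 2 after n is comparable to n; the summand 1 is for m =
          0.\<close>
        have m2: "2 ^ m \<le> 2 * n + 1"
        proof (cases m)
          case (Suc i)
          then have "\<not> n \<le> 2 ^ i" using not_less_Least[of i "\<lambda>m. n \<le> 2 ^ m"] by (simp add: m_def)
          then show ?thesis using Suc by simp
        qed simp
        have "real (2 ^ m) \<le> real (2 * n + 1)" by (intro of_nat_mono m2)
        then have "1 + real (2 ^ m) \<le> 2 * (1 + real n)" by simp
        then have "(2 * (1 + real n)) powr (- c) \<le> (1 + real (2 ^ m)) powr (- c)"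
          using c by (intro powr_mono2') (simp_all add: add_pos_nonneg)
        moreover have "2 powr (- c) * (1 + real n) powr (- c) = (2 * (1 + real n)) powr (- c)" by (subst powr_mult) auto
        ultimately have "2 powr (- c) * (1 + real n) powr (- c) \<le> (1 + real (2 ^ m)) powr (- c)" by linarith
        then show "\<exists>i\<ge>n. i \<le> 2 ^ M \<and> 2 powr (- c) * (1 + real n) powr (- c) \<le> (if \<exists>m. i = 2 ^ m then (1 + real i) powr (- c) else 0)"
          using m by (intro exI[of _ "2 ^ m"]) auto
      qed (use L in auto)
    qed (simp add: less_imp_le)
    moreover have "0 < 2 powr (- c)" by simp
    ultimately show ?thesis using L(1) by blast
  qed
  then obtain L l where L: "0 < L" "0 < l" and fam: "\<And>M. \<exists>N\<ge>M. \<exists>a. (\<forall>j. 0 \<le> a j) \<and>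
     (\<forall>j. a j \<le> (1 + real j) powr (- c)) \<and>
     (\<forall>n\<le>N. (\<Sum>j\<in>{n..N}. a j) \<le> L * (1 + real n) powr (- c)) \<and>
     (\<forall>n\<le>N. \<exists>i\<ge>n. i \<le> N \<and> l * (1 + real n) powr (- c) \<le> a i)"
    by blast
  obtain D where D: "0 < D"
    "\<And>a N f. (\<And>j. 0 \<le> a j) \<Longrightarrow> test_sum C k a N f \<Longrightarrow>
       (\<And>j. a j \<le> (1 + real j) powr (- (b0 + recip q0))) \<Longrightarrow>
       (\<And>n. n \<le> N \<Longrightarrow> (\<Sum>j\<in>{n..N}. a j) \<le> L * (1 + real n) powr (- (b0 + recip q0))) \<Longrightarrow>
       besov_le q0 0 b0 k f (D * harm_sum N powr recip q0)"
    by (rule besov_le_test_sum_zero[OF k q0 C(1) L(1), of b0]) blast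
  have "\<exists>N\<ge>M. harm_sum N powr recip q1 \<le> (A * D / l) * harm_sum N powr recip q0" for M
  proof -
    obtain N a where N: "M \<le> N" and a: "\<And>j. 0 \<le> a j" "\<And>j. a j \<le> (1 + real j) powr (- c)"
     "\<And>n. n \<le> N \<Longrightarrow> (\<Sum>j\<in>{n..N}. a j) \<le> L * (1 + real n) powr (- c)"
     "\<And>n. n \<le> N \<Longrightarrow> \<exists>i\<ge>n. i \<le> N \<and> l * (1 + real n) powr (- c) \<le> a i"
      using fam[of M] by auto
    obtain f where f: "test_sum C k a N f" using C(2)[of a N, OF a(1)] by blast
    have H: "0 < harm_sum N" using harm_sum_ge_1[of N] by simp
    have "besov_le q0 0 b0 k f (D * harm_sum N powr recip q0)"
      using a(2,3) unfolding c_def by (intro D(2)[OF a(1) f])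
    then have "besov_le q1 0 b1 k f (A * (D * harm_sum N powr recip q0))" using D H by (intro A(2)) auto
    then have lq: "lq_le (ennreal r) (\<lambda>n. wt 0 b1 n * omega k f n) (A * (D * harm_sum N powr recip q0))"
      by (simp add: besov_le_def r)
    have "l * harm_sum N powr recip (ennreal r) \<le> A * (D * harm_sum N powr recip q0)"
    proof (rule harm_sum_le_if_lq_le[OF r(1) L(2) _ lq])
      fix n assume n: "n \<le> N"
      then obtain i where i: "n \<le> i" "i \<le> N" "l * (1 + real n) powr (- c) \<le> a i" using a(4) by blast
      have "a i \<le> omega k f i" using f i by (simp add: test_sum_def)
      also have "\<dots> \<le> omega k f n" using f i decseqD[OF decseq_omega] by (auto simp: test_sum_def)
      finally have le: "l * (1 + real n) powr (- c) \<le> omega k f n" using i by simp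
      have "l * (1 + real n) powr (- recip (ennreal r)) = wt 0 b1 n * (l * (1 + real n) powr (- c))"
        unfolding wt_def c(2) r(2) by (simp add: mult.left_commute flip: powr_add)
      also have "\<dots> \<le> wt 0 b1 n * omega k f n" by (intro mult_left_mono le wt_nonneg)
      finally show "l * (1 + real n) powr (- recip (ennreal r)) \<le> wt 0 b1 n * omega k f n" .
    qed (use A D in auto)
    then have "harm_sum N powr recip q1 \<le> (A * D / l) * harm_sum N powr recip q0"
      using L by (simp add: r field_simps)
    then show ?thesis using N by blast
  qed
  then show False by (rule harm_sum_powr_contradiction[OF q])
qed

theorem continuously_embedded_iff_embedding_condition:
  assumes q: "0 < q0" "0 < q1" and s: "0 \<le> s0" "0 \<le> s1"
    and b: "s0 = 0 \<Longrightarrow> - recip q0 \<le> b0" "s1 = 0 \<Longrightarrow> - recip q1 \<le> b1"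
    and k: "s0 < real k0" "s1 < real k1"
    and bumps: "\<exists>B U S E h m. bump_family (max k0 k1) B U S E h m"
  shows "continuously_embedded (besov_set q0 s0 b0 k0) (besov_norm M p q0 s0 b0 k0)
      (besov_set q1 s1 b1 k1) (besov_norm M p q1 s1 b1 k1) \<longleftrightarrow> embedding_condition s0 b0 q0 s1 b1 q1"
proof -
  \<comment> \<open>One order above both smoothness parameters, so that the moduli on the two sides
    are the same sequence.\<close>
  define k where "k = max k0 k1"
  have sk: "s0 < real k" "s1 < real k" "0 < k" using k s by (auto simp: k_def)
  obtain C where C: "0 < C" "\<And>a N. (\<And>j. 0 \<le> a j) \<Longrightarrow> \<exists>f. test_sum C k a N f"
    using bumps ex_test_sums unfolding k_def by metis
  have "besov_bounded q0 s0 b0 k q1 s1 b1 k \<longleftrightarrow> embedding_condition s0 b0 q0 s1 b1 q1"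
  proof
    assume "embedding_condition s0 b0 q0 s1 b1 q1"
    then show "besov_bounded q0 s0 b0 k q1 s1 b1 k"
      by (intro besov_bounded_if_seq_embeds seq_embeds_if_condition q b)
  next
    assume bd: "besov_bounded q0 s0 b0 k q1 s1 b1 k"
    have le: "s1 \<le> s0"
      using not_besov_bounded_smoothness[OF q s(1) _ sk(2) C, of b0 b1] bd by (cases "s0 < s1") auto
    have pos: "embedding_condition s0 b0 q0 s1 b1 q1" if eq: "s0 = s1" "0 < s1"
    proof (cases "q0 \<le> q1")
      case True
      have "b1 \<le> b0"
        using not_besov_bounded_log_smoothness[OF q eq(2) sk(2) _ C, of b0 b1] bd eq by (cases "b0 < b1") auto
      then show ?thesis using True eq by (simp add: embedding_condition_def)
    next
      case False
      then have "b1 + recip q1 < b0 + recip q0"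
        using not_besov_bounded_weight[OF q(2) _ eq(2) sk(2) _ C, of q0 b0 b1] bd eq
        by (cases "b0 + recip q0 \<le> b1 + recip q1") auto
      then show ?thesis using False eq by (simp add: embedding_condition_def)
    qed
    have zero: "embedding_condition s0 b0 q0 s1 b1 q1" if eq: "s0 = 0" "s1 = 0"
    proof -
      have bb: "- recip q0 \<le> b0" "- recip q1 \<le> b1" using b eq by auto
      have "\<not> b0 + recip q0 < b1 + recip q1"
        using not_besov_bounded_zero_strict[OF q sk(3) bb _ C] bd eq by auto
      moreover have "q0 \<le> q1" if "b0 + recip q0 = b1 + recip q1"
        using not_besov_bounded_zero_eq[OF q(2) _ sk(3) bb(1) that C] bd eq by (cases "q1 < q0") auto
      ultimately show ?thesis using eq by (auto simp: embedding_condition_def)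
    qed
    consider "s1 < s0" | "s0 = s1" "0 < s1" | "s0 = 0" "s1 = 0" using le s by linarith
    then show "embedding_condition s0 b0 q0 s1 b1 q1"
      by cases (use pos zero in \<open>auto simp: embedding_condition_def\<close>)
  qed
  then show ?thesis
    using continuously_embedded_iff[OF q] besov_bounded_order_iff[OF q k sk(1,2)] by simp
qed

end

section \<open>Spline bumps\<close>

text \<open>The real counterpart of \<open>diff1\<close>: the bumps are real, and their differences
  are estimated in absolute value before the transfer by \<open>diff1_of_real\<close>.\<close>

definition rdiff :: "'a::plus \<Rightarrow> ('a \<Rightarrow> real) \<Rightarrow> 'a \<Rightarrow> real" where
  "rdiff h u = (\<lambda>x. u (x + h) - u x)"

lemma diff1_of_real: "(diff1 h ^^ k) (\<lambda>x. complex_of_real (u x)) = (\<lambda>x. complex_of_real ((rdiff h ^^ k) u x))"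
  by (induction k) (auto simp: diff1_def rdiff_def)

lemma rdiff_add: "(rdiff h ^^ n) (\<lambda>x. u x + v x) = (\<lambda>x. (rdiff h ^^ n) u x + (rdiff h ^^ n) v x)"
  by (induction n) (auto simp: rdiff_def)

lemma rdiff_shift:
  fixes h v :: "'a::ab_group_add"
  shows "(rdiff h ^^ n) (\<lambda>x. u (x + v)) = (\<lambda>x. (rdiff h ^^ n) u (x + v))"
  by (induction n) (auto simp: rdiff_def add_ac)

lemma rdiff_inner:
  "(rdiff h ^^ n) (\<lambda>x. u (x \<bullet> b)) = (\<lambda>x. (rdiff (h \<bullet> b) ^^ n) u (x \<bullet> b))"
  by (induction n) (auto simp: rdiff_def inner_add_left)

text \<open>The Leibniz rule: the difference of a product is a shifted first factor times a
  difference plus a difference times the second factor. Bounds uniform in x absorb the shift, and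
  the induction assembles (r + t)^n without binomial coefficients.\<close>

lemma rdiff_mult_bound:
  fixes h :: "'a::ab_group_add"
  assumes "0 \<le> r" "0 \<le> t" "0 \<le> A" "0 \<le> B"
    and "\<And>i x. i \<le> n \<Longrightarrow> \<bar>(rdiff h ^^ i) u x\<bar> \<le> A * r ^ i"
    and "\<And>i x. i \<le> n \<Longrightarrow> \<bar>(rdiff h ^^ i) v x\<bar> \<le> B * t ^ i"
  shows "\<bar>(rdiff h ^^ n) (\<lambda>x. u x * v x) x\<bar> \<le> A * B * (r + t) ^ n"
  using assms
proof (induction n arbitrary: u v A B x)
  case 0
  have "\<bar>u x\<bar> \<le> A" "\<bar>v x\<bar> \<le> B" using "0.prems"(5)[of 0 x] "0.prems"(6)[of 0 x] by auto
  then have "\<bar>u x\<bar> * \<bar>v x\<bar> \<le> A * B" using 0 by (intro mult_mono) auto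
  then show ?case by (simp add: abs_mult)
next
  case (Suc n)
  have eq: "rdiff h (\<lambda>x. u x * v x) = (\<lambda>x. u (x + h) * rdiff h v x + rdiff h u x * v x)"
    by (auto simp: rdiff_def algebra_simps)
  have u: "\<bar>(rdiff h ^^ i) (rdiff h u) x\<bar> \<le> (A * r) * r ^ i" if "i \<le> n" for i x
    using Suc.prems(5)[of "Suc i" x] that by (simp add: funpow_swap1 mult_ac)
  have v: "\<bar>(rdiff h ^^ i) (rdiff h v) x\<bar> \<le> (B * t) * t ^ i" if "i \<le> n" for i x
    using Suc.prems(6)[of "Suc i" x] that by (simp add: funpow_swap1 mult_ac)
  have u': "\<bar>(rdiff h ^^ i) (\<lambda>x. u (x + h)) x\<bar> \<le> A * r ^ i" if "i \<le> n" for i x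
    using Suc.prems(5)[of i "x + h"] that by (simp add: rdiff_shift)
  have 1: "\<bar>(rdiff h ^^ n) (\<lambda>x. u (x + h) * rdiff h v x) x\<bar> \<le> A * (B * t) * (r + t) ^ n"
    by (rule Suc.IH) (use Suc.prems u' v in auto)
  have 2: "\<bar>(rdiff h ^^ n) (\<lambda>x. rdiff h u x * v x) x\<bar> \<le> A * r * B * (r + t) ^ n"
    by (rule Suc.IH) (use Suc.prems u in auto)
  have "(rdiff h ^^ Suc n) (\<lambda>x. u x * v x) x =
      (rdiff h ^^ n) (\<lambda>x. u (x + h) * rdiff h v x) x + (rdiff h ^^ n) (\<lambda>x. rdiff h u x * v x) x"
    by (simp add: funpow_Suc_right eq rdiff_add del: funpow.simps)
  then have "\<bar>(rdiff h ^^ Suc n) (\<lambda>x. u x * v x) x\<bar> \<le> A * (B * t) * (r + t) ^ n + A * r * B * (r + t) ^ n"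
    using 1 2 by linarith
  also have "\<dots> = A * B * (r + t) ^ Suc n" by (simp add: algebra_simps)
  finally show ?case .
qed

lemma rdiff_prod_bound:
  fixes h :: "'a::ab_group_add"
  assumes "finite F" "0 \<le> r"
    and "\<And>b i x. b \<in> F \<Longrightarrow> i \<le> n \<Longrightarrow> \<bar>(rdiff h ^^ i) (u b) x\<bar> \<le> r ^ i"
  shows "i \<le> n \<Longrightarrow> \<bar>(rdiff h ^^ i) (\<lambda>x. \<Prod>b\<in>F. u b x) x\<bar> \<le> (real (card F) * r) ^ i"
  using assms
proof (induction F arbitrary: i x rule: finite_induct)
  case empty
  have "(rdiff h ^^ i) (\<lambda>x. 1) = (\<lambda>x. if i = 0 then 1 else 0)"
    by (induction i) (auto simp: rdiff_def)
  then show ?case by simp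
next
  case (insert c F)
  have "\<bar>(rdiff h ^^ i) (\<lambda>x. u c x * (\<Prod>b\<in>F. u b x)) x\<bar> \<le> 1 * 1 * (r + real (card F) * r) ^ i"
  proof (rule rdiff_mult_bound)
    fix j x assume "j \<le> i"
    then have "j \<le> n" using insert by simp
    then show "\<bar>(rdiff h ^^ j) (u c) x\<bar> \<le> 1 * r ^ j" "\<bar>(rdiff h ^^ j) (\<lambda>x. \<Prod>b\<in>F. u b x) x\<bar> \<le> 1 * (real (card F) * r) ^ j"
      using insert by auto
  qed (use insert in auto)
  then show ?case using insert by (simp add: distrib_right)
qed

text \<open>For d > 0 the mean of \<open>u\<close> over [x - d, x], rescaled to the unit interval.
  It looks only to the left of x, so averaging never spreads a support to the left; this keeps the
  bumps on one side of the hyperplane.\<close>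

definition avg :: "real \<Rightarrow> (real \<Rightarrow> real) \<Rightarrow> real \<Rightarrow> real" where
  "avg d u x = (\<integral>y. indicator {0..1} y * u (x - d * y) \<partial>lborel)"

text \<open>The shift \<open>c\<close> in the indicator is for the change of variables in the
  Lipschitz estimate.\<close>

lemma avg_integrable:
  fixes u :: "real \<Rightarrow> real"
  assumes [measurable]: "u \<in> borel_measurable borel" and "\<And>x. \<bar>u x\<bar> \<le> K"
  shows "integrable lborel (\<lambda>y::real. indicator {0..1} (c + y) * u (x - d * y))"
proof (rule integrableI_bounded_set[where A = "{- c..1 - c}" and B = K])
  show "AE y in lborel. y \<in> {- c..1 - c} \<longrightarrow> norm (indicator {0..1} (c + y) * u (x - d * y)) \<le> K"
    using assms(2) order_trans[OF abs_ge_zero assms(2)] by (auto simp: indicator_def abs_mult)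
qed (auto simp: indicator_def)

lemma avg_measurable:
  assumes [measurable]: "u \<in> borel_measurable borel"
  shows "avg d u \<in> borel_measurable borel"
proof -
  have "(\<lambda>x. \<integral>y. indicator {0..1} y * u (x - d * y) \<partial>lborel) \<in> borel_measurable borel" by measurable
  then show ?thesis by (simp add: avg_def[abs_def])
qed

lemma avg_const_on:
  assumes "\<And>y. 0 \<le> y \<Longrightarrow> y \<le> 1 \<Longrightarrow> u (x - d * y) = c"
  shows "avg d u x = c"
proof -
  have "avg d u x = (\<integral>y. indicator {0..1::real} y * c \<partial>lborel)"
    unfolding avg_def using assms by (intro Bochner_Integration.integral_cong) (auto simp: indicator_def)
  then show ?thesis by simp
qed

lemma avg_mono:
  assumes "u \<in> borel_measurable borel" "\<And>x. \<bar>u x\<bar> \<le> K" "v \<in> borel_measurable borel" "\<And>x. \<bar>v x\<bar> \<le> L"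
    "\<And>x. u x \<le> v x"
  shows "avg d u x \<le> avg d v x"
  unfolding avg_def
  using avg_integrable[OF assms(1,2), of 0 x d] avg_integrable[OF assms(3,4), of 0 x d] assms(5)
  by (intro integral_mono) (auto simp: mult_left_mono)

lemma avg_rdiff:
  assumes "u \<in> borel_measurable borel" "\<And>x. \<bar>u x\<bar> \<le> K"
  shows "rdiff h (avg d u) = avg d (rdiff h u)"
proof
  fix x
  have "rdiff h (avg d u) x = (\<integral>y. indicator {0..1} y * u (x + h - d * y) \<partial>lborel) - (\<integral>y. indicator {0..1} y * u (x - d * y) \<partial>lborel)"
    by (simp add: rdiff_def avg_def)
  also have "\<dots> = (\<integral>y. indicator {0..1} y * u (x + h - d * y) - indicator {0..1} y * u (x - d * y) \<partial>lborel)"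
    using avg_integrable[OF assms, of 0 "x + h" d] avg_integrable[OF assms, of 0 x d]
    by (intro Bochner_Integration.integral_diff[symmetric]) auto
  also have "\<dots> = avg d (rdiff h u) x"
    unfolding avg_def rdiff_def by (intro Bochner_Integration.integral_cong refl) (simp add: algebra_simps)
  finally show "rdiff h (avg d u) x = avg d (rdiff h u) x" .
qed

text \<open>The increment is moved from \<open>u\<close> to the window of integration, so only
  boundedness of \<open>u\<close> is used: the bound is the measure of the symmetric difference of
  two windows.\<close>

lemma avg_lipschitz:
  assumes u: "u \<in> borel_measurable borel" "\<And>x. \<bar>u x\<bar> \<le> K" and d: "0 < d"
  shows "\<bar>rdiff h (avg d u) x\<bar> \<le> 4 * \<bar>h\<bar> / d * K"
proof -
  define c where "c = h / d"
  have K: "0 \<le> K" using order_trans[OF abs_ge_zero u(2)] .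
  have "avg d u (x + h) = (\<integral>y. indicator {0..1} (c + y) * u (x + h - d * (c + y)) \<partial>lborel)"
    unfolding avg_def by (subst lborel_integral_real_affine[where c = 1 and t = c]) auto
  also have "\<dots> = (\<integral>y. indicator {0..1} (c + y) * u (x - d * y) \<partial>lborel)"
    using d by (simp add: c_def algebra_simps)
  finally have "rdiff h (avg d u) x = (\<integral>y. indicator {0..1} (c + y) * u (x - d * y) \<partial>lborel) - (\<integral>y. indicator {0..1} (0 + y) * u (x - d * y) \<partial>lborel)"
    by (simp add: rdiff_def avg_def)
  also have "\<dots> = (\<integral>y. indicator {0..1} (c + y) * u (x - d * y) - indicator {0..1} (0 + y) * u (x - d * y) \<partial>lborel)"
    by (intro Bochner_Integration.integral_diff[symmetric] avg_integrable[OF u])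
  finally have "\<bar>rdiff h (avg d u) x\<bar> \<le> (\<integral>y. \<bar>indicator {0..1} (c + y) * u (x - d * y) - indicator {0..1} (0 + y) * u (x - d * y)\<bar> \<partial>lborel)"
    using integral_norm_bound[of lborel "\<lambda>y. indicator {0..1} (c + y) * u (x - d * y) - indicator {0..1} (0 + y) * u (x - d * y)"] by simp
  also have "\<dots> \<le> (\<integral>y. (indicator {- \<bar>c\<bar>..\<bar>c\<bar>} y + indicator {1 - \<bar>c\<bar>..1 + \<bar>c\<bar>} y) * K \<partial>lborel)"
  proof (rule integral_mono)
    show "integrable lborel (\<lambda>y. \<bar>indicator {0..1} (c + y) * u (x - d * y) - indicator {0..1} (0 + y) * u (x - d * y)\<bar>)"
      by (intro integrable_abs Bochner_Integration.integrable_diff avg_integrable[OF u])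
    show "integrable lborel (\<lambda>y::real. (indicator {- \<bar>c\<bar>..\<bar>c\<bar>} y + indicator {1 - \<bar>c\<bar>..1 + \<bar>c\<bar>} y) * K)"
      by (intro integrable_mult_left Bochner_Integration.integrable_add) auto
    fix y :: real
    have "\<bar>indicator {0..1} (c + y) * u (x - d * y) - indicator {0..1} (0 + y) * u (x - d * y)\<bar> =
      \<bar>indicator {0..1} (c + y) - indicator {0..1} y\<bar> * \<bar>u (x - d * y)\<bar>"
      unfolding abs_mult[symmetric] by (simp add: algebra_simps)
    \<comment> \<open>Two unit intervals shifted by c differ only within distance |c| of the
      endpoints 0 and 1; two intervals of length 2 |c| give the constant 4.\<close>
    also have "\<dots> \<le> (indicator {- \<bar>c\<bar>..\<bar>c\<bar>} y + indicator {1 - \<bar>c\<bar>..1 + \<bar>c\<bar>} y) * K"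
    proof (rule mult_mono)
      show "\<bar>indicator {0..1} (c + y) - indicator {0..1} y :: real\<bar> \<le> indicator {- \<bar>c\<bar>..\<bar>c\<bar>} y + indicator {1 - \<bar>c\<bar>..1 + \<bar>c\<bar>} y"
        by (auto simp: indicator_def)
    qed (use u in auto)
    finally show "\<bar>indicator {0..1} (c + y) * u (x - d * y) - indicator {0..1} (0 + y) * u (x - d * y)\<bar> \<le> (indicator {- \<bar>c\<bar>..\<bar>c\<bar>} y + indicator {1 - \<bar>c\<bar>..1 + \<bar>c\<bar>} y) * K" .
  qed
  also have "\<dots> = 4 * \<bar>c\<bar> * K"
    by (simp add: Bochner_Integration.integral_add)
  also have "\<dots> = 4 * \<bar>h\<bar> / d * K" using d by (simp add: c_def)
  finally show ?thesis .
qed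

lemma avg_bound:
  assumes u: "u \<in> borel_measurable borel" "\<And>x. \<bar>u x\<bar> \<le> K"
  shows "\<bar>avg d u x\<bar> \<le> K"
proof -
  have K: "0 \<le> K" using order_trans[OF abs_ge_zero u(2)] .
  have b: "\<bar>- K\<bar> \<le> K" "\<bar>K\<bar> \<le> K" using K by auto
  have "avg d (\<lambda>_. - K) x \<le> avg d u x" "avg d u x \<le> avg d (\<lambda>_. K) x"
    by (rule avg_mono[OF _ b(1) u] avg_mono[OF u _ b(2)]; use u in \<open>auto simp: abs_le_iff minus_le_iff\<close>)+
  then show ?thesis by (simp add: avg_const_on[of "\<lambda>_. K" x d K] avg_const_on[of "\<lambda>_. - K" x d "- K"] abs_le_iff)
qed

lemma avg_iter:
  assumes u: "u \<in> borel_measurable borel" "\<And>x. \<bar>u x\<bar> \<le> K"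
  shows "(avg d ^^ m) u \<in> borel_measurable borel" "\<bar>(avg d ^^ m) u x\<bar> \<le> K"
proof -
  have "(avg d ^^ m) u \<in> borel_measurable borel \<and> (\<forall>x. \<bar>(avg d ^^ m) u x\<bar> \<le> K)"
    by (induction m) (auto simp: u avg_measurable intro!: avg_bound)
  then show "(avg d ^^ m) u \<in> borel_measurable borel" "\<bar>(avg d ^^ m) u x\<bar> \<le> K" by auto
qed

lemma rdiff_bounded_measurable:
  fixes u :: "real \<Rightarrow> real"
  assumes "u \<in> borel_measurable borel" "\<And>x. \<bar>u x\<bar> \<le> K"
  shows "rdiff h u \<in> borel_measurable borel" "\<bar>rdiff h u x\<bar> \<le> 2 * K"
proof -
  note assms(1)[measurable]
  show "rdiff h u \<in> borel_measurable borel" unfolding rdiff_def by measurable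
  show "\<bar>rdiff h u x\<bar> \<le> 2 * K" unfolding rdiff_def using assms(2)[of x] assms(2)[of "x + h"] by linarith
qed

lemma avg_iter_rdiff:
  assumes "u \<in> borel_measurable borel" "\<And>x. \<bar>u x\<bar> \<le> K"
  shows "rdiff h ((avg d ^^ m) u) = (avg d ^^ m) (rdiff h u)"
proof (induction m)
  case (Suc m)
  have "rdiff h (avg d ((avg d ^^ m) u)) = avg d (rdiff h ((avg d ^^ m) u))"
    by (rule avg_rdiff[OF avg_iter[OF assms]])
  then show ?case using Suc by simp
qed simp

text \<open>Each averaging gains one order of smoothness.\<close>

lemma rdiff_avg_iter_bound:
  assumes "0 < d" "u \<in> borel_measurable borel" "\<And>x. \<bar>u x\<bar> \<le> K"
  shows "\<bar>(rdiff h ^^ i) ((avg d ^^ i) u) x\<bar> \<le> (4 * \<bar>h\<bar> / d) ^ i * K"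
  using assms(2,3)
proof (induction i arbitrary: u K)
  case (Suc i)
  have v: "avg d u \<in> borel_measurable borel" "\<And>x. \<bar>avg d u x\<bar> \<le> K"
    using avg_iter[OF Suc.prems, where m = 1] by auto
  have "\<bar>(rdiff h ^^ i) ((avg d ^^ i) (rdiff h (avg d u))) x\<bar> \<le> (4 * \<bar>h\<bar> / d) ^ i * (4 * \<bar>h\<bar> / d * K)"
    by (rule Suc.IH[OF rdiff_bounded_measurable(1)[OF v] avg_lipschitz[OF Suc.prems assms(1)]])
  moreover have "(rdiff h ^^ Suc i) ((avg d ^^ Suc i) u) = (rdiff h ^^ i) ((avg d ^^ i) (rdiff h (avg d u)))"
    unfolding funpow_Suc_right o_apply avg_iter_rdiff[OF v] ..
  ultimately show ?case by (simp add: mult_ac)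
qed simp

text \<open>The indicator convolved \<open>k\<close> times with the uniform density on [0, d]: as
  many averagings as the order of the difference to be controlled.\<close>

definition spline :: "nat \<Rightarrow> real \<Rightarrow> real set \<Rightarrow> real \<Rightarrow> real" where
  "spline k d A = (avg d ^^ k) (indicator A)"

lemma indicator_abs_le_1: "\<bar>indicator A x :: real\<bar> \<le> 1"
  by (simp add: indicator_def)

lemma spline_measurable: "A \<in> sets borel \<Longrightarrow> spline k d A \<in> borel_measurable borel"
  unfolding spline_def by (rule avg_iter[OF _ indicator_abs_le_1]) auto

lemma spline_bounds:
  assumes "A \<in> sets borel"
  shows "0 \<le> spline k d A x" "spline k d A x \<le> 1"
proof -
  have ind: "indicator A \<in> borel_measurable borel" using assms by simp
  show "spline k d A x \<le> 1"
    using avg_iter(2)[OF ind indicator_abs_le_1, of k d x] by (simp add: spline_def abs_le_iff)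
  have "0 \<le> (avg d ^^ k) (indicator A) x" for x
  proof (induction k arbitrary: x)
    case (Suc k)
    have "avg d (\<lambda>_. 0) x \<le> avg d ((avg d ^^ k) (indicator A)) x"
      by (rule avg_mono[OF _ _ avg_iter[OF ind indicator_abs_le_1], of _ 0]) (use Suc in auto)
    then show ?case by (simp add: avg_const_on[of "\<lambda>_. 0" x d 0])
  qed simp
  then show "0 \<le> spline k d A x" by (simp add: spline_def)
qed

lemma spline_rdiff_bound:
  assumes "0 < d" "A \<in> sets borel" "i \<le> k"
  shows "\<bar>(rdiff h ^^ i) (spline k d A) x\<bar> \<le> (4 * \<bar>h\<bar> / d) ^ i"
proof -
  have ind: "indicator A \<in> borel_measurable borel" using assms by simp
  have "spline k d A = (avg d ^^ i) ((avg d ^^ (k - i)) (indicator A))"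
    unfolding spline_def using assms(3) funpow_add[of i "k - i" "avg d"] by simp
  then show ?thesis
    using rdiff_avg_iter_bound[OF assms(1) avg_iter[OF ind indicator_abs_le_1], where h = h and i = i and x = x] by simp
qed

text \<open>Each averaging looks back by at most \<open>d\<close>, so the k-fold average at x
  depends only on the window of length k d to the left of x.\<close>

lemma avg_iter_const_on:
  assumes "0 < d" "\<And>y. x - real k * d \<le> y \<Longrightarrow> y \<le> x \<Longrightarrow> u y = c"
  shows "(avg d ^^ k) u x = c"
  using assms(2)
proof (induction k arbitrary: x)
  case (Suc k)
  have "avg d ((avg d ^^ k) u) x = c"
  proof (rule avg_const_on)
    fix y :: real assume y: "0 \<le> y" "y \<le> 1"
    have dy: "0 \<le> d * y" "d * y \<le> d" using y assms(1) by (auto simp: mult_left_le)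
    show "(avg d ^^ k) u (x - d * y) = c"
    proof (rule Suc.IH)
      fix z assume "x - d * y - real k * d \<le> z" "z \<le> x - d * y"
      then show "u z = c" using dy by (intro Suc.prems) (auto simp: algebra_simps)
    qed
  qed
  then show ?case by simp
qed (use assms in auto)

lemma spline_eq_1: "0 < d \<Longrightarrow> {x - real k * d..x} \<subseteq> A \<Longrightarrow> spline k d A x = 1"
  unfolding spline_def by (intro avg_iter_const_on) (auto simp: indicator_def)

lemma spline_eq_0: "0 < d \<Longrightarrow> {x - real k * d..x} \<inter> A = {} \<Longrightarrow> spline k d A x = 0"
  unfolding spline_def by (intro avg_iter_const_on) (auto simp: indicator_def disjoint_iff)

lemma spline_periodic:
  assumes "\<And>x. x + c \<in> A \<longleftrightarrow> x \<in> A"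
  shows "spline k d A (x + c) = spline k d A x"
proof -
  have "(avg d ^^ k) (indicator A) (x + c) = (avg d ^^ k) (indicator A) x" for x
  proof (induction k arbitrary: x)
    case 0
    then show ?case using assms by (simp add: indicator_def)
  next
    case (Suc k)
    have "(avg d ^^ k) (indicator A) (x + c - d * y) = (avg d ^^ k) (indicator A) (x - d * y)" for y
      using Suc[of "x - d * y"] by (simp add: algebra_simps)
    then show ?case unfolding funpow.simps o_apply avg_def[of d "(avg d ^^ k) (indicator A)"] by simp
  qed
  then show ?thesis by (simp add: spline_def)
qed

section \<open>The Euclidean space and the circle\<close>

lemma nn_integral_translate:
  fixes g :: "'a::euclidean_space \<Rightarrow> ennreal"
  assumes [measurable]: "g \<in> borel_measurable borel"
  shows "(\<integral>\<^sup>+x. g (x + h) \<partial>lborel) = (\<integral>\<^sup>+x. g x \<partial>lborel)"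
proof -
  have "(\<integral>\<^sup>+x. g x \<partial>lborel) = (\<integral>\<^sup>+x. g x \<partial>density (distr lborel borel (\<lambda>x. h + 1 *\<^sub>R x)) (\<lambda>_. \<bar>1::real\<bar> ^ DIM('a)))"
    using lborel_affine[of "1::real" h] by simp
  also have "\<dots> = (\<integral>\<^sup>+x. g (x + h) \<partial>lborel)"
    by (simp add: nn_integral_density nn_integral_distr add.commute)
  finally show ?thesis ..
qed

lemma shift_invariant_Lp_Rd:
  assumes "1 < p"
  shows "shift_invariant_Lp (lborel :: 'a::euclidean_space measure) (borel_measurable lborel) p"
proof
  fix f :: "'a \<Rightarrow> complex" and h :: 'a
  assume f: "f \<in> borel_measurable lborel"
  note f[measurable]
  show "(\<lambda>x. f (x + h)) \<in> borel_measurable lborel" by measurable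
  show "Lp_norm lborel p (\<lambda>x. f (x + h)) = Lp_norm lborel p f"
    unfolding Lp_norm_def using nn_integral_translate[of "\<lambda>x. ennreal (norm (f x) powr p)" h] by simp
qed (use assms in auto)

lemma Lp_norm_indicator:
  assumes "S \<in> sets M" "0 < p" "emeasure M S = ennreal v" "0 \<le> v"
  shows "Lp_norm M p (indicator S) = ennreal (v powr (1 / p))"
proof -
  have "(\<integral>\<^sup>+x. ennreal (norm (indicator S x :: complex) powr p) \<partial>M) = (\<integral>\<^sup>+x. indicator S x \<partial>M)"
    using assms(2) by (intro nn_integral_cong) (auto simp: indicator_def)
  then show ?thesis unfolding Lp_norm_def using assms by (simp add: epowr_ennreal)
qed

text \<open>Products of one-dimensional splines. With A = [0, (k + 1) d], the windows of length k d
  give the support [0, (2 k + 1) d] and a plateau of length d, so support and plateau have measures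
  of the same order d^D.\<close>

lemma bump_family_Rd:
  assumes p: "1 < p" and k: "0 < k"
  shows "\<exists>B U S E h m. shift_invariant_Lp.bump_family (lborel :: 'a::euclidean_space measure) (borel_measurable lborel) p k B U S E h m"
proof -
  interpret shift_invariant_Lp "lborel :: 'a measure" "borel_measurable lborel" p
    by (rule shift_invariant_Lp_Rd[OF p])
  define D where "D = DIM('a)"
  \<comment> \<open>The ratio of the side of the support to the side of the plateau.\<close>
  define w :: real where "w = 2 * real k + 1"
  have w: "1 \<le> w" by (simp add: w_def)
  define d :: "nat \<Rightarrow> real" where "d n = 2 powr (- real n) / w" for n
  have d: "0 < d n" for n using w by (simp add: d_def)
  define A where "A n = {0..(real k + 1) * d n}" for n
  have A: "A n \<in> sets borel" for n by (simp add: A_def)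
  define U where "U n x = (\<Prod>b\<in>Basis. spline k (d n) (A n) (x \<bullet> b))" for n and x :: 'a
  define S :: "nat \<Rightarrow> 'a set" where "S n = cbox 0 ((w * d n) *\<^sub>R One)" for n
  define E :: "nat \<Rightarrow> 'a set" where "E n = cbox ((real k * d n) *\<^sub>R One) (((real k + 1) * d n) *\<^sub>R One)" for n
  obtain e :: 'a where e: "e \<in> Basis" using nonempty_Basis by blast
  \<comment> \<open>A step of length w d = 2^(-n) along one axis takes the plateau into the
    half-space of negative coordinates, where the bumps of all scales vanish.\<close>
  define h :: "nat \<Rightarrow> 'a" where "h n = - (w * d n) *\<^sub>R e" for n
  define m :: "nat \<Rightarrow> real" where "m n = d n ^ D" for n
  \<comment> \<open>The first summand is the smoothness constant of a product of D splines, the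
    second the quotient of the measures of \<open>S n\<close> and \<open>E n\<close>.\<close>
  define B where "B = real D * 4 * w + w ^ D"
  have wD: "1 \<le> w ^ D" using w by (rule one_le_power)
  have B: "0 < B" "real D * 4 * w \<le> B" "w ^ D \<le> B"
  proof -
    have "0 \<le> real D * 4 * w" using w by simp
    with wD show "0 < B" "real D * 4 * w \<le> B" "w ^ D \<le> B" unfolding B_def by linarith+
  qed
  have spline_neg: "spline k (d n) (A n) x = 0" if "x < 0" for n x
    using that d[of n] by (intro spline_eq_0) (auto simp: A_def)
  have spline_large: "spline k (d n) (A n) x = 0" if "w * d n < x" for n x
    using that d[of n] by (intro spline_eq_0) (auto simp: A_def w_def algebra_simps)
  have spline_one: "spline k (d n) (A n) x = 1" if "real k * d n \<le> x" "x \<le> (real k + 1) * d n" for n x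
    using that d[of n] by (intro spline_eq_1) (auto simp: A_def)
  have "bump_family k B U S E h m"
    unfolding bump_family_def
  proof (intro conjI allI B(1))
    fix n
    have "U n \<in> borel_measurable borel"
    proof -
      have [measurable]: "spline k (d n) (A n) \<in> borel_measurable borel" by (rule spline_measurable[OF A])
      show ?thesis unfolding U_def[abs_def] by measurable
    qed
    then show "(\<lambda>x. complex_of_real (U n x)) \<in> borel_measurable lborel" by simp
    show "(\<lambda>x. indicator (S n) x :: complex) \<in> borel_measurable lborel" by (simp add: S_def)
    show "0 < m n" using d by (simp add: m_def)
    show "E n \<in> sets lborel" by (simp add: E_def)
    have one: "((c::real) *\<^sub>R (One::'a)) \<bullet> b = c" if "b \<in> Basis" for b c
      using that by (simp add: inner_Basis inner_sum_left sum.delta)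
    have "emeasure lborel (S n) = ennreal ((w * d n) ^ D)"
      unfolding S_def D_def using w d[of n] by (subst emeasure_lborel_cbox) (auto simp: one)
    then have "Lp_norm lborel p (indicator (S n) :: 'a \<Rightarrow> complex) = ennreal (((w * d n) ^ D) powr (1 / p))"
      using p w d[of n] by (intro Lp_norm_indicator) (auto simp: S_def)
    also have "((w * d n) ^ D) powr (1 / p) = (w ^ D) powr (1 / p) * m n powr (1 / p)"
      using w d[of n] by (simp add: m_def power_mult_distrib powr_mult)
    also have "\<dots> \<le> B * m n powr (1 / p)"
    proof (rule mult_right_mono)
      have "(w ^ D) powr (1 / p) \<le> (w ^ D) powr 1" using p wD by (intro powr_mono) auto
      then show "(w ^ D) powr (1 / p) \<le> B" using wD B by simp
    qed simp
    finally show "Lp_norm lborel p (indicator (S n) :: 'a \<Rightarrow> complex) \<le> ennreal (B * m n powr (1 / p))"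
      by (simp add: ennreal_leI)
    have "emeasure lborel (E n) = ennreal (m n)"
      unfolding E_def D_def m_def using d[of n]
      by (subst emeasure_lborel_cbox) (auto simp: one inner_diff_left algebra_simps)
    then show "ennreal (m n) \<le> emeasure lborel (E n)" by simp
    show "norm (h n) \<le> 2 powr (- real n)" using w e by (simp add: h_def d_def)
    fix x :: 'a
    show "0 \<le> U n x" "U n x \<le> 1" unfolding U_def
      by (auto intro!: prod_nonneg prod_le_1 spline_bounds[OF A])
    show "x \<notin> S n \<longrightarrow> U n x = 0"
    proof
      assume "x \<notin> S n"
      then obtain b :: 'a where b: "b \<in> Basis" "x \<bullet> b < 0 \<or> w * d n < x \<bullet> b"
        by (auto simp: S_def mem_box one not_le)
      then have "spline k (d n) (A n) (x \<bullet> b) = 0" using spline_neg spline_large by blast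
      then show "U n x = 0" unfolding U_def using b by (intro prod_zero) auto
    qed
    fix v :: 'a
    have "\<bar>(rdiff v ^^ k) (U n) x\<bar> \<le> (real (card (Basis :: 'a set)) * (4 * norm v / d n)) ^ k"
      unfolding U_def[abs_def]
    proof (rule rdiff_prod_bound)
      fix b :: 'a and i x assume b: "b \<in> Basis" "i \<le> k"
      have "\<bar>(rdiff v ^^ i) (\<lambda>x. spline k (d n) (A n) (x \<bullet> b)) x\<bar> \<le> (4 * \<bar>v \<bullet> b\<bar> / d n) ^ i"
        unfolding rdiff_inner by (rule spline_rdiff_bound[OF d A b(2)])
      also have "\<dots> \<le> (4 * norm v / d n) ^ i"
        using d[of n] Basis_le_norm[OF b(1), of v] by (intro power_mono divide_right_mono) auto
      finally show "\<bar>(rdiff v ^^ i) (\<lambda>x. spline k (d n) (A n) (x \<bullet> b)) x\<bar> \<le> (4 * norm v / d n) ^ i" .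
    qed (use d[of n] in auto)
    also have "real (card (Basis :: 'a set)) * (4 * norm v / d n) = (real D * 4 * w) * 2 powr real n * norm v"
      using w by (simp add: D_def d_def powr_minus field_simps)
    also have "(\<dots>) ^ k \<le> (B * 2 powr real n * norm v) ^ k"
      using B w by (intro power_mono mult_right_mono) auto
    finally show "norm ((diff1 v ^^ k) (\<lambda>x. complex_of_real (U n x)) x) \<le> (B * 2 powr real n * norm v) ^ k"
      unfolding diff1_of_real by simp
  next
    fix n
    have one: "((c::real) *\<^sub>R (One::'a)) \<bullet> b = c" if "b \<in> Basis" for b c
      using that by (simp add: inner_Basis inner_sum_left sum.delta)
    show "\<forall>x\<in>E n. U n x = 1"
      unfolding U_def by (auto simp: E_def mem_box one intro!: prod.neutral spline_one)
    show "\<forall>x\<in>E n. \<forall>i j. 1 \<le> i \<longrightarrow> i \<le> k \<longrightarrow> U j (x + real i *\<^sub>R h n) = 0"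
    proof (intro ballI allI impI)
      fix x i j assume x: "x \<in> E n" and i: "1 \<le> i" "i \<le> k"
      have "x \<bullet> e \<le> (real k + 1) * d n" using x e by (auto simp: E_def mem_box one)
      moreover have "1 * (w * d n) \<le> real i * (w * d n)" using i w d[of n] by (intro mult_right_mono) auto
      moreover have "(x + real i *\<^sub>R h n) \<bullet> e = x \<bullet> e - real i * (w * d n)"
        using e by (simp add: h_def inner_add_left inner_diff_left inner_Basis)
      moreover have "(real k + 1) * d n < w * d n"
        using k d[of n] by (intro mult_strict_right_mono) (auto simp: w_def)
      ultimately have "(x + real i *\<^sub>R h n) \<bullet> e < 0" by linarith
      then have "spline k (d j) (A j) ((x + real i *\<^sub>R h n) \<bullet> e) = 0" by (rule spline_neg)
      then show "U j (x + real i *\<^sub>R h n) = 0" unfolding U_def using e by (intro prod_zero) auto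
    qed
  qed
  then show ?thesis by blast
qed

section \<open>Periodic functions on the circle\<close>

lemma periodic_int:
  assumes "\<And>x::real. g (x + 2 * pi) = g x"
  shows "g (x + 2 * pi * of_int j) = g x"
proof (induction j rule: int_induct[where k = 0])
  case (step1 i)
  then show ?case using assms[of "x + 2 * pi * of_int i"] by (simp add: algebra_simps)
next
  case (step2 i)
  then show ?case using assms[of "x + 2 * pi * of_int (i - 1)"] by (simp add: algebra_simps)
qed simp

lemma nn_integral_circle:
  "(\<integral>\<^sup>+x. g x \<partial>circle_measure) = (\<integral>\<^sup>+x. g x * indicator {0..<2 * pi} x \<partial>lborel)"
  unfolding circle_measure_def by (subst nn_integral_restrict_space) auto

text \<open>For 0 <= h < 2 pi the shifted period is cut at 2 pi and its second part moved back by
  one period; any other h is reduced modulo 2 pi.\<close>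

lemma nn_integral_circle_translate:
  fixes g :: "real \<Rightarrow> ennreal"
  assumes [measurable]: "g \<in> borel_measurable borel" and per: "\<And>x. g (x + 2 * pi) = g x"
  shows "(\<integral>\<^sup>+x. g (x + h) \<partial>circle_measure) = (\<integral>\<^sup>+x. g x \<partial>circle_measure)"
proof -
  have *: "(\<integral>\<^sup>+x. g (x + h) \<partial>circle_measure) = (\<integral>\<^sup>+x. g x \<partial>circle_measure)" if h: "0 \<le> h" "h < 2 * pi" for h
  proof -
    have "(\<integral>\<^sup>+x. g (x + h) \<partial>circle_measure) = (\<integral>\<^sup>+x. g (x + h) * indicator {h..<h + 2 * pi} (x + h) \<partial>lborel)"
      unfolding nn_integral_circle by (intro nn_integral_cong) (auto simp: indicator_def)
    also have "\<dots> = (\<integral>\<^sup>+x. g x * indicator {h..<h + 2 * pi} x \<partial>lborel)"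
      by (rule nn_integral_translate) measurable
    also have "\<dots> = (\<integral>\<^sup>+x. g x * indicator {h..<2 * pi} x + g x * indicator {2 * pi..<h + 2 * pi} x \<partial>lborel)"
      using h by (intro nn_integral_cong) (auto simp: indicator_def)
    also have "\<dots> = (\<integral>\<^sup>+x. g x * indicator {h..<2 * pi} x \<partial>lborel) + (\<integral>\<^sup>+x. g x * indicator {2 * pi..<h + 2 * pi} x \<partial>lborel)"
      by (intro nn_integral_add) auto
    also have "(\<integral>\<^sup>+x. g x * indicator {2 * pi..<h + 2 * pi} x \<partial>lborel) =
        (\<integral>\<^sup>+x. g (x + 2 * pi) * indicator {2 * pi..<h + 2 * pi} (x + 2 * pi) \<partial>lborel)"
      by (rule nn_integral_translate[symmetric]) measurable
    also have "\<dots> = (\<integral>\<^sup>+x. g x * indicator {0..<h} x \<partial>lborel)"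
      by (intro nn_integral_cong) (auto simp: per indicator_def)
    also have "(\<integral>\<^sup>+x. g x * indicator {h..<2 * pi} x \<partial>lborel) + (\<integral>\<^sup>+x. g x * indicator {0..<h} x \<partial>lborel) =
        (\<integral>\<^sup>+x. g x * indicator {h..<2 * pi} x + g x * indicator {0..<h} x \<partial>lborel)"
      by (intro nn_integral_add[symmetric]) auto
    also have "\<dots> = (\<integral>\<^sup>+x. g x \<partial>circle_measure)"
      unfolding nn_integral_circle using h by (intro nn_integral_cong) (auto simp: indicator_def)
    finally show ?thesis .
  qed
  define j where "j = \<lfloor>h / (2 * pi)\<rfloor>"
  define h' where "h' = h - 2 * pi * of_int j"
  have "of_int j \<le> h / (2 * pi)" "h / (2 * pi) < of_int j + 1" unfolding j_def by linarith+
  then have "0 \<le> h'" "h' < 2 * pi" unfolding h'_def by (simp_all add: field_simps)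
  from *[OF this] have "(\<integral>\<^sup>+x. g (x + h') \<partial>circle_measure) = (\<integral>\<^sup>+x. g x \<partial>circle_measure)" .
  moreover have "g (x + h') = g (x + h)" for x
    using periodic_int[of g "x + h'" j, OF per] by (simp add: h'_def algebra_simps)
  ultimately show ?thesis by simp
qed

definition periodic_borel :: "(real \<Rightarrow> complex) set" where
  "periodic_borel = {f \<in> borel_measurable lborel. \<forall>x. f (x + 2 * pi) = f x}"

lemma shift_invariant_Lp_T:
  assumes "1 < p"
  shows "shift_invariant_Lp circle_measure periodic_borel p"
proof
  fix f :: "real \<Rightarrow> complex" and h :: real
  assume f: "f \<in> periodic_borel"
  have m[measurable]: "f \<in> borel_measurable borel" and per: "\<And>x. f (x + 2 * pi) = f x"
    using f by (auto simp: periodic_borel_def)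
  show "f \<in> borel_measurable circle_measure"
    unfolding circle_measure_def by (rule measurable_restrict_space1) simp
  have "f (x + 2 * pi + h) = f (x + h)" for x using per[of "x + h"] by (simp add: add_ac)
  then show "(\<lambda>x. f (x + h)) \<in> periodic_borel" unfolding periodic_borel_def by simp
  show "Lp_norm circle_measure p (\<lambda>x. f (x + h)) = Lp_norm circle_measure p f"
    unfolding Lp_norm_def using nn_integral_circle_translate[of "\<lambda>x. ennreal (norm (f x) powr p)" h] per by simp
qed (use assms in \<open>auto simp: periodic_borel_def\<close>)

text \<open>The one-dimensional construction, periodized. The new danger is that a step to the left
  wraps around and meets the support again; all k steps together must remain in the gap before the
  period.\<close>

lemma bump_family_T:
  assumes p: "1 < p" and k: "0 < k"
  shows "\<exists>B U S E h m. shift_invariant_Lp.bump_family circle_measure periodic_borel p k B U S E h m"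
proof -
  interpret shift_invariant_Lp circle_measure periodic_borel p
    by (rule shift_invariant_Lp_T[OF p])
  define w :: real where "w = 2 * real k + 1"
  have w: "1 \<le> w" "real k \<le> w" by (auto simp: w_def)
  \<comment> \<open>One more factor 1 / w than on Euclidean space: then k steps of length w d add up
    to at most 1.\<close>
  define d :: "nat \<Rightarrow> real" where "d n = 2 powr (- real n) / w ^ 2" for n
  have d: "0 < d n" for n using w by (simp add: d_def)
  have wd: "w * d n = 2 powr (- real n) / w" for n using w by (simp add: d_def power2_eq_square)
  have d1: "w * d n \<le> 1" "real k * (w * d n) \<le> 1" for n
  proof -
    have "(2::real) powr (- real n) \<le> 2 powr 0" by (intro powr_mono) auto
    then have le: "(2::real) powr (- real n) \<le> 1" by simp
    then show "w * d n \<le> 1" unfolding wd using w by (simp add: field_simps)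
    have "real k * 2 powr (- real n) \<le> w * 1" using w le by (intro mult_mono) auto
    then show "real k * (w * d n) \<le> 1" unfolding wd using w by (simp add: field_simps)
  qed
  \<comment> \<open>The interval [0, r] repeated with period 2 pi.\<close>
  define P :: "real \<Rightarrow> real set" where "P r = (\<Union>j::int. {- (2 * pi * of_int j)..r - 2 * pi * of_int j})" for r
  have P: "x \<in> P r \<longleftrightarrow> (\<exists>j::int. 0 \<le> x + 2 * pi * of_int j \<and> x + 2 * pi * of_int j \<le> r)" for x r
  proof -
    have "x \<in> {- c..r - c} \<longleftrightarrow> 0 \<le> x + c \<and> x + c \<le> r" for c by auto
    then show ?thesis by (simp add: P_def del: atLeastAtMost_iff)
  qed
  have P_meas: "P r \<in> sets borel" for r unfolding P_def by measurable
  have P_per: "x + 2 * pi \<in> P r \<longleftrightarrow> x \<in> P r" for x r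
  proof
    assume "x + 2 * pi \<in> P r"
    then obtain j :: int where "0 \<le> x + 2 * pi + 2 * pi * of_int j" "x + 2 * pi + 2 * pi * of_int j \<le> r" by (auto simp: P)
    then show "x \<in> P r" unfolding P by (intro exI[of _ "j + 1"]) (simp add: algebra_simps)
  next
    assume "x \<in> P r"
    then obtain j :: int where "0 \<le> x + 2 * pi * of_int j" "x + 2 * pi * of_int j \<le> r" by (auto simp: P)
    then show "x + 2 * pi \<in> P r" unfolding P by (intro exI[of _ "j - 1"]) (simp add: algebra_simps)
  qed
  \<comment> \<open>For r <= 1 and x in [-1, 2 pi) no other copy of the interval can contain x,
    because 2 pi - 1 > 1. This covers the points reached by the steps to the left.\<close>
  have P_near: "x \<in> P r \<longleftrightarrow> 0 \<le> x \<and> x \<le> r" if "r \<le> 1" "-1 \<le> x" "x < 2 * pi" for x r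
  proof
    assume "x \<in> P r"
    then obtain j :: int where j: "0 \<le> x + 2 * pi * of_int j" "x + 2 * pi * of_int j \<le> r" by (auto simp: P)
    have pi: "3 < pi" by (rule pi_gt3)
    have "j = 0"
    proof (rule ccontr)
      assume "j \<noteq> 0"
      then consider "1 \<le> j" | "j \<le> -1" by linarith
      then show False
      proof cases
        case 1
        then have "2 * pi * 1 \<le> 2 * pi * of_int j" using pi by (intro mult_left_mono) auto
        then show False using j that pi by linarith
      next
        case 2
        then have "2 * pi * of_int j \<le> 2 * pi * (-1)" using pi by (intro mult_left_mono) auto
        then show False using j that pi by linarith
      qed
    qed
    then show "0 \<le> x \<and> x \<le> r" using j by simp
  next
    assume "0 \<le> x \<and> x \<le> r"
    then show "x \<in> P r" unfolding P by (intro exI[of _ 0]) simp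
  qed
  define A where "A n = P ((real k + 1) * d n)" for n
  have A: "A n \<in> sets borel" for n by (simp add: A_def P_meas)
  define U where "U n = spline k (d n) (A n)" for n
  define S where "S n = P (w * d n)" for n
  define E where "E n = {real k * d n..(real k + 1) * d n}" for n
  define h :: "nat \<Rightarrow> real" where "h n = - (w * d n)" for n
  \<comment> \<open>From 4 / d = 4 w^2 2^n in the smoothness bound of the spline; it also exceeds
    \<open>w\<close>, the quotient of the lengths of support and plateau.\<close>
  define B where "B = 4 * w ^ 2"
  have w2: "w * 1 \<le> w * w" using w by (intro mult_left_mono) auto
  have B: "0 < B" "w \<le> B" using w w2 by (auto simp: B_def power2_eq_square)
  have E_sub: "E n \<subseteq> {0..<2 * pi}" for n
  proof -
    have "(real k + 1) * d n \<le> w * d n" using d[of n] by (intro mult_right_mono) (auto simp: w_def)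
    then have "(real k + 1) * d n < 2 * pi" using d1[of n] pi_gt3 by linarith
    moreover have "0 \<le> real k * d n" using d[of n] by simp
    ultimately have "0 \<le> x \<and> x < 2 * pi" if "real k * d n \<le> x" "x \<le> (real k + 1) * d n" for x
      using that by linarith
    then show ?thesis by (simp add: E_def subset_iff)
  qed
  have U_0: "U n x = 0" if "x \<notin> S n" for n x
    unfolding U_def
  proof (rule spline_eq_0[OF d])
    show "{x - real k * d n..x} \<inter> A n = {}"
    proof (rule ccontr)
      assume "{x - real k * d n..x} \<inter> A n \<noteq> {}"
      then obtain z and j :: int where z: "x - real k * d n \<le> z" "z \<le> x"
        "0 \<le> z + 2 * pi * of_int j" "z + 2 * pi * of_int j \<le> (real k + 1) * d n"
        by (auto simp: A_def P)
      have "w * d n = (real k + 1) * d n + real k * d n" by (simp add: w_def algebra_simps)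
      then have "x \<in> S n" unfolding S_def P using z by (intro exI[of _ j]) linarith
      then show False using that by simp
    qed
  qed
  have "bump_family k B U S E h d"
    unfolding bump_family_def
  proof (intro conjI allI B(1))
    fix n
    have "U n (x + 2 * pi) = U n x" for x
      unfolding U_def by (rule spline_periodic) (simp add: A_def P_per)
    then show "(\<lambda>x. complex_of_real (U n x)) \<in> periodic_borel"
      using spline_measurable[OF A, of k "d n" n] by (simp add: periodic_borel_def U_def)
    show "(\<lambda>x. indicator (S n) x :: complex) \<in> periodic_borel"
      using P_meas by (auto simp: periodic_borel_def S_def P_per indicator_def)
    show "0 < d n" by (rule d)
    have sp: "space circle_measure = {0..<2 * pi}" by (simp add: circle_measure_def space_restrict_space)
    show "E n \<in> sets circle_measure"
      unfolding circle_measure_def using E_sub[of n] by (subst sets_restrict_space_iff) (auto simp: E_def)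
    have emc: "emeasure circle_measure C = emeasure lborel C" if "C \<subseteq> {0..<2 * pi}" for C
      unfolding circle_measure_def using that by (intro emeasure_restrict_space) auto
    have "{0..w * d n} \<subseteq> {0..<2 * pi}"
      using d1[of n] pi_gt3 by auto
    then have "emeasure circle_measure {0..w * d n} = ennreal (w * d n)"
      using w d[of n] by (simp add: emc)
    moreover have "{0..w * d n} \<in> sets circle_measure"
      unfolding circle_measure_def using \<open>{0..w * d n} \<subseteq> {0..<2 * pi}\<close>
      by (subst sets_restrict_space_iff) auto
    moreover have "Lp_norm circle_measure p (indicator (S n)) = Lp_norm circle_measure p (indicator {0..w * d n})"
    proof (rule Lp_norm_cong)
      fix x assume "x \<in> space circle_measure"
      then have "x \<in> S n \<longleftrightarrow> x \<in> {0..w * d n}" unfolding S_def sp using P_near[OF d1(1), of x n] by auto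
      then show "norm (indicator (S n) x :: complex) = norm (indicator {0..w * d n} x :: complex)"
        by (simp add: indicator_def)
    qed
    ultimately have "Lp_norm circle_measure p (indicator (S n)) = ennreal ((w * d n) powr (1 / p))"
      using p w d[of n] by (simp add: Lp_norm_indicator)
    also have "(w * d n) powr (1 / p) = w powr (1 / p) * d n powr (1 / p)"
      using w d[of n] by (simp add: powr_mult)
    also have "\<dots> \<le> B * d n powr (1 / p)"
    proof (rule mult_right_mono)
      have "w powr (1 / p) \<le> w powr 1" using p w by (intro powr_mono) auto
      then show "w powr (1 / p) \<le> B" using w B by simp
    qed simp
    finally show "Lp_norm circle_measure p (indicator (S n)) \<le> ennreal (B * d n powr (1 / p))"
      by (simp add: ennreal_leI)
    have "emeasure circle_measure (E n) = ennreal (d n)"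
      unfolding emc[OF E_sub] unfolding E_def using d[of n] by (subst emeasure_lborel_Icc) (auto simp: algebra_simps)
    then show "ennreal (d n) \<le> emeasure circle_measure (E n)" by simp
    show "norm (h n) \<le> 2 powr (- real n)"
      using w d[of n] by (simp add: h_def wd field_simps)
    fix x
    show "0 \<le> U n x" "U n x \<le> 1" unfolding U_def by (rule spline_bounds[OF A])+
    show "x \<notin> S n \<longrightarrow> U n x = 0" using U_0 by blast
    fix v :: real
    have "\<bar>(rdiff v ^^ k) (U n) x\<bar> \<le> (4 * \<bar>v\<bar> / d n) ^ k"
      unfolding U_def by (rule spline_rdiff_bound[OF d A order_refl])
    also have "4 * \<bar>v\<bar> / d n = B * 2 powr real n * norm v"
      using w by (simp add: B_def d_def powr_minus field_simps)
    finally show "norm ((diff1 v ^^ k) (\<lambda>x. complex_of_real (U n x)) x) \<le> (B * 2 powr real n * norm v) ^ k"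
      unfolding diff1_of_real by simp
  next
    fix n
    show "\<forall>x\<in>E n. U n x = 1"
    proof
      fix x assume x: "x \<in> E n"
      have "z \<in> A n" if "x - real k * d n \<le> z" "z \<le> x" for z
        unfolding A_def P using that x by (intro exI[of _ 0]) (auto simp: E_def)
      then show "U n x = 1" unfolding U_def by (intro spline_eq_1 d) auto
    qed
    show "\<forall>x\<in>E n. \<forall>i j. 1 \<le> i \<longrightarrow> i \<le> k \<longrightarrow> U j (x + real i *\<^sub>R h n) = 0"
    proof (intro ballI allI impI)
      fix x i j assume x: "x \<in> E n" and i: "1 \<le> i" "i \<le> k"
      let ?y = "x + real i *\<^sub>R h n"
      have y: "?y = x - real i * (w * d n)" by (simp add: h_def)
      have "x \<le> (real k + 1) * d n" "0 \<le> x" using x E_sub[of n] by (auto simp: E_def)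
      moreover have "1 * (w * d n) \<le> real i * (w * d n)" using i w d[of n] by (intro mult_right_mono) auto
      moreover have "real i * (w * d n) \<le> real k * (w * d n)" using i w d[of n] by (intro mult_right_mono) auto
      moreover have "(real k + 1) * d n < w * d n"
        using k d[of n] by (intro mult_strict_right_mono) (auto simp: w_def)
      ultimately have "-1 \<le> ?y" "?y < 0" unfolding y using d1(2)[of n] by linarith+
      moreover have "?y < 2 * pi" using \<open>?y < 0\<close> pi_gt_zero by linarith
      ultimately have "?y \<notin> S j" unfolding S_def using P_near[OF d1(1), of ?y j] by simp
      then show "U j ?y = 0" by (rule U_0)
    qed
  qed
  then show ?thesis by blast
qed

theorem proposition6p3:
  fixes p s0 s1 b0 b1 :: real and q0 q1 :: ennreal and k0 k1 :: nat
  assumes "1 < p"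
    and "0 < q0" and "0 < q1"
    and "0 \<le> s0" and "0 \<le> s1"
    and "s0 = 0 \<Longrightarrow> b0 \<ge> - recip q0"
    and "s1 = 0 \<Longrightarrow> b1 \<ge> - recip q1"
    and "s0 < real k0" and "s1 < real k1"
  shows
    "(continuously_embedded
        (besov_Rd p q0 s0 b0 k0 :: (real^'d \<Rightarrow> complex) set) (besov_norm_Rd p q0 s0 b0 k0)
        (besov_Rd p q1 s1 b1 k1) (besov_norm_Rd p q1 s1 b1 k1)
      \<longleftrightarrow>
        s0 > s1
      \<or> (s0 = s1 \<and> s1 > 0 \<and> q0 \<le> q1 \<and> b0 \<ge> b1)
      \<or> (s0 = s1 \<and> s1 > 0 \<and> q0 > q1 \<and> b0 + recip q0 > b1 + recip q1)
      \<or> (s0 = s1 \<and> s1 = 0 \<and> b0 + recip q0 > b1 + recip q1)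
      \<or> (s0 = s1 \<and> s1 = 0 \<and> b0 + recip q0 = b1 + recip q1 \<and> q0 \<le> q1))
   \<and> (continuously_embedded
        (besov_T p q0 s0 b0 k0) (besov_norm_T p q0 s0 b0 k0)
        (besov_T p q1 s1 b1 k1) (besov_norm_T p q1 s1 b1 k1)
      \<longleftrightarrow>
        s0 > s1
      \<or> (s0 = s1 \<and> s1 > 0 \<and> q0 \<le> q1 \<and> b0 \<ge> b1)
      \<or> (s0 = s1 \<and> s1 > 0 \<and> q0 > q1 \<and> b0 + recip q0 > b1 + recip q1)
      \<or> (s0 = s1 \<and> s1 = 0 \<and> b0 + recip q0 > b1 + recip q1)
      \<or> (s0 = s1 \<and> s1 = 0 \<and> b0 + recip q0 = b1 + recip q1 \<and> q0 \<le> q1))"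
proof (rule conjI, goal_cases)
  have k: "0 < max k0 k1" using assms by auto
  case 1
  interpret shift_invariant_Lp "lborel :: (real^'d) measure" "borel_measurable lborel" p
    by (rule shift_invariant_Lp_Rd[OF assms(1)])
  have "besov_Rd p q s b k = besov_set q s b k" for q s b k
    unfolding besov_Rd_def besov_set_def Lp_Rd_def by auto
  then show ?case
    using continuously_embedded_iff_embedding_condition[OF assms(2-9) bump_family_Rd[OF assms(1) k]]
    unfolding embedding_condition_def by simp
next
  have k: "0 < max k0 k1" using assms by auto
  case 2
  interpret shift_invariant_Lp circle_measure periodic_borel p
    by (rule shift_invariant_Lp_T[OF assms(1)])
  have "besov_T p q s b k = besov_set q s b k" for q s b k
    unfolding besov_T_def besov_set_def by (auto simp: Lp_T_def periodic_borel_def)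
  then show ?case
    using continuously_embedded_iff_embedding_condition[OF assms(2-9) bump_family_T[OF assms(1) k]]
    unfolding embedding_condition_def by simp
qed

end
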